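(* If $G$ is a planar graph with maximum degree $\Delta\ge 32$ that contains neither $4$-cycles nor $5$-cycles, then $\chi_{\ell}(G^2)\le \Delta+3$. In fact, this bound holds also for paintability: $\chi_p(G^2)\le \Delta+3$.
   Context: Graphs are finite and simple. "Contains no $k$-cycle" means there is no cycle of length $k$ as a (not necessarily induced) subgraph. The square $G^2$ of a graph $G$ is formed from $G$ by adding an edge between each pair of vertices at distance two in $G$. A list assignment $L$ assigns to each vertex $v$ a set $L(v)$ of allowable colors. An $L$-coloring is a proper coloring $f$ with $f(v)\in L(v)$ for every vertex $v$. A graph is $k$-choosable if it has an $L$-coloring whenever $|L(v)|=k$ for every vertex $v$. The list chromatic number $\chi_\ell$ of a graph is the least $k$ such that it is $k$-choosable. The game of $k$-paintability (online list $k$-coloring) on a graph is played by two players, Lister and Painter. In each round $i$, Lister presents to Painter some nonempty set of uncolored vertices. Painter chooses an independent subset of the presented vertices to receive color $i$ (these vertices are then colored). If Lister lists some particular vertex $k$ times and Painter never paints it, then Lister wins; otherwise Painter wins. A graph is $k$-paintable if Painter has a winning strategy, and the paint number $\chi_p$ of a graph is the least $k$ such that it is $k$-paintable. *)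

theory Defs
  imports "HOL-Analysis.Analysis" "Graph_Theory.Graph_Theory"
begin

text \<open>
  A finite simple graph is a \<open>pair_graph\<close>, i.e. an irreflexive symmetric arc relation on a finite
  vertex set: each undirected edge is represented by its two opposite arcs.
\<close>

definition planar :: "'a pair_pre_digraph \<Rightarrow> bool" where
  "planar G \<longleftrightarrow> (\<exists>(\<phi> :: 'a \<Rightarrow> complex) (\<gamma> :: 'a set \<Rightarrow> real \<Rightarrow> complex).
     inj_on \<phi> (pverts G) \<and>
     (\<forall>(u, v) \<in> parcs G.
        Path_Connected.arc (\<gamma> {u, v}) \<and>
        {pathstart (\<gamma> {u, v}), pathfinish (\<gamma> {u, v})} = {\<phi> u, \<phi> v} \<and>
        path_image (\<gamma> {u, v}) \<inter> \<phi> ` pverts G = {\<phi> u, \<phi> v}) \<and>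
     (\<forall>(u, v) \<in> parcs G. \<forall>(x, y) \<in> parcs G. {u, v} \<noteq> {x, y} \<longrightarrow>
        path_image (\<gamma> {u, v}) \<inter> path_image (\<gamma> {x, y}) = \<phi> ` ({u, v} \<inter> {x, y})))"

text \<open>
  In a symmetric digraph a pair of opposite arcs is a directed cycle of length 2; for \<open>k \<ge> 3\<close> the
  directed cycles of length \<open>k\<close> are the traversals of the undirected \<open>k\<close>-cycles.
\<close>
definition contains_cycle :: "'a pair_pre_digraph \<Rightarrow> nat \<Rightarrow> bool" where
  "contains_cycle G k \<longleftrightarrow> (\<exists>p. pre_digraph.cycle (with_proj G) p \<and> length p = k)"

text \<open>The inserted 0 only matters for the graph without vertices.\<close>
definition max_degree :: "'a pair_pre_digraph \<Rightarrow> nat" where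
  "max_degree G = Max (insert 0 (out_degree (with_proj G) ` pverts G))"

text \<open>The \<open>\<mu>\<close> of the library, taken with unit weights, is the distance.\<close>
definition square :: "'a pair_pre_digraph \<Rightarrow> 'a pair_pre_digraph" where
  "square G = \<lparr> pverts = pverts G,
     parcs = parcs G \<union>
       {(u, v) \<in> pverts G \<times> pverts G. wf_digraph.\<mu> (with_proj G) (\<lambda>_. 1) u v = 2} \<rparr>"

definition list_coloring :: "'a pair_pre_digraph \<Rightarrow> ('a \<Rightarrow> 'c set) \<Rightarrow> ('a \<Rightarrow> 'c) \<Rightarrow> bool" where
  "list_coloring G L f \<longleftrightarrow>
     (\<forall>v \<in> pverts G. f v \<in> L v) \<and> (\<forall>(u, v) \<in> parcs G. f u \<noteq> f v)"

text \<open>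
  Colors are natural numbers: for finite \<open>G\<close> the finitely many colors occurring in a list assignment
  can always be renamed injectively.
\<close>
definition choosable :: "'a pair_pre_digraph \<Rightarrow> nat \<Rightarrow> bool" where
  "choosable G k \<longleftrightarrow> (\<forall>L :: 'a \<Rightarrow> nat set.
     (\<forall>v \<in> pverts G. finite (L v) \<and> card (L v) = k) \<longrightarrow> (\<exists>f. list_coloring G L f))"

definition list_chromatic_number :: "'a pair_pre_digraph \<Rightarrow> nat" where
  "list_chromatic_number G = (LEAST k. choosable G k)"

definition independent_set :: "'a pair_pre_digraph \<Rightarrow> 'a set \<Rightarrow> bool" where
  "independent_set G I \<longleftrightarrow> I \<subseteq> pverts G \<and> (\<forall>u \<in> I. \<forall>v \<in> I. (u, v) \<notin> parcs G)"

text \<open>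
  A history is the list of vertex sets presented by Lister so far, oldest first. A Painter strategy
  \<open>\<sigma>\<close> maps a nonempty history to the set painted in its last round; Painter's earlier moves are
  determined by \<open>\<sigma>\<close> and the shorter histories.
\<close>
type_synonym 'a painter_strategy = "'a set list \<Rightarrow> 'a set"

definition painted :: "'a painter_strategy \<Rightarrow> 'a set list \<Rightarrow> 'a set" where
  "painted \<sigma> Ss = (\<Union>i < length Ss. \<sigma> (take (Suc i) Ss))"

definition legal_history :: "'a pair_pre_digraph \<Rightarrow> 'a painter_strategy \<Rightarrow> 'a set list \<Rightarrow> bool" where
  "legal_history G \<sigma> Ss \<longleftrightarrow>
     (\<forall>i < length Ss. Ss ! i \<noteq> {} \<and> Ss ! i \<subseteq> pverts G - painted \<sigma> (take i Ss))"

definition times_listed :: "'a \<Rightarrow> 'a set list \<Rightarrow> nat" where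
  "times_listed v Ss = card {i. i < length Ss \<and> v \<in> Ss ! i}"

text \<open>
  Lister wins at the end of the first round after which some vertex has been presented \<open>k\<close> times and
  is unpainted, so Painter wins a play iff this happens after none of its finite initial segments.
\<close>
definition lister_has_won ::
  "'a pair_pre_digraph \<Rightarrow> nat \<Rightarrow> 'a painter_strategy \<Rightarrow> 'a set list \<Rightarrow> bool" where
  "lister_has_won G k \<sigma> Ss \<longleftrightarrow>
     (\<exists>v \<in> pverts G. k \<le> times_listed v Ss \<and> v \<notin> painted \<sigma> Ss)"

definition winning_painter_strategy ::
  "'a pair_pre_digraph \<Rightarrow> nat \<Rightarrow> 'a painter_strategy \<Rightarrow> bool" where
  "winning_painter_strategy G k \<sigma> \<longleftrightarrow> (\<forall>Ss. legal_history G \<sigma> Ss \<longrightarrow>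
     (Ss \<noteq> [] \<longrightarrow> \<sigma> Ss \<subseteq> last Ss \<and> independent_set G (\<sigma> Ss)) \<and>
     \<not> lister_has_won G k \<sigma> Ss)"

definition paintable :: "'a pair_pre_digraph \<Rightarrow> nat \<Rightarrow> bool" where
  "paintable G k \<longleftrightarrow> (\<exists>\<sigma>. winning_painter_strategy G k \<sigma>)"

definition paint_number :: "'a pair_pre_digraph \<Rightarrow> nat" where
  "paint_number G = (LEAST k. paintable G k)"

end

theory Submission
  imports Defs
begin

text \<open>
  The square of \<open>G\<close> is coloured greedily: with \<open>k = \<Delta>\<close>, its vertices can be ordered so that each has
  at most \<open>k + 2\<close> earlier neighbours in the square. Let \<open>S\<close> be a maximal set of vertices that can be
  put last in such an order. If \<open>S\<close> contains an edge, a leaf, or a vertex of degree 2 on a triangle,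
  then deleting that edge, or all edges at that vertex, changes no distance that matters outside
  \<open>S\<close>, and induction on the number of edges applies. Otherwise every vertex outside \<open>S\<close> has at least
  \<open>k + 3\<close> neighbours in the square besides those in \<open>S\<close>, and discharging with initial charge
  \<open>2 d(v) - 6\<close> at a vertex and \<open>-3\<close> at a triangle shows \<open>4 |E| \<ge> 6 |V| + 3 t\<close> for the number \<open>t\<close> of
  triangles. This contradicts Euler's formula, as without 4- and 5-cycles a face has at least six
  edges on its boundary or contains a triangle there. For the topological part, the Jordan curve
  theorem bounds the number of faces from below, and Janiszewski's theorem shows that an edge is on
  the boundary of at most two of them.
\<close>

section \<open>Edge sets, paths and forests\<close>

text \<open>Deleting a vertex can push two of its neighbours further apart, so a vertex with few
  neighbours in the square cannot simply be removed for an induction. This is why the vertices of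
  \<open>S\<close> are postponed but stay in the graph: they still serve as middle vertices of paths
  of length two. One order serves both bounds: a vertex with at most \<open>k + 2\<close> earlier
  neighbours in the square loses at most that many of its \<open>k + 3\<close> colours, and in the
  game it is passed over at most that many times.

  The constants come from Euler's formula. With V, E, F, t for the numbers of vertices, edges, faces
  and triangles, six boundary edges per face, up to a deficit of 3 for each triangle, mean 6 F <= 2
  E + 3 t, hence 4 E < 6 V + 3 t; and 4 E - 6 V - 3 t is the total initial charge. The graph may be
  disconnected and have bridges, so the boundary of a face is handled as a bare set of edges and not
  as a closed walk. What matters is that this set contains a cycle as soon as there are two
  faces.\<close>

definition edge_conn :: "'a set set \<Rightarrow> 'a rel" where
  "edge_conn E = {(x, y). {x, y} \<in> E}\<^sup>*"

text \<open>The edges that are not bridges. Whether \<open>e\<close> lies on a cycle is read off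
  from the connection of its ends without \<open>e\<close>, so no cycle has to be named.\<close>

definition cycle_edge :: "'a set set \<Rightarrow> 'a set \<Rightarrow> bool" where
  "cycle_edge E e \<longleftrightarrow> e \<in> E \<and> (\<exists>u v. e = {u, v} \<and> u \<noteq> v \<and> (u, v) \<in> edge_conn (E - {e}))"

definition edge_forest :: "'a set set \<Rightarrow> bool" where
  "edge_forest E \<longleftrightarrow> (\<forall>e. \<not> cycle_edge E e)"

fun path_edges :: "'a list \<Rightarrow> 'a set set" where
  "path_edges (x # y # vs) = insert {x, y} (path_edges (y # vs))"
| "path_edges vs = {}"

lemma edge_conn_refl [simp]: "(u, u) \<in> edge_conn E"
  by (simp add: edge_conn_def)

lemma edge_conn_step: "(u, v) \<in> edge_conn E \<Longrightarrow> {v, w} \<in> E \<Longrightarrow> (u, w) \<in> edge_conn E"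
  unfolding edge_conn_def by (erule rtrancl_into_rtrancl) simp

lemma edge_conn_mono: "E \<subseteq> E' \<Longrightarrow> edge_conn E \<subseteq> edge_conn E'"
  unfolding edge_conn_def by (rule rtrancl_mono) auto

lemma cycle_edge_mono: "cycle_edge E e \<Longrightarrow> E \<subseteq> E' \<Longrightarrow> cycle_edge E' e"
  unfolding cycle_edge_def using edge_conn_mono[of "E - {e}" "E' - {e}"] by blast

lemma edge_forest_subset: "edge_forest E' \<Longrightarrow> E \<subseteq> E' \<Longrightarrow> edge_forest E"
  unfolding edge_forest_def using cycle_edge_mono by blast

lemma path_edges_subset: "e \<in> path_edges vs \<Longrightarrow> e \<subseteq> set vs"
  by (induction vs rule: path_edges.induct) auto

lemma finite_path_edges: "finite (path_edges vs)"
  by (induction vs rule: path_edges.induct) auto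

lemma card_path_edges: "distinct vs \<Longrightarrow> card (path_edges vs) = length vs - 1"
proof (induction vs rule: path_edges.induct)
  case (1 x y vs)
  have "{x, y} \<notin> path_edges (y # vs)"
    using path_edges_subset[of "{x, y}" "y # vs"] 1 by auto
  then show ?case using 1 by (simp add: finite_path_edges)
qed auto

lemma path_edges_snoc: "vs \<noteq> [] \<Longrightarrow> path_edges (vs @ [z]) = insert {last vs, z} (path_edges vs)"
  by (induction vs rule: path_edges.induct) auto

lemma path_edges_append: "path_edges vs \<subseteq> path_edges (vs @ ws)"
  by (induction vs rule: path_edges.induct) auto

lemma edge_conn_path:
  assumes "(u, v) \<in> edge_conn E"
  obtains vs where "distinct vs" "vs \<noteq> []" "hd vs = u" "last vs = v" "path_edges vs \<subseteq> E"
proof -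
  from assms[unfolded edge_conn_def]
  have "\<exists>vs. distinct vs \<and> vs \<noteq> [] \<and> hd vs = u \<and> last vs = v \<and> path_edges vs \<subseteq> E"
  proof (induction rule: rtrancl_induct)
    case base
    show ?case by (rule exI[of _ "[u]"]) simp
  next
    case (step y z)
    then obtain vs where vs: "distinct vs" "vs \<noteq> []" "hd vs = u" "last vs = y" "path_edges vs \<subseteq> E"
      by blast
    show ?case
    proof (cases "z \<in> set vs")
      case True
      then obtain as bs where ab: "vs = as @ z # bs" by (meson split_list)
      show ?thesis
        using vs path_edges_append[of "as @ [z]" bs] ab
        by (intro exI[of _ "as @ [z]"]) (auto simp: hd_append)
    next
      case False
      then show ?thesis
        using vs step(2) by (intro exI[of _ "vs @ [z]"]) (auto simp: path_edges_snoc)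
    qed
  qed
  with that show thesis by blast
qed

lemma cycle_edge_path:
  assumes "cycle_edge E e"
  obtains u v vs where "e = {u, v}" "u \<noteq> v" "distinct vs" "hd vs = u" "last vs = v"
    "path_edges vs \<subseteq> E - {e}" "3 \<le> length vs"
proof -
  obtain u v where uv: "e = {u, v}" "u \<noteq> v" "(u, v) \<in> edge_conn (E - {e})"
    using assms unfolding cycle_edge_def by blast
  obtain vs where vs: "distinct vs" "vs \<noteq> []" "hd vs = u" "last vs = v" "path_edges vs \<subseteq> E - {e}"
    using edge_conn_path[OF uv(3)] by blast
  \<comment> \<open>A path on two vertices would consist of \<open>e\<close> itself.\<close>
  have "3 \<le> length vs"
  proof (cases vs rule: path_edges.cases)
    case (1 x y ws)
    then show ?thesis using vs uv by (cases ws) auto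
  qed (use vs uv in auto)
  then show thesis using that uv vs by blast
qed

text \<open>Without a bridge \<open>e\<close>, no edge leaves the component \<open>C\<close> of one
  end. So the other edges fall into a forest on \<open>V \<inter> C\<close> and one on
  \<open>V - C\<close>, and both vertex sets are nonempty.\<close>

lemma card_edge_forest:
  assumes "finite V" "V \<noteq> {}" "edge_forest E" "\<And>e. e \<in> E \<Longrightarrow> e \<subseteq> V \<and> card e = 2"
  shows "finite E \<and> card E < card V"
  using assms
proof (induction "card V" arbitrary: V E rule: less_induct)
  case less
  show ?case
  proof (cases "E = {}")
    case True
    then show ?thesis using less.prems by (simp add: card_gt_0_iff)
  next
    case False
    then obtain e where e: "e \<in> E" by blast
    then obtain u v where uv: "e = {u, v}" "u \<noteq> v" "u \<in> V" "v \<in> V"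
      using less.prems(4)[OF e] by (auto simp: card_2_iff)
    define C where "C = {x. (u, x) \<in> edge_conn (E - {e})}"
    have "v \<notin> C"
      using less.prems(3) e uv unfolding edge_forest_def cycle_edge_def C_def by blast
    have "u \<in> C" by (simp add: C_def)
    define E1 where "E1 = {f \<in> E - {e}. f \<subseteq> C}"
    define E2 where "E2 = {f \<in> E - {e}. f \<inter> C = {}}"
    have E: "E = insert e (E1 \<union> E2)"
    proof -
      have "f \<subseteq> C \<or> f \<inter> C = {}" if "f \<in> E - {e}" for f
      proof -
        obtain x y where f: "f = {x, y}" using less.prems(4)[of f] \<open>f \<in> E - {e}\<close>
          by (auto simp: card_2_iff)
        have "x \<in> C \<longleftrightarrow> y \<in> C"
          using that edge_conn_step[of u x "E - {e}" y] edge_conn_step[of u y "E - {e}" x]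
          by (auto simp: f C_def insert_commute)
        then show ?thesis using f by auto
      qed
      then show ?thesis using e unfolding E1_def E2_def by blast
    qed
    have 1: "finite E1 \<and> card E1 < card (V \<inter> C)"
    proof (rule less.hyps)
      show "card (V \<inter> C) < card V"
        by (rule psubset_card_mono) (use less.prems(1) uv \<open>v \<notin> C\<close> in auto)
      show "edge_forest E1" by (rule edge_forest_subset[OF less.prems(3)]) (auto simp: E1_def)
      show "V \<inter> C \<noteq> {}" using uv \<open>u \<in> C\<close> by blast
    qed (use less.prems in \<open>auto simp: E1_def\<close>)
    have 2: "finite E2 \<and> card E2 < card (V - C)"
    proof (rule less.hyps)
      show "card (V - C) < card V"
        by (rule psubset_card_mono) (use less.prems(1) uv \<open>u \<in> C\<close> in auto)
      show "edge_forest E2" by (rule edge_forest_subset[OF less.prems(3)]) (auto simp: E2_def)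
      show "V - C \<noteq> {}" using uv \<open>v \<notin> C\<close> by blast
    qed (use less.prems(1,4) in \<open>auto simp: E2_def\<close>)
    have "card V = card (V \<inter> C) + card (V - C)"
      using less.prems(1) by (metis card_Diff_subset_Int card_mono finite_Int inf_le1 le_add_diff_inverse)
    moreover have "card E \<le> Suc (card E1 + card E2)"
    proof -
      have "card E \<le> Suc (card (E1 \<union> E2))" unfolding E by (rule card_insert_le_m1) auto
      then show ?thesis using card_Un_le[of E1 E2] by linarith
    qed
    moreover have "finite E" using 1 2 unfolding E by simp
    ultimately show ?thesis using 1 2 by linarith
  qed
qed

section \<open>Plane drawings\<close>

text \<open>The vertices are the elements of the edges; with no separate vertex set, a subset of the
  edges is again a plane graph for the same \<open>\<phi>\<close> and
  \<open>\<gamma>\<close>.\<close>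

locale plane_graph =
  fixes E :: "'a set set" and \<phi> :: "'a \<Rightarrow> complex" and \<gamma> :: "'a set \<Rightarrow> real \<Rightarrow> complex"
  assumes finite_edges: "finite E"
    and card_edge: "e \<in> E \<Longrightarrow> card e = 2"
    and inj_vertices: "inj_on \<phi> (\<Union>E)"
    and arc_edge: "e \<in> E \<Longrightarrow> Path_Connected.arc (\<gamma> e)"
    and ends_edge: "e \<in> E \<Longrightarrow> {pathstart (\<gamma> e), pathfinish (\<gamma> e)} = \<phi> ` e"
    and edges_meet: "e \<in> E \<Longrightarrow> e' \<in> E \<Longrightarrow> e \<noteq> e' \<Longrightarrow>
      path_image (\<gamma> e) \<inter> path_image (\<gamma> e') = \<phi> ` (e \<inter> e')"
begin

definition drawing :: "'a set set \<Rightarrow> complex set" where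
  "drawing H = (\<Union>e \<in> H. path_image (\<gamma> e))"

definition edge_interior :: "'a set \<Rightarrow> complex set" where
  "edge_interior e = path_image (\<gamma> e) - \<phi> ` e"

lemma drawing_empty [simp]: "drawing {} = {}"
  by (simp add: drawing_def)

lemma drawing_Un: "drawing (A \<union> B) = drawing A \<union> drawing B"
  by (auto simp: drawing_def)

lemma drawing_insert: "drawing (insert e A) = path_image (\<gamma> e) \<union> drawing A"
  by (auto simp: drawing_def)

lemma drawing_mono: "A \<subseteq> B \<Longrightarrow> drawing A \<subseteq> drawing B"
  by (auto simp: drawing_def)

lemma compact_drawing: "H \<subseteq> E \<Longrightarrow> compact (drawing H)"
  unfolding drawing_def using finite_edges arc_edge
  by (intro compact_UN) (auto intro: finite_subset compact_arc_image)

lemma open_drawing_complement: "H \<subseteq> E \<Longrightarrow> open (- drawing H)"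
  using compact_drawing compact_imp_closed by blast

lemma vertices_subset_edge: "e \<in> E \<Longrightarrow> \<phi> ` e \<subseteq> path_image (\<gamma> e)"
  using ends_edge[of e] by (metis insert_subset pathfinish_in_path_image pathstart_in_path_image empty_subsetI)

lemma plane_subgraph: "H \<subseteq> E \<Longrightarrow> plane_graph H \<phi> \<gamma>"
  using finite_subset[OF _ finite_edges] card_edge inj_on_subset[OF inj_vertices Union_mono]
    arc_edge ends_edge edges_meet
  by unfold_locales (simp_all add: subsetD)

lemma edge_interior_eq: "e \<in> E \<Longrightarrow> edge_interior e = path_image (\<gamma> e) - {pathstart (\<gamma> e), pathfinish (\<gamma> e)}"
  using ends_edge by (simp add: edge_interior_def)

lemma connected_edge_interior: "e \<in> E \<Longrightarrow> Topological_Spaces.connected (edge_interior e)"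
  by (simp add: edge_interior_eq connected_simple_path_endless arc_imp_simple_path arc_edge)

lemma nonempty_edge_interior: "e \<in> E \<Longrightarrow> edge_interior e \<noteq> {}"
  using nonempty_simple_path_endless[OF arc_imp_simple_path[OF arc_edge]] by (simp add: edge_interior_eq)

lemma edge_interior_disjoint: "e \<in> E \<Longrightarrow> H \<subseteq> E \<Longrightarrow> e \<notin> H \<Longrightarrow> edge_interior e \<inter> drawing H = {}"
  unfolding edge_interior_def drawing_def using edges_meet by blast

lemma drawing_Int:
  assumes "A \<subseteq> E" "B \<subseteq> E" "A \<inter> B = {}"
  shows "drawing A \<inter> drawing B = \<phi> ` (\<Union>A \<inter> \<Union>B)"
proof
  show "drawing A \<inter> drawing B \<subseteq> \<phi> ` (\<Union>A \<inter> \<Union>B)"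
  proof
    fix p assume "p \<in> drawing A \<inter> drawing B"
    then obtain e f where ef: "e \<in> A" "f \<in> B" "p \<in> path_image (\<gamma> e) \<inter> path_image (\<gamma> f)"
      by (auto simp: drawing_def)
    moreover have "e \<noteq> f" using ef assms by blast
    ultimately have "p \<in> \<phi> ` (e \<inter> f)" using edges_meet[of e f] assms by blast
    then show "p \<in> \<phi> ` (\<Union>A \<inter> \<Union>B)" using ef by blast
  qed
  show "\<phi> ` (\<Union>A \<inter> \<Union>B) \<subseteq> drawing A \<inter> drawing B"
  proof clarify
    fix x A' B' assume "x \<in> A'" "A' \<in> A" "x \<in> B'" "B' \<in> B"
    then have "\<phi> x \<in> path_image (\<gamma> A')" "\<phi> x \<in> path_image (\<gamma> B')"
      using vertices_subset_edge[of A'] vertices_subset_edge[of B'] assms by blast+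
    then show "\<phi> x \<in> drawing A \<inter> drawing B"
      using \<open>A' \<in> A\<close> \<open>B' \<in> B\<close> by (auto simp: drawing_def)
  qed
qed

lemma arc_path_edges:
  assumes "distinct vs" "2 \<le> length vs" "path_edges vs \<subseteq> E"
  shows "\<exists>g. Path_Connected.arc g \<and> path_image g = drawing (path_edges vs) \<and>
    pathstart g = \<phi> (hd vs) \<and> pathfinish g = \<phi> (last vs)"
  using assms
proof (induction vs rule: path_edges.induct)
  case (1 x y vs)
  have e: "{x, y} \<in> E" using 1(4) by simp
  have xy: "x \<noteq> y" using 1(2) by simp
  \<comment> \<open>The arc of an edge may run in either direction.\<close>
  have "pathstart (\<gamma> {x, y}) = \<phi> x \<and> pathfinish (\<gamma> {x, y}) = \<phi> y \<or>
      pathstart (\<gamma> {x, y}) = \<phi> y \<and> pathfinish (\<gamma> {x, y}) = \<phi> x"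
    using ends_edge[OF e] by (auto simp: doubleton_eq_iff)
  then obtain g1 where g1: "Path_Connected.arc g1" "path_image g1 = path_image (\<gamma> {x, y})"
      "pathstart g1 = \<phi> x" "pathfinish g1 = \<phi> y"
  proof
    assume "pathstart (\<gamma> {x, y}) = \<phi> y \<and> pathfinish (\<gamma> {x, y}) = \<phi> x"
    with that[of "reversepath (\<gamma> {x, y})"] show thesis using arc_edge[OF e] by (simp add: arc_reversepath)
  qed (use that arc_edge[OF e] in blast)
  show ?case
  proof (cases vs)
    case Nil
    then show ?thesis using g1 by (intro exI[of _ g1]) (simp add: drawing_insert)
  next
    case (Cons z ws)
    then obtain g2 where g2: "Path_Connected.arc g2" "path_image g2 = drawing (path_edges (y # vs))"
        "pathstart g2 = \<phi> y" "pathfinish g2 = \<phi> (last (y # vs))"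
      using 1(1)[OF _ _] 1(2-4) by (auto simp del: path_edges.simps(1) simp: path_edges.simps(1)[of x])
    have sub: "\<Union>(path_edges (y # vs)) \<subseteq> set (y # vs)"
      using path_edges_subset by (metis Union_least)
    have "{x, y} \<notin> path_edges (y # vs)" using sub 1(2) by auto
    then have "drawing {{x, y}} \<inter> drawing (path_edges (y # vs)) =
        \<phi> ` (\<Union>{{x, y}} \<inter> \<Union>(path_edges (y # vs)))"
      by (intro drawing_Int) (use 1(4) in auto)
    also have "\<dots> \<subseteq> {\<phi> y}" using sub 1(2) by auto
    finally have "path_image g1 \<inter> path_image g2 \<subseteq> {\<phi> y}" using g1 g2 by (simp add: drawing_insert)
    then have "Path_Connected.arc (g1 +++ g2)" using g1 g2 by (intro arc_join) auto
    moreover have "path_image (g1 +++ g2) = drawing (path_edges (x # y # vs))"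
      using g1 g2 by (simp add: path_image_join drawing_insert)
    ultimately show ?thesis using g1 g2
      by (intro exI[of _ "g1 +++ g2"]) simp
  qed
qed auto

text \<open>Gluing in a bridge one end at a time, Janiszewski's theorem applies twice.\<close>

lemma connected_component_bridge:
  assumes H: "H \<subseteq> E" "e \<in> H" "\<not> cycle_edge H e"
    and ab: "connected_component (- drawing (H - {e})) a b" "a \<notin> drawing H" "b \<notin> drawing H"
  shows "connected_component (- drawing H) a b"
proof -
  have e: "e \<in> E" using H by blast
  obtain u v where uv: "e = {u, v}" "u \<noteq> v" using card_edge[OF e] by (auto simp: card_2_iff)
  define C where "C = {x. (u, x) \<in> edge_conn (H - {e})}"
  have "v \<notin> C" using H uv unfolding cycle_edge_def C_def by blast
  have "u \<in> C" by (simp add: C_def)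
  define E1 where "E1 = {f \<in> H - {e}. f \<subseteq> C}"
  define E2 where "E2 = {f \<in> H - {e}. f \<inter> C = {}}"
  have He: "H - {e} = E1 \<union> E2"
  proof -
    have "f \<subseteq> C \<or> f \<inter> C = {}" if "f \<in> H - {e}" for f
    proof -
      have "card f = 2" using card_edge[of f] that H by blast
      then obtain x y where f: "f = {x, y}" by (auto simp: card_2_iff)
      have "x \<in> C \<longleftrightarrow> y \<in> C"
        using that edge_conn_step[of u x "H - {e}" y] edge_conn_step[of u y "H - {e}" x]
        by (auto simp: f C_def insert_commute)
      then show ?thesis using f by auto
    qed
    then show ?thesis unfolding E1_def E2_def by blast
  qed
  have sub: "E1 \<subseteq> E" "E2 \<subseteq> E" "{e} \<subseteq> E" using H by (auto simp: E1_def E2_def)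
  \<comment> \<open>At most one common point, hence a connected intersection, as Janiszewski's
    theorem requires; likewise for \<open>i2\<close>.\<close>
  have i1: "drawing {e} \<inter> drawing E1 \<subseteq> {\<phi> u}"
  proof -
    have "drawing {e} \<inter> drawing E1 = \<phi> ` (\<Union>{e} \<inter> \<Union>E1)"
      by (rule drawing_Int) (use sub in \<open>auto simp: E1_def\<close>)
    also have "\<dots> \<subseteq> {\<phi> u}" using \<open>v \<notin> C\<close> by (auto simp: uv E1_def)
    finally show ?thesis .
  qed
  have i2: "(drawing {e} \<union> drawing E1) \<inter> drawing E2 \<subseteq> {\<phi> v}"
  proof -
    have "drawing (insert e E1) \<inter> drawing E2 = \<phi> ` (\<Union>(insert e E1) \<inter> \<Union>E2)"
    proof (intro drawing_Int)
      have "f \<noteq> {}" if "f \<in> H" for f using card_edge[of f] that H by auto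
      then show "insert e E1 \<inter> E2 = {}" unfolding E1_def E2_def by blast
    qed (use sub in auto)
    also have "\<dots> \<subseteq> {\<phi> v}" using \<open>u \<in> C\<close> by (auto simp: uv E1_def E2_def)
    finally show ?thesis by (simp add: drawing_insert)
  qed
  have conn: "Topological_Spaces.connected S" if "S \<subseteq> {p}" for S and p :: complex
    using that by (auto simp: subset_singleton_iff)
  have dH: "drawing H = (drawing {e} \<union> drawing E1) \<union> drawing E2"
    using H(2) He by (metis Un_assoc drawing_Un insert_Diff insert_is_Un)
  have mono: "connected_component (- drawing E1) a b" "connected_component (- drawing E2) a b"
    using connected_component_of_subset[OF ab(1)] unfolding He drawing_Un by blast+
  have ce: "connected_component (- drawing {e}) a b"
  proof -
    have "Topological_Spaces.connected (- drawing {e})"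
      using connected_arc_complement[OF arc_edge[OF e]] by (simp add: drawing_insert)
    moreover have "a \<in> - drawing {e}" "b \<in> - drawing {e}" using ab(2,3) unfolding dH by blast+
    ultimately show ?thesis unfolding connected_iff_connected_component by blast
  qed
  note cpt = compact_drawing[OF sub(1)] compact_drawing[OF sub(2)] compact_drawing[OF sub(3)]
  have "connected_component (- (drawing {e} \<union> drawing E1)) a b"
    by (rule Janiszewski[OF cpt(3) compact_imp_closed[OF cpt(1)] conn[OF i1] ce mono(1)])
  then have "connected_component (- ((drawing {e} \<union> drawing E1) \<union> drawing E2)) a b"
    by (rule Janiszewski[OF compact_Un[OF cpt(3,1)] compact_imp_closed[OF cpt(2)] conn[OF i2] _ mono(2)])
  then show ?thesis by (simp add: dH)
qed

text \<open>Every edge of a forest is a bridge, so putting the edges back one at a time never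
  separates two points.\<close>

lemma connected_forest_complement: "edge_forest H \<Longrightarrow> H \<subseteq> E \<Longrightarrow> Topological_Spaces.connected (- drawing H)"
proof (induction "card H" arbitrary: H)
  case 0
  then have "H = {}" using finite_edges finite_subset by fastforce
  then show ?case using connected_UNIV by simp
next
  case (Suc n)
  then obtain e where e: "e \<in> H" by fastforce
  have "card (H - {e}) = n" using Suc.hyps(2) e by simp
  then have "Topological_Spaces.connected (- drawing (H - {e}))"
    using Suc.hyps(1)[of "H - {e}"] Suc.prems edge_forest_subset[of H "H - {e}"] by auto
  moreover have "- drawing H \<subseteq> - drawing (H - {e})" using drawing_mono[of "H - {e}" H] by blast
  moreover have "\<not> cycle_edge H e" using Suc.prems(1) by (simp add: edge_forest_def)
  ultimately show ?case
    using connected_component_bridge[OF Suc.prems(2) e]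
    unfolding connected_iff_connected_component by (meson ComplD subsetD)
qed

text \<open>Everything used about a cycle through \<open>e\<close>: its curve \<open>J\<close>, the
  two sides, and, as the last clause, that in a larger drawing \<open>e\<close> cannot separate two
  points on the same side of \<open>J\<close> that the other edges leave together.\<close>

definition Jordan_split :: "'a set set \<Rightarrow> 'a set \<Rightarrow> complex set \<Rightarrow> complex set \<Rightarrow> complex set \<Rightarrow> bool" where
  "Jordan_split H e J A B \<longleftrightarrow> frontier A = J \<and> frontier B = J \<and> A \<union> B = - J \<and> A \<inter> B = {} \<and>
     Topological_Spaces.connected A \<and> Topological_Spaces.connected B \<and> open A \<and> open B \<and>
     edge_interior e \<subseteq> J \<and> J \<subseteq> drawing H \<and> \<phi> ` e \<subseteq> drawing (H - {e}) \<and>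
     (\<forall>K a b. e \<in> K \<longrightarrow> K \<subseteq> E \<longrightarrow> H \<subseteq> K \<longrightarrow> connected_component (- drawing (K - {e})) a b \<longrightarrow>
       connected_component (- J) a b \<longrightarrow> connected_component (- drawing K) a b)"

lemma Jordan_splitD:
  assumes "Jordan_split H e J A B"
  shows "frontier A = J" "frontier B = J" "A \<union> B = - J" "A \<inter> B = {}"
    "Topological_Spaces.connected A" "Topological_Spaces.connected B" "open A" "open B"
    "edge_interior e \<subseteq> J" "J \<subseteq> drawing H" "\<phi> ` e \<subseteq> drawing (H - {e})"
  using assms by (simp_all only: Jordan_split_def)

lemma Jordan_split_connected:
  assumes "Jordan_split H e J A B" "e \<in> K" "K \<subseteq> E" "H \<subseteq> K"
    "connected_component (- drawing (K - {e})) a b" "connected_component (- J) a b"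
  shows "connected_component (- drawing K) a b"
proof -
  have "\<forall>K a b. e \<in> K \<longrightarrow> K \<subseteq> E \<longrightarrow> H \<subseteq> K \<longrightarrow> connected_component (- drawing (K - {e})) a b \<longrightarrow>
       connected_component (- J) a b \<longrightarrow> connected_component (- drawing K) a b"
    using assms(1) unfolding Jordan_split_def by (elim conjE)
  then show ?thesis using assms(2-) by iprover
qed

text \<open>\<open>J\<close> is \<open>e\<close> closed up by a path in \<open>H - {e}\<close>. For
  the last clause, \<open>J\<close> meets the drawing of \<open>K - {e}\<close> exactly in that
  path, which is an arc and hence connected, so Janiszewski's theorem applies.\<close>

lemma Jordan_cycle:
  assumes "H \<subseteq> E" "cycle_edge H e"
  shows "\<exists>J A B. Jordan_split H e J A B"
proof -
  obtain u v vs where uv: "e = {u, v}" "u \<noteq> v" "distinct vs" "hd vs = u" "last vs = v"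
    "path_edges vs \<subseteq> H - {e}" "3 \<le> length vs"
    using cycle_edge_path[OF assms(2)] by blast
  have e: "e \<in> E" "e \<in> H" using assms unfolding cycle_edge_def by auto
  obtain g where g: "Path_Connected.arc g" "path_image g = drawing (path_edges vs)"
    "pathstart g = \<phi> u" "pathfinish g = \<phi> v"
    using arc_path_edges[of vs] uv assms by auto
  have "pathstart (\<gamma> e) = \<phi> u \<and> pathfinish (\<gamma> e) = \<phi> v \<or>
      pathstart (\<gamma> e) = \<phi> v \<and> pathfinish (\<gamma> e) = \<phi> u"
    using ends_edge[OF e(1)] by (auto simp: doubleton_eq_iff uv)
  then obtain g1 where g1: "Path_Connected.arc g1" "path_image g1 = path_image (\<gamma> e)"
      "pathstart g1 = \<phi> v" "pathfinish g1 = \<phi> u"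
  proof
    assume "pathstart (\<gamma> e) = \<phi> u \<and> pathfinish (\<gamma> e) = \<phi> v"
    with that[of "reversepath (\<gamma> e)"] show thesis using arc_edge[OF e(1)] by (simp add: arc_reversepath)
  qed (use that arc_edge[OF e(1)] in blast)
  have i: "path_image g1 \<inter> drawing K \<subseteq> {\<phi> u, \<phi> v}" if "K \<subseteq> E - {e}" for K
  proof -
    have "drawing {e} \<inter> drawing K = \<phi> ` (\<Union>{e} \<inter> \<Union>K)"
      using that e by (intro drawing_Int) auto
    then show ?thesis using uv g1 by (auto simp: drawing_insert)
  qed
  have vsE: "path_edges vs \<subseteq> E - {e}" using uv assms by blast
  define J where "J = path_image (g +++ g1)"
  have "simple_path (g +++ g1)"
    using g g1 i[OF vsE] by (intro simple_path_join_loop) auto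
  moreover have "pathfinish (g +++ g1) = pathstart (g +++ g1)" using g g1 by simp
  ultimately have jordan: "open (inside J)" "Topological_Spaces.connected (inside J)" "open (outside J)"
      "Topological_Spaces.connected (outside J)" "inside J \<inter> outside J = {}" "inside J \<union> outside J = - J"
      "frontier (inside J) = J" "frontier (outside J) = J"
    using Jordan_inside_outside[of "g +++ g1"] unfolding J_def by blast+
  have J: "J = path_image (\<gamma> e) \<union> drawing (path_edges vs)"
    using g g1 by (auto simp: J_def path_image_join)
  have comp: "compact J"
    unfolding J by (intro compact_Un compact_drawing compact_arc_image arc_edge) (use e vsE in auto)
  have ends: "{\<phi> u, \<phi> v} \<subseteq> drawing (path_edges vs)"
    using g pathstart_in_path_image[of g] pathfinish_in_path_image[of g] by auto
  have "Jordan_split H e J (inside J) (outside J)"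
    unfolding Jordan_split_def
  proof (intro conjI allI impI)
    show "edge_interior e \<subseteq> J" unfolding J edge_interior_def by blast
    show "J \<subseteq> drawing H" unfolding J using uv e drawing_mono[of "path_edges vs" H]
      by (auto simp: drawing_def)
    show "\<phi> ` e \<subseteq> drawing (H - {e})"
      using ends drawing_mono[OF uv(6)] by (auto simp: uv)
    fix K a b assume K: "e \<in> K" "K \<subseteq> E" "H \<subseteq> K" "connected_component (- drawing (K - {e})) a b"
      "connected_component (- J) a b"
    have dK: "drawing K = J \<union> drawing (K - {e})"
      using K uv drawing_mono[of "path_edges vs" "K - {e}"]
      unfolding J by (auto simp: drawing_def)
    have "path_edges vs \<subseteq> K - {e}" using uv K by blast
    then have "J \<inter> drawing (K - {e}) = drawing (path_edges vs)"
      using i[of "K - {e}"] K(2) ends drawing_mono[of "path_edges vs" "K - {e}"]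
      unfolding J g1(2) by blast
    moreover have "Topological_Spaces.connected (drawing (path_edges vs))"
      using connected_arc_image[OF g(1)] g(2) by simp
    ultimately show "connected_component (- drawing K) a b"
      unfolding dK using K comp compact_drawing[of "K - {e}"]
      by (intro Janiszewski) (auto intro: compact_imp_closed)
  qed (use jordan comp in auto)
  then show ?thesis by blast
qed

end

section \<open>Faces\<close>

definition triangles :: "'a set set \<Rightarrow> 'a set set" where
  "triangles E = {T. card T = 3 \<and> (\<forall>x \<in> T. \<forall>y \<in> T. x \<noteq> y \<longrightarrow> {x, y} \<in> E)}"

definition has_cycle :: "'a set set \<Rightarrow> nat \<Rightarrow> bool" where
  "has_cycle E n \<longleftrightarrow> (\<exists>vs. distinct vs \<and> length vs = n \<and> path_edges vs \<subseteq> E \<and> {last vs, hd vs} \<in> E)"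

lemma triangles_mono: "E \<subseteq> E' \<Longrightarrow> triangles E \<subseteq> triangles E'"
  unfolding triangles_def by blast

lemma has_cycle_mono: "has_cycle E n \<Longrightarrow> E \<subseteq> E' \<Longrightarrow> has_cycle E' n"
  unfolding has_cycle_def by blast

lemma trianglesE:
  assumes "T \<in> triangles E"
  obtains x y z where "T = {x, y, z}" "x \<noteq> y" "y \<noteq> z" "x \<noteq> z" "{x, y} \<in> E" "{y, z} \<in> E" "{x, z} \<in> E"
proof -
  obtain x y z where "T = {x, y, z}" "x \<noteq> y" "y \<noteq> z" "x \<noteq> z"
    using assms unfolding triangles_def card_3_iff by blast
  with that[of x y z] assms show thesis unfolding triangles_def by blast
qed

lemma trianglesI:
  "x \<noteq> y \<Longrightarrow> y \<noteq> z \<Longrightarrow> x \<noteq> z \<Longrightarrow> {x, y} \<in> E \<Longrightarrow> {y, z} \<in> E \<Longrightarrow> {x, z} \<in> E \<Longrightarrow> {x, y, z} \<in> triangles E"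
  unfolding triangles_def by (auto simp: insert_commute)

lemma triangles_subset: "T \<in> triangles E \<Longrightarrow> T \<subseteq> \<Union>E"
  by (erule trianglesE) blast

lemma finite_triangles:
  assumes "finite E" "\<And>e. e \<in> E \<Longrightarrow> card e = 2"
  shows "finite (triangles E)"
proof -
  have "finite e" if "e \<in> E" for e using assms(2)[OF that] by (metis card.infinite zero_neq_numeral)
  then have "finite (\<Union>E)" using assms(1) by blast
  moreover have "triangles E \<subseteq> Pow (\<Union>E)" using triangles_subset by blast
  ultimately show ?thesis by (meson finite_Pow_iff finite_subset)
qed

text \<open>With different third vertices \<open>z\<close> and \<open>w\<close>, the walk
  \<open>x\<close>, \<open>z\<close>, \<open>y\<close>, \<open>w\<close> would close up to a
  4-cycle.\<close>

lemma triangles_share_edge: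
  assumes "\<not> has_cycle E 4" "T \<in> triangles E" "T' \<in> triangles E" "x \<in> T \<inter> T'" "y \<in> T \<inter> T'" "x \<noteq> y"
  shows "T = T'"
proof (rule ccontr)
  assume ne: "T \<noteq> T'"
  have third: "\<exists>z. S = {x, y, z} \<and> z \<noteq> x \<and> z \<noteq> y \<and> {x, z} \<in> E \<and> {y, z} \<in> E"
    if "S \<in> triangles E" "x \<in> S" "y \<in> S" for S
    using that(1)
  proof (rule trianglesE)
    fix a b c assume "S = {a, b, c}" "a \<noteq> b" "b \<noteq> c" "a \<noteq> c" "{a, b} \<in> E" "{b, c} \<in> E" "{a, c} \<in> E"
    then show ?thesis using that(2,3) assms(6)
      by (auto simp: insert_commute)
  qed
  obtain z where z: "T = {x, y, z}" "z \<noteq> x" "z \<noteq> y" "{x, z} \<in> E" "{y, z} \<in> E"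
    using third[of T] assms by blast
  obtain w where w: "T' = {x, y, w}" "w \<noteq> x" "w \<noteq> y" "{x, w} \<in> E" "{y, w} \<in> E"
    using third[of T'] assms by blast
  have "has_cycle E 4"
    unfolding has_cycle_def
    by (rule exI[of _ "[x, z, y, w]"]) (use z w ne assms in \<open>auto simp: insert_commute\<close>)
  with assms show False by simp
qed

lemma cycle_edge_in: "cycle_edge E e \<Longrightarrow> e \<in> E"
  unfolding cycle_edge_def by blast

text \<open>The cycle through \<open>e\<close> has length 3 or at least 6, and all its edges are in
  \<open>E\<close>.\<close>

lemma cycle_edge_triangle:
  assumes "cycle_edge E e" "finite E" "\<not> has_cycle E 4" "\<not> has_cycle E 5"
  shows "6 \<le> card E \<or> triangles E \<noteq> {}"
proof -
  obtain u v vs where p: "e = {u, v}" "u \<noteq> v" "distinct vs" "hd vs = u" "last vs = v"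
    "path_edges vs \<subseteq> E - {e}" "3 \<le> length vs"
    using cycle_edge_path[OF assms(1)] by blast
  have e: "e \<in> E" using assms(1) by (rule cycle_edge_in)
  have cyc: "has_cycle E (length vs)"
    unfolding has_cycle_def using p e by (intro exI[of _ vs]) (auto simp: insert_commute)
  have "card (insert e (path_edges vs)) = length vs"
    using p card_path_edges[of vs] finite_path_edges[of vs] by (subst card_insert_disjoint) auto
  moreover have "card (insert e (path_edges vs)) \<le> card E"
    using p e assms(2) by (intro card_mono) auto
  ultimately have le: "length vs \<le> card E" by simp
  show ?thesis
  proof (cases "length vs = 3")
    case True
    then obtain a b c where "vs = [a, b, c]" by (auto simp: numeral_3_eq_3 length_Suc_conv)
    then have "{a, b, c} \<in> triangles E" using p e by (intro trianglesI) auto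
    then show ?thesis by blast
  next
    case False
    have "length vs \<noteq> 4" "length vs \<noteq> 5" using cyc assms by metis+
    then show ?thesis using False p(7) le by linarith
  qed
qed

definition triangle_edges :: "'a set \<Rightarrow> 'a set set" where
  "triangle_edges T = {e. e \<subseteq> T \<and> card e = 2}"

lemma triangle_edges_eq:
  assumes "x \<noteq> y" "y \<noteq> z" "x \<noteq> z"
  shows "triangle_edges {x, y, z} = {{x, y}, {y, z}, {x, z}}"
proof
  show "triangle_edges {x, y, z} \<subseteq> {{x, y}, {y, z}, {x, z}}"
    unfolding triangle_edges_def card_2_iff using assms by (auto simp: insert_commute)
qed (use assms in \<open>auto simp: triangle_edges_def\<close>)

lemma triangle_edges_subset: "T \<in> triangles E \<Longrightarrow> triangle_edges T \<subseteq> E"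
  by (erule trianglesE) (auto simp: triangle_edges_eq)

lemma card_triangle_edges: "T \<in> triangles E \<Longrightarrow> card (triangle_edges T) = 3"
  by (erule trianglesE) (simp add: triangle_edges_eq doubleton_eq_iff)

lemma cycle_edge_triangle_edges:
  assumes "T \<in> triangles E" "e \<in> triangle_edges T"
  shows "cycle_edge (triangle_edges T) e"
proof -
  from assms(1) obtain x y z where T: "T = {x, y, z}" "x \<noteq> y" "y \<noteq> z" "x \<noteq> z" by (rule trianglesE)
  have *: "cycle_edge (triangle_edges {a, b, c}) {a, b}" if "a \<noteq> b" "b \<noteq> c" "a \<noteq> c" for a b c :: 'a
  proof -
    have "(a, b) \<in> edge_conn (triangle_edges {a, b, c} - {{a, b}})"
      using that by (intro edge_conn_step[of a c _ b] edge_conn_step[of a a _ c])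
        (auto simp: triangle_edges_eq doubleton_eq_iff insert_commute)
    then show ?thesis using that unfolding cycle_edge_def by (auto simp: triangle_edges_eq)
  qed
  have p: "{y, z, x} = {x, y, z}" "{x, z, y} = {x, y, z}" by auto
  show ?thesis
    using assms(2) *[of x y z] *[of y z x] *[of x z y] T unfolding p
    by (auto simp: triangle_edges_eq)
qed

section \<open>Faces, their boundary edges, and Euler's inequality\<close>

context plane_graph
begin

definition faces :: "'a set set \<Rightarrow> complex set set" where
  "faces H = components (- drawing H)"

text \<open>Touching an end of an edge does not count. A single common point with the interior does,
  which spares a proof that the whole edge then lies on the frontier.\<close>

definition face_edges :: "'a set set \<Rightarrow> complex set \<Rightarrow> 'a set set" where
  "face_edges H f = {e \<in> H. frontier f \<inter> edge_interior e \<noteq> {}}"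

lemma face_edges_subset: "face_edges H f \<subseteq> H"
  by (auto simp: face_edges_def)

lemma face_nonempty: "f \<in> faces H \<Longrightarrow> f \<noteq> {}"
  unfolding faces_def by (rule in_components_nonempty)

lemma face_connected: "f \<in> faces H \<Longrightarrow> Topological_Spaces.connected f"
  unfolding faces_def by (rule in_components_connected)

lemma face_subset: "f \<in> faces H \<Longrightarrow> f \<subseteq> - drawing H"
  unfolding faces_def by (rule in_components_subset)

lemma face_open: "f \<in> faces H \<Longrightarrow> H \<subseteq> E \<Longrightarrow> open f"
  unfolding faces_def by (rule open_components[OF open_drawing_complement])

lemma frontier_face: "f \<in> faces H \<Longrightarrow> H \<subseteq> E \<Longrightarrow> frontier f \<subseteq> drawing H"
  unfolding faces_def
  by (rule frontier_of_components_closed_complement[OF compact_imp_closed[OF compact_drawing]])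

lemma face_eqI:
  assumes "f \<in> faces H" "g \<in> faces H" "a \<in> f" "b \<in> g" "connected_component (- drawing H) a b"
  shows "f = g"
proof -
  have "f = connected_component_set (- drawing H) a" "g = connected_component_set (- drawing H) b"
    using assms connected_component_eq unfolding faces_def components_iff by metis+
  then show ?thesis using connected_component_eq[of b "- drawing H" a] assms(5) by simp
qed

lemma face_ex: "a \<notin> drawing H \<Longrightarrow> \<exists>f \<in> faces H. a \<in> f"
  using Union_components[of "- drawing H"] unfolding faces_def by blast

lemma faces_nonempty: "H \<subseteq> E \<Longrightarrow> faces H \<noteq> {}"
proof -
  assume "H \<subseteq> E"
  then have "drawing H \<noteq> UNIV" using compact_drawing not_compact_UNIV by metis
  then show ?thesis using face_ex[of _ H] by blast
qed

lemma connected_face_edge: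
  assumes H: "H \<subseteq> E" and f: "f \<in> faces H" "e \<in> face_edges H f"
  shows "Topological_Spaces.connected (f \<union> edge_interior e)"
proof -
  obtain p where p: "p \<in> frontier f" "p \<in> edge_interior e" "e \<in> H"
    using f by (auto simp: face_edges_def)
  have "Topological_Spaces.connected (insert p f)"
    using face_connected[OF f(1)] by (rule connected_intermediate_closure)
      (use p frontier_def closure_subset in auto)
  then have "Topological_Spaces.connected (insert p f \<union> edge_interior e)"
    by (intro connected_Un connected_edge_interior) (use p H in auto)
  moreover have "insert p f \<union> edge_interior e = f \<union> edge_interior e" using p by auto
  ultimately show ?thesis by simp
qed

text \<open>Once \<open>e\<close> is removed, two faces at \<open>e\<close> are joined through its
  interior.\<close>

lemma faces_at_edge_connected:
  assumes H: "H \<subseteq> E" and f: "f \<in> faces H" "e \<in> face_edges H f" "a \<in> f"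
    and g: "g \<in> faces H" "e \<in> face_edges H g" "b \<in> g"
  shows "connected_component (- drawing (H - {e})) a b"
proof -
  have e: "e \<in> E" "e \<in> H" using f H by (auto simp: face_edges_def)
  have "Topological_Spaces.connected ((f \<union> edge_interior e) \<union> (g \<union> edge_interior e))"
    using connected_Un[OF connected_face_edge[OF H f(1,2)] connected_face_edge[OF H g(1,2)]]
      nonempty_edge_interior[OF e(1)] by blast
  moreover have "edge_interior e \<inter> drawing (H - {e}) = {}"
    using e H by (intro edge_interior_disjoint) auto
  then have "(f \<union> edge_interior e) \<union> (g \<union> edge_interior e) \<subseteq> - drawing (H - {e})"
    using face_subset[OF f(1)] face_subset[OF g(1)] drawing_mono[of "H - {e}" H] by blast
  ultimately show ?thesis
    unfolding connected_component_def using f(3) g(3) by blast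
qed

text \<open>All faces at \<open>e\<close> merge when \<open>e\<close> is removed. A bridge does not
  separate them, so there is only one. Otherwise faces on the same side of a Jordan curve through
  \<open>e\<close> coincide; the side is an injective map to \<open>bool\<close>, which gives
  finiteness as well as the bound.\<close>

lemma faces_at_edge_le_2:
  assumes H: "H \<subseteq> E" and e: "e \<in> H"
  shows "finite {f \<in> faces H. e \<in> face_edges H f} \<and> card {f \<in> faces H. e \<in> face_edges H f} \<le> 2"
proof -
  let ?F = "{f \<in> faces H. e \<in> face_edges H f}"
  have "\<exists>c :: complex set \<Rightarrow> bool. inj_on c ?F"
  proof (cases "cycle_edge H e")
    case False
    have "f = g" if fg: "f \<in> ?F" "g \<in> ?F" for f g
    proof -
      obtain a b where ab: "a \<in> f" "b \<in> g"
        using face_nonempty[of f H] face_nonempty[of g H] fg by auto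
      then have "a \<notin> drawing H" "b \<notin> drawing H" using face_subset that by blast+
      then have "connected_component (- drawing H) a b"
        using connected_component_bridge[OF H e False] faces_at_edge_connected[OF H] that ab by blast
      then show ?thesis using face_eqI that ab by blast
    qed
    then have "inj_on (\<lambda>_. True) ?F" by (intro inj_onI) blast
    then show ?thesis by blast
  next
    case True
    obtain J A B where "Jordan_split H e J A B" using Jordan_cycle[OF H True] by blast
    note J = Jordan_splitD[OF this]
    note glue = Jordan_split_connected[OF \<open>Jordan_split H e J A B\<close> e H order_refl]
    define a where "a f = (SOME p. p \<in> f)" for f :: "complex set"
    have a: "a f \<in> f" "a f \<in> A \<union> B" if "f \<in> ?F" for f
    proof -
      have "f \<noteq> {}" using face_nonempty[of f H] that by simp
      then show "a f \<in> f" unfolding a_def by (simp add: some_in_eq)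
      then show "a f \<in> A \<union> B" using J(3,10) face_subset[of f H] that by blast
    qed
    have "f = g" if fg: "f \<in> ?F" "g \<in> ?F" "(a f \<in> A) = (a g \<in> A)" for f g
    proof -
      have "connected_component (- J) (a f) (a g)"
        unfolding connected_component_def using J(3,5,6) a[OF fg(1)] a[OF fg(2)] fg(3) by blast
      then have "connected_component (- drawing H) (a f) (a g)"
        using glue faces_at_edge_connected[OF H] fg(1,2) a(1) by blast
      then show ?thesis using face_eqI fg a by blast
    qed
    then have "inj_on (\<lambda>f. a f \<in> A) ?F" by (intro inj_onI) blast
    then show ?thesis by blast
  qed
  then obtain c :: "complex set \<Rightarrow> bool" where c: "inj_on c ?F" by blast
  have "card ?F \<le> card (UNIV :: bool set)"
    by (rule card_inj_on_le[OF c]) auto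
  moreover have "finite ?F" using c by (rule inj_on_finite[of _ _ UNIV]) auto
  ultimately show ?thesis by simp
qed

lemma finite_vertices: "H \<subseteq> E \<Longrightarrow> finite (\<Union>H)"
proof -
  assume "H \<subseteq> E"
  moreover have "finite e" if "e \<in> E" for e
    using card_edge[OF that] by (metis card.infinite zero_neq_numeral)
  ultimately show ?thesis using finite_edges by (meson finite_Union finite_subset subsetD)
qed

lemma drawing_face_edges: "H \<subseteq> E \<Longrightarrow> f \<in> faces H \<Longrightarrow> frontier f \<subseteq> drawing (face_edges H f) \<union> \<phi> ` \<Union>H"
  using frontier_face[of f H] unfolding drawing_def face_edges_def edge_interior_def by blast

text \<open>A face is relatively clopen in the complement of the edges on its frontier.\<close>

lemma face_eqI_face_edges:
  assumes H: "H \<subseteq> E" and f: "f \<in> faces H" "a \<in> f" and g: "g \<in> faces H" "b \<in> g"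
    and c: "connected_component (- drawing (face_edges H f)) a b"
  shows "f = g"
proof -
  let ?D = "drawing (face_edges H f)"
  have sub: "face_edges H f \<subseteq> E" using face_edges_subset H by blast
  \<comment> \<open>Away from its boundary edges the frontier of \<open>f\<close> consists of
    vertices only. Removing these finitely many points keeps a connected open set of the plane
    connected.\<close>
  define W where "W = connected_component_set (- ?D) a - \<phi> ` \<Union>H"
  have "Topological_Spaces.connected W"
    unfolding W_def
  proof (rule connected_open_delete_finite)
    show "open (connected_component_set (- ?D) a)"
      using open_drawing_complement[OF sub] by (rule open_connected_component)
    show "finite (\<phi> ` \<Union>H)" using finite_vertices[OF H] by (rule finite_imageI)
  qed (simp_all add: connected_connected_component)
  moreover have "W \<inter> (?D \<union> \<phi> ` \<Union>H) = {}"
    using connected_component_subset[of "- ?D" a] unfolding W_def by fastforce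
  then have "W \<inter> frontier f = {}" using drawing_face_edges[OF H f(1)] by (meson disjoint_iff subsetD)
  moreover have "a \<in> W" "b \<in> W"
  proof -
    have "\<phi> ` \<Union>H \<subseteq> drawing H"
    proof
      fix p assume "p \<in> \<phi> ` \<Union>H"
      then obtain e where "e \<in> H" "p \<in> \<phi> ` e" by blast
      then show "p \<in> drawing H"
        using vertices_subset_edge[of e] H unfolding drawing_def by blast
    qed
    then have "a \<notin> \<phi> ` \<Union>H" "b \<notin> \<phi> ` \<Union>H"
      using face_subset[OF f(1)] face_subset[OF g(1)] f g by blast+
    moreover have "connected_component (- ?D) a a"
      using connected_component_in[OF c] by (intro connected_component_refl) blast
    ultimately show "a \<in> W" "b \<in> W" using c unfolding W_def by simp_all
  qed
  ultimately have "b \<in> f" using connected_Int_frontier[of W f] f(2) by blast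
  moreover have "b \<in> - drawing H" using g face_subset by blast
  ultimately show ?thesis by (intro face_eqI[OF f(1) g(1) _ g(2), of b]) auto
qed

text \<open>A forest does not separate the plane, but the boundary edges of \<open>f\<close>
  separate it from \<open>g\<close>.\<close>

lemma face_edges_not_forest:
  assumes H: "H \<subseteq> E" and f: "f \<in> faces H" and g: "g \<in> faces H" "f \<noteq> g"
  shows "\<not> edge_forest (face_edges H f)"
proof
  assume *: "edge_forest (face_edges H f)"
  have sub: "face_edges H f \<subseteq> E" using face_edges_subset H by blast
  obtain a b where ab: "a \<in> f" "b \<in> g"
    using face_nonempty[OF f] face_nonempty[OF g(1)] by blast
  then have "a \<in> - drawing (face_edges H f)" "b \<in> - drawing (face_edges H f)"
    using face_subset[OF f] face_subset[OF g(1)] drawing_mono[OF face_edges_subset, of H f] by blast+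
  then have "connected_component (- drawing (face_edges H f)) a b"
    using connected_forest_complement[OF * sub] unfolding connected_iff_connected_component by blast
  then show False using face_eqI_face_edges[OF H f ab(1) g(1) ab(2)] g(2) by blast
qed

text \<open>Drawing \<open>e\<close> affects only the face \<open>f0\<close> of
  \<open>H - {e}\<close> that contains its interior; all others remain faces. As \<open>f0\<close>
  reaches both sides of a Jordan curve through \<open>e\<close>, it breaks up into at least two
  faces.\<close>

lemma cycle_edge_faces:
  assumes H: "H \<subseteq> E" and e: "cycle_edge H e" and fin: "finite (faces H)"
  shows "finite (faces (H - {e})) \<and> card (faces (H - {e})) + 1 \<le> card (faces H)"
proof -
  have eH: "e \<in> H" "e \<in> E" using cycle_edge_in[OF e] H by blast+
  obtain J A B where "Jordan_split H e J A B" using Jordan_cycle[OF H e] by blast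
  note J = Jordan_splitD[OF this]
  obtain p where p: "p \<in> edge_interior e" using nonempty_edge_interior[OF eH(2)] by blast
  have "p \<notin> drawing (H - {e})" using edge_interior_disjoint[of e "H - {e}"] p eH H by blast
  then obtain f0 where f0: "f0 \<in> faces (H - {e})" "p \<in> f0" using face_ex by blast
  have open0: "open f0" using face_open f0 H by blast
  have dH: "drawing H = path_image (\<gamma> e) \<union> drawing (H - {e})"
    using eH by (metis drawing_insert insert_Diff)
  have int0: "edge_interior e \<subseteq> f0"
  proof -
    have "edge_interior e \<subseteq> - drawing (H - {e})"
      using edge_interior_disjoint[of e "H - {e}"] eH H by blast
    then show ?thesis
      using components_maximal[of f0 "- drawing (H - {e})" "edge_interior e"] f0 p
        connected_edge_interior[OF eH(2)] unfolding faces_def by blast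
  qed
  \<comment> \<open>The point \<open>p\<close> of \<open>J\<close> is on the frontier of both sides,
    and \<open>f0\<close> is a neighbourhood of \<open>p\<close>.\<close>
  have near: "\<exists>a. a \<in> f0 \<and> a \<in> C \<and> a \<notin> drawing H" if "frontier C = J" "open C" "C \<inter> J = {}" for C
  proof -
    have "p \<in> closure C" using p J(9) that(1) by (auto simp: frontier_def)
    then obtain a where "a \<in> f0" "a \<in> C"
      using open0 f0(2) unfolding closure_iff_nhds_not_empty by blast
    moreover have "a \<notin> path_image (\<gamma> e)"
      using J(9,11) that(3) face_subset[OF f0(1)] calculation unfolding edge_interior_def by blast
    ultimately show ?thesis using face_subset[OF f0(1)] dH by blast
  qed
  obtain a where a: "a \<in> f0" "a \<in> A" "a \<notin> drawing H" using near[of A] J(1,3,7) by blast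
  obtain b where b: "b \<in> f0" "b \<in> B" "b \<notin> drawing H" using near[of B] J(2,3,8) by blast
  obtain fa where fa: "fa \<in> faces H" "a \<in> fa" using face_ex a by blast
  obtain fb where fb: "fb \<in> faces H" "b \<in> fb" using face_ex b by blast
  have ne: "fa \<noteq> fb"
  proof
    assume eq: "fa = fb"
    then have "fa \<inter> J \<noteq> {}"
      using connected_Int_frontier[OF face_connected[OF fa(1)], of A] fa fb a b J(1,4) eq by blast
    then show False using face_subset[OF fa(1)] J(10) by blast
  qed
  have in0: "fc \<subseteq> f0" if "fc \<in> faces H" "c \<in> fc" "c \<in> f0" for fc c
  proof -
    have "fc \<subseteq> - drawing (H - {e})" using face_subset[OF that(1)] dH by blast
    then show ?thesis
      using components_maximal[of f0 "- drawing (H - {e})" fc] f0 that face_connected[OF that(1)]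
      unfolding faces_def by blast
  qed
  have old: "faces (H - {e}) - {f0} \<subseteq> faces H"
  proof
    fix g assume g: "g \<in> faces (H - {e}) - {f0}"
    have "g \<inter> f0 = {}"
      using g f0(1) components_nonoverlap[of g "- drawing (H - {e})" f0] unfolding faces_def by blast
    then have "g \<subseteq> - drawing H"
      using g face_subset[of g "H - {e}"] int0 J(11) unfolding dH edge_interior_def by blast
    moreover obtain c where c: "c \<in> g" using g face_nonempty by blast
    ultimately obtain fc where fc: "fc \<in> faces H" "c \<in> fc" using face_ex by blast
    have "g \<subseteq> fc"
      using components_maximal[of fc "- drawing H" g] fc c \<open>g \<subseteq> - drawing H\<close> g face_connected[of g "H - {e}"]
      unfolding faces_def by blast
    moreover have "fc \<subseteq> g"
      using components_maximal[of g "- drawing (H - {e})" fc] g c fc face_connected[OF fc(1)]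
        face_subset[OF fc(1)] dH unfolding faces_def by blast
    ultimately show "g \<in> faces H" using fc by simp
  qed
  have sub: "insert fa (insert fb (faces (H - {e}) - {f0})) \<subseteq> faces H"
    using old fa fb by blast
  have fin': "finite (faces (H - {e}))"
    using finite_subset[OF old fin] by simp
  have notin: "fc \<notin> faces (H - {e}) - {f0}" if "fc \<in> faces H" "c \<in> fc" "c \<in> f0" for fc c
    using that f0(1) components_nonoverlap[of fc "- drawing (H - {e})" f0] unfolding faces_def by blast
  have "card (insert fa (insert fb (faces (H - {e}) - {f0}))) = Suc (Suc (card (faces (H - {e}) - {f0})))"
    using notin[OF fa a(1)] notin[OF fb b(1)] ne fin' by simp
  also have "\<dots> = card (faces (H - {e})) + 1"
    using fin' f0(1) by (metis One_nat_def Suc_eq_plus1 card.remove)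
  finally show ?thesis using card_mono[OF fin sub] fin' by simp
qed

text \<open>A forest has fewer edges than vertices and at least one face; each edge that closes a
  cycle adds at least one face. \<open>V\<close> stays fixed while edges are removed, so it may
  contain more than the vertices of \<open>H\<close>.\<close>

lemma Euler_inequality:
  assumes "H \<subseteq> E" "finite (faces H)" "finite V" "V \<noteq> {}" "\<Union>H \<subseteq> V"
  shows "card H + 2 \<le> card V + card (faces H)"
  using assms(1,2,5)
proof (induction "card H" arbitrary: H rule: less_induct)
  case less
  have finH: "finite H" using less.prems(1) finite_edges by (rule finite_subset)
  show ?case
  proof (cases "edge_forest H")
    case True
    then have "card H < card V"
      using card_edge_forest[OF assms(3,4) True] less.prems(1,3) card_edge by (meson Sup_le_iff subsetD)
    moreover have "0 < card (faces H)"
      using less.prems(1,2) faces_nonempty by (simp add: card_gt_0_iff)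
    ultimately show ?thesis by simp
  next
    case False
    then obtain e where e: "cycle_edge H e" by (auto simp: edge_forest_def)
    then have "e \<in> H" by (rule cycle_edge_in)
    then have card: "card H = Suc (card (H - {e}))" using finH by (metis card.remove)
    note faces = cycle_edge_faces[OF less.prems(1) e less.prems(2)]
    have "card (H - {e}) + 2 \<le> card V + card (faces (H - {e}))"
    proof (rule less.hyps)
      show "\<Union>(H - {e}) \<subseteq> V" "H - {e} \<subseteq> E" using less.prems(1,3) by blast+
    qed (use card faces in simp_all)
    then show ?thesis using faces card by simp
  qed
qed

end

section \<open>Faces with fewer than six boundary edges\<close>

lemma triangles_disjoint_edges:
  assumes "\<not> has_cycle E 4" "T \<in> triangles E" "T' \<in> triangles E" "T \<noteq> T'"
  shows "triangle_edges T \<inter> triangle_edges T' = {}"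
proof (rule ccontr)
  assume "triangle_edges T \<inter> triangle_edges T' \<noteq> {}"
  then obtain e where e: "e \<subseteq> T" "e \<subseteq> T'" "card e = 2" unfolding triangle_edges_def by blast
  then obtain x y where "e = {x, y}" "x \<noteq> y" by (auto simp: card_2_iff)
  then show False using triangles_share_edge[OF assms(1-3), of x y] e assms(4) by blast
qed

text \<open>A cycle that survives the removal of \<open>e\<close> would, among fewer than six edges,
  yield a second triangle. It would share no edge with \<open>T\<close>, and two such triangles need
  six edges.\<close>

lemma triangle_edges_not_forest:
  assumes "finite K" "card K < 6" "T \<in> triangles K" "e \<in> triangle_edges T"
    "\<not> has_cycle K 4" "\<not> has_cycle K 5"
  shows "edge_forest (K - {e})"
  unfolding edge_forest_def
proof (rule, rule)
  fix e1 assume c: "cycle_edge (K - {e}) e1"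
  have sub: "K - {e} \<subseteq> K" by blast
  have "\<not> has_cycle (K - {e}) 4" "\<not> has_cycle (K - {e}) 5"
    using assms(5,6) has_cycle_mono[OF _ sub] by blast+
  then have "6 \<le> card (K - {e}) \<or> triangles (K - {e}) \<noteq> {}"
    using cycle_edge_triangle[OF c] assms(1) by simp
  moreover have "card (K - {e}) \<le> card K" using assms(1) by (rule card_mono) (rule sub)
  ultimately obtain T' where T': "T' \<in> triangles (K - {e})" using assms(2) by fastforce
  have sub': "triangle_edges T' \<subseteq> K - {e}" using triangle_edges_subset[OF T'] .
  then have "T \<noteq> T'" using assms(4) by blast
  moreover have TK: "T' \<in> triangles K" using T' triangles_mono[OF sub] by blast
  ultimately have disj: "triangle_edges T \<inter> triangle_edges T' = {}"
    using triangles_disjoint_edges[OF assms(5,3)] by blast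
  have subs: "triangle_edges T \<subseteq> K" "triangle_edges T' \<subseteq> K"
    using triangle_edges_subset[OF assms(3)] sub' by blast+
  have "card (triangle_edges T \<union> triangle_edges T') = 6"
    using disj subs assms(1) card_triangle_edges[OF assms(3)] card_triangle_edges[OF TK]
    by (subst card_Un_disjoint) (auto intro: finite_subset)
  moreover have "card (triangle_edges T \<union> triangle_edges T') \<le> card K"
    using subs assms(1) by (intro card_mono) auto
  ultimately show False using assms(2) by simp
qed

context plane_graph
begin

text \<open>Without \<open>e\<close> the boundary of \<open>f\<close> is a forest and separates
  nothing. So it separates only what the triangle separates, and \<open>f\<close> is the only face
  with points on its side of \<open>J\<close>.\<close>

lemma small_face_eqI:
  assumes cyc: "\<not> has_cycle E 4" "\<not> has_cycle E 5"
    and f: "f \<in> faces E" "card (face_edges E f) < 6" "T \<in> triangles (face_edges E f)" "a \<in> f"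
    and e: "e \<in> triangle_edges T" and J: "Jordan_split (triangle_edges T) e J A B"
    and g: "g \<in> faces E" "b \<in> g" and ab: "connected_component (- J) a b"
  shows "f = g"
proof -
  let ?K = "face_edges E f"
  have K: "?K \<subseteq> E" "finite ?K" using face_edges_subset finite_edges finite_subset by metis+
  have TK: "triangle_edges T \<subseteq> ?K" by (rule triangle_edges_subset[OF f(3)])
  have "\<not> has_cycle ?K 4" "\<not> has_cycle ?K 5" using cyc has_cycle_mono[OF _ K(1)] by blast+
  then have forest: "edge_forest (?K - {e})"
    using triangle_edges_not_forest[OF K(2) f(2,3) e] by blast
  have "?K - {e} \<subseteq> E" using K by blast
  note conn = connected_forest_complement[OF forest this]
  have "drawing (?K - {e}) \<subseteq> drawing E" using K by (intro drawing_mono) blast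
  then have "a \<in> - drawing (?K - {e})" "b \<in> - drawing (?K - {e})"
    using face_subset[OF f(1)] face_subset[OF g(1)] f(4) g(2) by blast+
  then have "connected_component (- drawing (?K - {e})) a b"
    using conn unfolding connected_iff_connected_component by blast
  moreover have "e \<in> ?K" using e TK by blast
  ultimately have "connected_component (- drawing ?K) a b"
    using Jordan_split_connected[OF J _ K(1) TK] ab by blast
  then show ?thesis using face_eqI_face_edges[OF order_refl f(1,4) g] by blast
qed

text \<open>Two different small faces with the same triangle would each be alone on a side of
  \<open>J\<close>, leaving no side for \<open>h\<close>. The third face is essential: both sides of
  a graph that is just a triangle are small.\<close>

lemma small_faces_triangle_inj:
  assumes cyc: "\<not> has_cycle E 4" "\<not> has_cycle E 5"
    and f: "f \<in> faces E" "card (face_edges E f) < 6" "T \<in> triangles (face_edges E f)"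
    and g: "g \<in> faces E" "card (face_edges E g) < 6" "T \<in> triangles (face_edges E g)"
    and h: "h \<in> faces E" "h \<noteq> f" "h \<noteq> g"
  shows "f = g"
proof (rule ccontr)
  assume fg: "f \<noteq> g"
  have TE: "triangle_edges T \<subseteq> E"
    using triangle_edges_subset[OF f(3)] face_edges_subset[of E f] by blast
  have "card (triangle_edges T) = 3" by (rule card_triangle_edges[OF f(3)])
  then obtain e where e: "e \<in> triangle_edges T" by (metis card.empty ex_in_conv zero_neq_numeral)
  obtain J A B where J: "Jordan_split (triangle_edges T) e J A B"
    using Jordan_cycle[OF TE cycle_edge_triangle_edges[OF f(3) e]] by blast
  obtain a b c where abc: "a \<in> f" "b \<in> g" "c \<in> h"
    using face_nonempty[OF f(1)] face_nonempty[OF g(1)] face_nonempty[OF h(1)] by blast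
  have "J \<subseteq> drawing E" using Jordan_splitD(10)[OF J] drawing_mono[OF TE] by blast
  then have "{a, b, c} \<subseteq> - J"
    using abc face_subset[OF f(1)] face_subset[OF g(1)] face_subset[OF h(1)] by blast
  then have mem: "a \<in> A \<union> B" "b \<in> A \<union> B" "c \<in> A \<union> B" unfolding Jordan_splitD(3)[OF J] by simp_all
  have same: "connected_component (- J) x y" if "x \<in> A \<and> y \<in> A \<or> x \<in> B \<and> y \<in> B" for x y
    unfolding connected_component_def using that Jordan_splitD(3,5,6)[OF J] by blast
  have "\<not> connected_component (- J) a b"
    using small_face_eqI[OF cyc f abc(1) e J g(1) abc(2)] fg by blast
  moreover have "\<not> connected_component (- J) a c"
    using small_face_eqI[OF cyc f abc(1) e J h(1) abc(3)] h by blast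
  moreover have "\<not> connected_component (- J) b c"
    using small_face_eqI[OF cyc g abc(2) e J h(1) abc(3)] h by blast
  ultimately show False using same[of a b] same[of a c] same[of b c] mem by blast
qed

text \<open>There are at most two incidences of faces with each edge. A face with fewer than six
  boundary edges has at least the three of a triangle, and distinct such faces choose distinct
  triangles once there are more than two faces. With at most two faces, Euler's inequality alone
  gives at most as many edges as vertices.\<close>

theorem edge_bound:
  assumes ne: "E \<noteq> {}" and cyc: "\<not> has_cycle E 4" "\<not> has_cycle E 5"
  shows "4 * card E < 6 * card (\<Union>E) + 3 * card (triangles E)"
proof -
  let ?F = "faces E" and ?b = "face_edges E"
  have V: "finite (\<Union>E)" "\<Union>E \<noteq> {}"
    using finite_vertices[of E] ne card_edge by fastforce+
  then have V0: "0 < card (\<Union>E)" by (simp add: card_gt_0_iff)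
  show ?thesis
  proof (cases "\<forall>f \<in> ?F. \<forall>g \<in> ?F. f = g \<or> (\<exists>h \<in> ?F. h \<noteq> f \<and> h \<noteq> g)")
    case False
    then obtain f g where "f \<in> ?F" "g \<in> ?F" "\<And>h. h \<in> ?F \<Longrightarrow> h = f \<or> h = g" by blast
    then have "?F = {f, g}" by blast
    then have "finite ?F" "card ?F \<le> 2" by (simp_all add: card_insert_if)
    then show ?thesis using Euler_inequality[OF order_refl _ V order_refl] V0 by simp
  next
    \<comment> \<open>\<open>many\<close> still admits a single face, which is split off
      next.\<close>
    case many: True
    show ?thesis
    proof (cases "\<exists>f. ?F = {f}")
      case True
      then show ?thesis using Euler_inequality[OF order_refl _ V order_refl] V0 by auto
    next
      case False
      have ex: "\<exists>g \<in> ?F. f \<noteq> g" if "f \<in> ?F" for f using False that by blast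
      have bd: "\<exists>e. cycle_edge (?b f) e" if "f \<in> ?F" for f
        using face_edges_not_forest[OF order_refl that] ex[OF that] unfolding edge_forest_def by blast
      have fin: "finite (?b f)" for f using face_edges_subset finite_edges by (rule finite_subset)
      have big: "6 \<le> card (?b f) \<or> triangles (?b f) \<noteq> {}" if f: "f \<in> ?F" for f
      proof -
        obtain e where "cycle_edge (?b f) e" using bd[OF f] by blast
        moreover have "\<not> has_cycle (?b f) 4" "\<not> has_cycle (?b f) 5"
          using cyc has_cycle_mono[OF _ face_edges_subset] by blast+
        ultimately show ?thesis using cycle_edge_triangle fin by blast
      qed
      have "?F \<subseteq> (\<Union>e \<in> E. {f \<in> ?F. e \<in> ?b f})"
      proof
        fix f assume f: "f \<in> ?F"
        obtain e where "cycle_edge (?b f) e" using bd[OF f] by blast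
        then have "e \<in> ?b f" by (rule cycle_edge_in)
        then show "f \<in> (\<Union>e \<in> E. {f \<in> ?F. e \<in> ?b f})" using f face_edges_subset[of E f] by blast
      qed
      moreover have "finite (\<Union>e \<in> E. {f \<in> ?F. e \<in> ?b f})"
        using finite_edges faces_at_edge_le_2[OF order_refl] by blast
      ultimately have finF: "finite ?F" by (rule finite_subset)
      define S where "S = {f \<in> ?F. card (?b f) < 6}"
      define t where "t f = (SOME T. T \<in> triangles (?b f))" for f
      have t: "t f \<in> triangles (?b f)" if "f \<in> S" for f
      proof -
        have "triangles (?b f) \<noteq> {}" using big[of f] that unfolding S_def by auto
        then show ?thesis unfolding t_def by (simp add: some_in_eq)
      qed
      have "inj_on t S"
      proof (rule inj_onI, rule ccontr)
        fix f g assume fg: "f \<in> S" "g \<in> S" "t f = t g" "f \<noteq> g"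
        then have F: "f \<in> ?F" "g \<in> ?F" "card (?b f) < 6" "card (?b g) < 6" by (simp_all add: S_def)
        obtain h where h: "h \<in> ?F" "h \<noteq> f" "h \<noteq> g" using many F(1,2) fg(4) by blast
        have "t f \<in> triangles (?b g)" using t[OF fg(2)] fg(3) by simp
        then show False
          using small_faces_triangle_inj[OF cyc F(1,3) t[OF fg(1)] F(2,4) _ h] fg(4) by blast
      qed
      moreover have "t ` S \<subseteq> triangles E"
        using t triangles_mono[OF face_edges_subset] by blast
      ultimately have S: "card S \<le> card (triangles E)"
        using finite_triangles[OF finite_edges card_edge] by (rule card_inj_on_le)
      have "6 \<le> card (?b f) + (if f \<in> S then 3 else 0)" if "f \<in> ?F" for f
      proof (cases "f \<in> S")
        case True
        have "card (triangle_edges (t f)) \<le> card (?b f)"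
          using triangle_edges_subset[OF t[OF True]] fin by (intro card_mono)
        then show ?thesis using card_triangle_edges[OF t[OF True]] True by simp
      qed (use that in \<open>simp add: S_def\<close>)
      then have "(\<Sum>f \<in> ?F. 6) \<le> (\<Sum>f \<in> ?F. card (?b f) + (if f \<in> S then 3 else 0))"
        by (rule sum_mono)
      also have "\<dots> = (\<Sum>f \<in> ?F. card (?b f)) + 3 * card S"
      proof -
        have "?F \<inter> S = S" by (auto simp: S_def)
        then show ?thesis using finF by (simp add: sum.distrib sum.If_cases)
      qed
      also have "(\<Sum>f \<in> ?F. card (?b f)) = (\<Sum>e \<in> E. card {f \<in> ?F. e \<in> ?b f})"
      proof -
        have "(\<Sum>f \<in> ?F. card (?b f)) = (\<Sum>f \<in> ?F. card {e \<in> E. e \<in> ?b f})"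
          by (rule sum.cong) (auto simp: face_edges_def)
        then show ?thesis using sum_multicount_gen[OF finF finite_edges, of "\<lambda>f e. e \<in> ?b f"] by simp
      qed
      also have "\<dots> \<le> (\<Sum>e \<in> E. 2)"
        by (rule sum_mono) (use faces_at_edge_le_2[OF order_refl] in blast)
      finally have "6 * card ?F \<le> 2 * card E + 3 * card (triangles E)" using S by simp
      moreover have "card E + 2 \<le> card (\<Union>E) + card ?F"
        by (rule Euler_inequality[OF order_refl finF V order_refl])
      ultimately show ?thesis by linarith
    qed
  qed
qed

end

section \<open>Neighbourhoods and triangles\<close>

definition nbs :: "'a set set \<Rightarrow> 'a \<Rightarrow> 'a set" where
  "nbs E v = {w. {v, w} \<in> E}"

definition deg :: "'a set set \<Rightarrow> 'a \<Rightarrow> nat" where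
  "deg E v = card (nbs E v)"

text \<open>The neighbourhood of \<open>v\<close> in the square.\<close>

definition nbs2 :: "'a set set \<Rightarrow> 'a \<Rightarrow> 'a set" where
  "nbs2 E v = (nbs E v \<union> (\<Union>x \<in> nbs E v. nbs E x)) - {v}"

locale simple_edges =
  fixes E :: "'a set set"
  assumes finite_edges: "finite E" and card_edge: "e \<in> E \<Longrightarrow> card e = 2"
begin

lemma nbs_sym: "w \<in> nbs E v \<longleftrightarrow> v \<in> nbs E w"
  by (simp add: nbs_def insert_commute)

lemma nbs_irrefl: "v \<notin> nbs E v"
  using card_edge[of "{v}"] by (auto simp: nbs_def)

lemma finite_vertices: "finite (\<Union>E)"
proof -
  have "finite e" if "e \<in> E" for e
    using card_edge[OF that] by (metis card.infinite zero_neq_numeral)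
  then show ?thesis using finite_edges by blast
qed

lemma nbs_subset: "nbs E v \<subseteq> \<Union>E"
  by (auto simp: nbs_def)

lemma finite_nbs: "finite (nbs E v)"
  using nbs_subset finite_vertices by (rule finite_subset)

lemma deg_pos: "v \<in> \<Union>E \<Longrightarrow> 0 < deg E v"
proof -
  assume "v \<in> \<Union>E"
  then obtain e where e: "e \<in> E" "v \<in> e" by blast
  then obtain w where "e = {v, w}" using card_edge[OF e(1)] by (auto simp: card_2_iff)
  then have "w \<in> nbs E v" using e by (simp add: nbs_def)
  then show ?thesis unfolding deg_def using finite_nbs by (auto simp: card_gt_0_iff)
qed

lemma handshake: "(\<Sum>v \<in> \<Union>E. deg E v) = 2 * card E"
proof -
  have "deg E v = card {e \<in> E. v \<in> e}" for v
  proof -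
    have "inj_on (\<lambda>w. {v, w}) (nbs E v)" by (auto intro!: inj_onI simp: doubleton_eq_iff)
    moreover have "(\<lambda>w. {v, w}) ` nbs E v = {e \<in> E. v \<in> e}"
    proof
      show "{e \<in> E. v \<in> e} \<subseteq> (\<lambda>w. {v, w}) ` nbs E v"
      proof
        fix e assume "e \<in> {e \<in> E. v \<in> e}"
        then have e: "e \<in> E" "v \<in> e" by auto
        then obtain w where "e = {v, w}" using card_edge[OF e(1)] by (auto simp: card_2_iff)
        then show "e \<in> (\<lambda>w. {v, w}) ` nbs E v" using e by (auto simp: nbs_def)
      qed
    qed (auto simp: nbs_def)
    ultimately show ?thesis unfolding deg_def using card_image by fastforce
  qed
  then have "(\<Sum>v \<in> \<Union>E. deg E v) = (\<Sum>v \<in> \<Union>E. card {e \<in> E. v \<in> e})" by simp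
  also have "\<dots> = (\<Sum>e \<in> E. card {v \<in> \<Union>E. v \<in> e})"
    using sum_multicount_gen[OF finite_vertices finite_edges, of "\<lambda>v e. v \<in> e"] by simp
  also have "\<dots> = (\<Sum>e \<in> E. 2)"
  proof (rule sum.cong)
    fix e assume "e \<in> E"
    then have "{v \<in> \<Union>E. v \<in> e} = e" by blast
    then show "card {v \<in> \<Union>E. v \<in> e} = 2" using card_edge \<open>e \<in> E\<close> by simp
  qed simp
  finally show ?thesis by simp
qed

lemma finite_nbs2: "finite (nbs2 E v)"
  unfolding nbs2_def using finite_nbs by blast

lemma nbs2_sym: "w \<in> nbs2 E v \<longleftrightarrow> v \<in> nbs2 E w"
  unfolding nbs2_def using nbs_sym by blast

lemma nbs2_nbs: "w \<in> nbs E v \<Longrightarrow> w \<in> nbs2 E v"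
  unfolding nbs2_def using nbs_irrefl by blast

lemma nbs2_step: "x \<in> nbs E v \<Longrightarrow> w \<in> nbs E x \<Longrightarrow> w \<noteq> v \<Longrightarrow> w \<in> nbs2 E v"
  unfolding nbs2_def by blast

text \<open>A neighbour \<open>w\<close> contributes itself and those of its neighbours that are
  neither \<open>v\<close> nor adjacent to \<open>v\<close>; the 1 for \<open>w\<close> makes up for
  the 1 lost with \<open>v\<close>.\<close>

lemma card_nbs2_le: "card (nbs2 E v) \<le> (\<Sum>w \<in> nbs E v. deg E w - card (nbs E w \<inter> nbs E v))"
proof -
  let ?M = "\<lambda>w. insert w (nbs E w - {v} - nbs E v)"
  have "nbs2 E v \<subseteq> (\<Union>w \<in> nbs E v. ?M w)" unfolding nbs2_def by auto
  then have "card (nbs2 E v) \<le> card (\<Union>w \<in> nbs E v. ?M w)"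
    by (rule card_mono[rotated]) (use finite_nbs in auto)
  also have "\<dots> \<le> (\<Sum>w \<in> nbs E v. card (?M w))" by (rule card_UN_le[OF finite_nbs])
  also have "\<dots> \<le> (\<Sum>w \<in> nbs E v. deg E w - card (nbs E w \<inter> nbs E v))"
  proof (rule sum_mono)
    fix w assume w: "w \<in> nbs E v"
    have v: "v \<in> nbs E w" "v \<notin> nbs E v" using w nbs_sym nbs_irrefl by blast+
    have "nbs E w - {v} - nbs E v = nbs E w - insert v (nbs E w \<inter> nbs E v)" by blast
    then have "card (nbs E w - {v} - nbs E v) = deg E w - card (insert v (nbs E w \<inter> nbs E v))"
      unfolding deg_def using v finite_nbs[of w] by (simp add: card_Diff_subset)
    also have "\<dots> = deg E w - (1 + card (nbs E w \<inter> nbs E v))" using v finite_nbs by simp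
    finally have eq: "card (nbs E w - {v} - nbs E v) = deg E w - (1 + card (nbs E w \<inter> nbs E v))" .
    have "card (insert v (nbs E w \<inter> nbs E v)) \<le> deg E w"
      unfolding deg_def using v finite_nbs by (intro card_mono) auto
    then have "1 + card (nbs E w \<inter> nbs E v) \<le> deg E w" using v finite_nbs by simp
    moreover have "card (?M w) \<le> Suc (card (nbs E w - {v} - nbs E v))"
      by (rule card_insert_le_m1) auto
    ultimately show "card (?M w) \<le> deg E w - card (nbs E w \<inter> nbs E v)" using eq by linarith
  qed
  finally show ?thesis .
qed

definition in_triangle :: "'a \<Rightarrow> 'a \<Rightarrow> bool" where
  "in_triangle v w \<longleftrightarrow> (\<exists>T \<in> triangles E. v \<in> T \<and> w \<in> T)"

definition link :: "'a \<Rightarrow> 'a set" where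
  "link v = {w \<in> nbs E v. \<not> in_triangle v w}"

definition triangles_at :: "'a \<Rightarrow> 'a set set" where
  "triangles_at v = {T \<in> triangles E. v \<in> T}"

lemma link_sym: "w \<in> link v \<longleftrightarrow> v \<in> link w"
  using nbs_sym[of w v] unfolding link_def in_triangle_def by blast

lemma finite_link: "finite (link v)"
  unfolding link_def using finite_nbs by auto

lemma finite_triangles_at: "finite (triangles_at v)"
  unfolding triangles_at_def using finite_triangles[OF finite_edges card_edge] by auto

lemma triangle_nbs: "T \<in> triangles E \<Longrightarrow> v \<in> T \<Longrightarrow> w \<in> T \<Longrightarrow> v \<noteq> w \<Longrightarrow> w \<in> nbs E v"
  unfolding triangles_def nbs_def by blast

lemma card_triangle: "T \<in> triangles E \<Longrightarrow> card T = 3"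
  unfolding triangles_def by blast

lemma finite_triangle: "T \<in> triangles E \<Longrightarrow> finite T"
  using card_triangle by (metis card.infinite zero_neq_numeral)

lemma nbs_decomp: "nbs E v = link v \<union> (\<Union>T \<in> triangles_at v. T - {v})"
proof
  show "nbs E v \<subseteq> link v \<union> (\<Union>T \<in> triangles_at v. T - {v})"
  proof
    fix w assume "w \<in> nbs E v"
    moreover then have "w \<noteq> v" using nbs_irrefl by metis
    ultimately show "w \<in> link v \<union> (\<Union>T \<in> triangles_at v. T - {v})"
      unfolding link_def in_triangle_def triangles_at_def by auto
  qed
  show "link v \<union> (\<Union>T \<in> triangles_at v. T - {v}) \<subseteq> nbs E v"
  proof (rule Un_least)
    show "(\<Union>T \<in> triangles_at v. T - {v}) \<subseteq> nbs E v"
      using triangle_nbs[of _ v] unfolding triangles_at_def by auto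
  qed (simp add: link_def)
qed

text \<open>If \<open>v\<close> and \<open>w\<close> lie on a triangle, its third vertex is a common
  neighbour.\<close>

lemma card_nbs2_le_reduced:
  "real (card (nbs2 E v)) \<le> (\<Sum>w \<in> nbs E v. real (deg E w) - of_bool (in_triangle v w))"
proof -
  have "real (card (nbs2 E v)) \<le> (\<Sum>w \<in> nbs E v. real (deg E w - card (nbs E w \<inter> nbs E v)))"
    using card_nbs2_le[of v] by (metis of_nat_le_iff of_nat_sum)
  also have "\<dots> \<le> (\<Sum>w \<in> nbs E v. real (deg E w) - of_bool (in_triangle v w))"
  proof (rule sum_mono)
    fix w assume w: "w \<in> nbs E v"
    have le: "card (nbs E w \<inter> nbs E v) \<le> deg E w"
      unfolding deg_def using finite_nbs by (intro card_mono) auto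
    have "of_bool (in_triangle v w) \<le> card (nbs E w \<inter> nbs E v)"
    proof (cases "in_triangle v w")
      case True
      then obtain T where T: "T \<in> triangles E" "v \<in> T" "w \<in> T" by (auto simp: in_triangle_def)
      have "v \<noteq> w" using w nbs_irrefl by blast
      have "\<not> T \<subseteq> {v, w}"
      proof
        assume "T \<subseteq> {v, w}"
        then have "card T \<le> card {v, w}" by (intro card_mono) auto
        then show False using card_triangle[OF T(1)] by (auto simp: card_insert_if split: if_splits)
      qed
      then obtain z where "z \<in> T" "z \<noteq> v" "z \<noteq> w" by blast
      then have "z \<in> nbs E w \<inter> nbs E v" using triangle_nbs T by blast
      then have "0 < card (nbs E w \<inter> nbs E v)" using finite_nbs by (auto simp: card_gt_0_iff)
      then show ?thesis using True by simp
    qed simp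
    then have "real (of_bool (in_triangle v w)) \<le> real (card (nbs E w \<inter> nbs E v))"
      by (rule of_nat_mono)
    then show "real (deg E w - card (nbs E w \<inter> nbs E v)) \<le> real (deg E w) - of_bool (in_triangle v w)"
      using le by (simp add: of_nat_diff)
  qed
  finally show ?thesis .
qed

end

locale no4_edges = simple_edges +
  assumes no4: "\<not> has_cycle E 4"
begin

lemma triangles_at_disjoint:
  "T \<in> triangles_at v \<Longrightarrow> T' \<in> triangles_at v \<Longrightarrow> T \<noteq> T' \<Longrightarrow> (T - {v}) \<inter> (T' - {v}) = {}"
  using triangles_share_edge[OF no4, of T T' v] unfolding triangles_at_def by blast

text \<open>Without 4-cycles the triangles at \<open>v\<close> meet only in \<open>v\<close>, so
  together with \<open>link v\<close> they partition the neighbourhood.\<close>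

lemma sum_nbs:
  fixes f :: "'a \<Rightarrow> 'b :: comm_monoid_add"
  shows "sum f (nbs E v) = sum f (link v) + (\<Sum>T \<in> triangles_at v. sum f (T - {v}))"
proof -
  let ?U = "\<Union>T \<in> triangles_at v. T - {v}"
  have fin: "finite (T - {v})" if "T \<in> triangles_at v" for T
    using that finite_triangle unfolding triangles_at_def by blast
  have "sum f (nbs E v) = sum f (link v) + sum f ?U"
    unfolding nbs_decomp
  proof (rule sum.union_disjoint[OF finite_link])
    show "finite ?U" using finite_triangles_at fin by blast
    show "link v \<inter> ?U = {}" unfolding link_def in_triangle_def triangles_at_def by blast
  qed
  also have "sum f ?U = (\<Sum>T \<in> triangles_at v. sum f (T - {v}))"
    by (rule sum.UNION_disjoint) (use finite_triangles_at fin triangles_at_disjoint in blast)+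
  finally show ?thesis .
qed

lemma card_link: "card (link v) + 2 * card (triangles_at v) = deg E v"
proof -
  have "card (T - {v}) = 2" if "T \<in> triangles_at v" for T
    using that card_triangle finite_triangle unfolding triangles_at_def by simp
  then have "(\<Sum>T \<in> triangles_at v. card (T - {v})) = 2 * card (triangles_at v)" by simp
  then show ?thesis using sum_nbs[of "\<lambda>_. 1 :: nat" v] by (simp add: deg_def)
qed

end

section \<open>Discharging\<close>

text \<open>The situation in which no reduction applies: \<open>heavy\<close> says that
  \<open>S\<close> cannot be enlarged, \<open>indep\<close> and \<open>no_ear\<close> that nothing
  at \<open>S\<close> can be deleted. An ear, a vertex of degree 2 on a triangle, may still occur
  outside \<open>S\<close>.\<close>

locale discharging = no4_edges +
  fixes k :: nat and S :: "'a set"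
  assumes k: "32 \<le> k"
    and deg_le: "deg E v \<le> k"
    and deg_ge: "v \<in> \<Union>E \<Longrightarrow> 2 \<le> deg E v"
    and indep: "u \<in> S \<Longrightarrow> w \<in> S \<Longrightarrow> w \<notin> nbs E u"
    and heavy: "v \<in> \<Union>E \<Longrightarrow> v \<notin> S \<Longrightarrow> k + 3 + card (S \<inter> nbs2 E v) \<le> card (nbs2 E v)"
    and no_ear: "u \<in> S \<Longrightarrow> deg E u = 2 \<Longrightarrow> triangles_at u = {}"
begin

text \<open>
  The charge sent along an edge outside all triangles. A vertex of degree at least 6 spreads its
  charge \<open>2 d - 6\<close> evenly over its edges. A vertex of degree 3 to 5 helps neighbours of degree 2: those
  in \<open>S\<close> need 1 from each side, whereas those outside \<open>S\<close> get almost 2 from a neighbour of degree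
  close to \<open>k\<close>, so that \<open>6 / k\<close>, or again an even share, suffices.
\<close>

definition give :: "'a \<Rightarrow> 'a \<Rightarrow> real" where
  "give v w =
    (if 6 \<le> deg E v then 2 - 6 / deg E v
     else if deg E w = 2 \<and> 3 \<le> deg E v then
       (if w \<in> S then 1 else if deg E v = 3 then 6 / k else 2 - 6 / deg E v)
     else 0)"

definition net :: "'a \<Rightarrow> 'a \<Rightarrow> real" where
  "net v w = give w v - give v w"

definition rest :: "'a \<Rightarrow> real" where
  "rest v = 2 * real (deg E v) - 6 + (\<Sum>w \<in> link v. net v w)"

text \<open>The 2 is fitted to a vertex of degree 4 outside \<open>S\<close> on two triangles: by
  \<open>heavy_two\<close>, if the other degrees on one triangle add up to at most 9, those on the
  second add up to at least \<open>k - 2\<close>.\<close>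

definition rich :: "'a \<Rightarrow> 'a set \<Rightarrow> real" where
  "rich v T = of_bool (k \<le> 2 + (\<Sum>w \<in> T - {v}. deg E w))"

text \<open>
  What remains at a vertex is split evenly among its triangles, except that a vertex of degree 4 on
  one rich and one poor triangle moves \<open>1 / 2\<close> from the rich one to the poor one.
\<close>

definition share :: "'a \<Rightarrow> 'a set \<Rightarrow> real" where
  "share v T = rest v / card (triangles_at v) +
     (if deg E v = 4 then ((\<Sum>T' \<in> triangles_at v. rich v T') - card (triangles_at v) * rich v T) / 2
      else 0)"

lemma frac_le: "0 < n \<Longrightarrow> n \<le> m \<Longrightarrow> 0 \<le> c \<Longrightarrow> c / real m \<le> c / real n" for c :: real
  by (rule divide_left_mono) auto

lemma six_div_k: "0 < 6 / real k" "6 / real k \<le> 3 / 16"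
  using k frac_le[of 32 k 6] by auto

text \<open>The corrections at degree 4 cancel over the triangles at \<open>v\<close>.\<close>

lemma sum_share: "triangles_at v \<noteq> {} \<Longrightarrow> (\<Sum>T \<in> triangles_at v. share v T) = rest v"
  using finite_triangles_at[of v]
  by (cases "deg E v = 4")
    (simp_all add: share_def sum.distrib sum_subtractf flip: sum_distrib_left sum_divide_distrib)

lemma give_nonneg: "0 \<le> give v w"
  using frac_le[of 6 "deg E v" 6] frac_le[of 4 "deg E v" 6] unfolding give_def
  by (auto simp: divide_le_eq split: if_splits)

lemma link_deg: "w \<in> link v \<Longrightarrow> 2 \<le> deg E w"
  using deg_ge[of w] nbs_subset[of v] unfolding link_def by blast

text \<open>Outside triangles, a vertex of degree 3 to 5 gives only to neighbours of degree 2 and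
  receives only from those of degree at least 6.\<close>

lemma net_cases:
  assumes "w \<in> link v" "3 \<le> deg E v" "deg E v \<le> 5"
  shows "deg E w = 2 \<and> w \<in> S \<and> net v w = -1 \<or>
    deg E w = 2 \<and> w \<notin> S \<and> net v w = - (if deg E v = 3 then 6 / k else 2 - 6 / deg E v) \<or>
    3 \<le> deg E w \<and> deg E w \<le> 5 \<and> net v w = 0 \<or>
    6 \<le> deg E w \<and> net v w = 2 - 6 / deg E w \<and> 1 \<le> net v w"
proof -
  have "2 \<le> deg E w" using assms(1) by (rule link_deg)
  moreover have "6 \<le> deg E w \<Longrightarrow> 6 / real (deg E w) \<le> 1" by simp
  ultimately show ?thesis using assms(2,3) unfolding net_def give_def by auto
qed

lemma net_big:
  assumes "w \<in> link v" "3 \<le> deg E v" "deg E v \<le> 5" "6 \<le> deg E w"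
  shows "net v w = 2 - 6 / deg E w" "1 \<le> net v w"
  using net_cases[OF assms(1-3)] assms(4) by simp_all

lemma net_nonneg:
  assumes "w \<in> link v" "3 \<le> deg E v" "deg E v \<le> 5" "3 \<le> deg E w"
  shows "0 \<le> net v w"
  using net_cases[OF assms(1-3)] assms(4) by linarith

lemma net_lower_not_S:
  assumes "w \<in> link v" "3 \<le> deg E v" "deg E v \<le> 5" "w \<notin> S"
  shows "- (if deg E v = 3 then 6 / k else 2 - 6 / deg E v) \<le> net v w"
proof -
  have "0 \<le> (if deg E v = 3 then 6 / k else 2 - 6 / deg E v)"
    using assms(2,3) six_div_k frac_le[of 3 "deg E v" 6] by auto
  then show ?thesis using net_cases[OF assms(1-3)] assms(4) by linarith
qed

lemma net_lower:
  assumes "w \<in> link v" "3 \<le> deg E v" "deg E v \<le> 5"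
  shows "-1 \<le> net v w"
proof -
  have "(if deg E v = 3 then 6 / k else 2 - 6 / deg E v) \<le> 1"
    using assms(2,3) k frac_le[of "deg E v" 5 6] by auto
  then show ?thesis using net_cases[OF assms] by linarith
qed

text \<open>The even share of an edge is \<open>?h\<close>, and no edge costs more. The two edges of
  each triangle at \<open>v\<close> thus leave \<open>2 * ?h\<close> for it.\<close>

lemma rest_big:
  assumes "6 \<le> deg E v"
  shows "real (card (triangles_at v)) * (4 - 12 / deg E v) \<le> rest v"
proof -
  let ?h = "2 - 6 / real (deg E v)"
  have "net v w \<ge> - ?h" for w
    using give_nonneg[of w v] assms unfolding net_def give_def[of v w] by simp
  then have "(\<Sum>w \<in> link v. - ?h) \<le> (\<Sum>w \<in> link v. net v w)" by (rule sum_mono)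
  moreover have "(\<Sum>w \<in> link v. - ?h) = - (card (link v) * ?h)" by (simp add: algebra_simps)
  ultimately have "2 * real (deg E v) - 6 - card (link v) * ?h \<le> rest v"
    unfolding rest_def by linarith
  moreover have "real (card (link v)) = real (deg E v) - 2 * real (card (triangles_at v))"
    using card_link[of v] by linarith
  moreover have "real (deg E v) * ?h = 2 * real (deg E v) - 6"
    using assms by (simp add: field_simps)
  ultimately show ?thesis by (simp add: algebra_simps)
qed

text \<open>Each vertex of \<open>S\<close> found near \<open>v\<close> and collected in
  \<open>X\<close> raises the lower bound by 1. This makes up for the full unit that a vertex of
  degree 2 in \<open>S\<close> demands.\<close>

lemma heavy_sum:
  assumes "v \<in> \<Union>E" "v \<notin> S" "X \<subseteq> S \<inter> nbs2 E v"
  shows "real k + 3 + card X \<le> (\<Sum>w \<in> link v. real (deg E w)) +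
    (\<Sum>T \<in> triangles_at v. \<Sum>w \<in> T - {v}. real (deg E w) - 1)"
proof -
  let ?f = "\<lambda>w. real (deg E w) - of_bool (in_triangle v w)"
  have "card X \<le> card (S \<inter> nbs2 E v)"
    using assms(3) finite_nbs2 by (intro card_mono) auto
  then have "k + 3 + card X \<le> card (nbs2 E v)" using heavy[OF assms(1,2)] by linarith
  then have "real k + 3 + card X \<le> real (card (nbs2 E v))" by linarith
  also have "\<dots> \<le> sum ?f (nbs E v)" by (rule card_nbs2_le_reduced)
  also have "\<dots> = sum ?f (link v) + (\<Sum>T \<in> triangles_at v. sum ?f (T - {v}))" by (rule sum_nbs)
  also have "sum ?f (link v) = (\<Sum>w \<in> link v. real (deg E w))"
    by (rule sum.cong) (auto simp: link_def)
  also have "(\<Sum>T \<in> triangles_at v. sum ?f (T - {v})) =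
      (\<Sum>T \<in> triangles_at v. \<Sum>w \<in> T - {v}. real (deg E w) - 1)"
    by (intro sum.cong) (auto simp: triangles_at_def in_triangle_def)
  finally show ?thesis .
qed

lemma S_nbs2: "w \<in> S \<Longrightarrow> w \<in> nbs E v \<Longrightarrow> w \<in> S \<inter> nbs2 E v"
  using nbs2_nbs by blast

lemma link_nbs: "w \<in> link v \<Longrightarrow> w \<in> nbs E v"
  by (simp add: link_def)

lemma nbs_vertex: "w \<in> nbs E v \<Longrightarrow> v \<in> \<Union>E"
  by (auto simp: nbs_def)

lemma link_vertex: "w \<in> link v \<Longrightarrow> v \<in> \<Union>E"
  by (rule nbs_vertex) (rule link_nbs)

lemma nbs_ne: "w \<in> nbs E v \<Longrightarrow> w \<noteq> v"
  using nbs_irrefl by blast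

lemma two_vertex_not_S:
  assumes "u \<notin> S" "deg E u = 2" "link u = {a, b}" "a \<noteq> b" "triangles_at u = {}" "X \<subseteq> S \<inter> nbs2 E u"
  shows "k + 3 + card X \<le> deg E a + deg E b"
proof -
  have "u \<in> \<Union>E" using link_vertex[of a u] assms(3) by simp
  from heavy_sum[OF this assms(1,6)] show ?thesis using assms(3-5) by simp
qed

text \<open>A vertex of degree 2 with a neighbour of degree 2 has at most \<open>k + 2\<close>
  neighbours in the square, so it is in \<open>S\<close>. Both would be, against
  \<open>indep\<close>.\<close>

lemma no_two_two:
  assumes "w \<in> nbs E u" "deg E u = 2"
  shows "deg E w \<noteq> 2"
proof
  assume w2: "deg E w = 2"
  have *: "y \<in> S" if xy: "x \<in> nbs E y" "deg E x = 2" "deg E y = 2" for x y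
  proof (rule ccontr)
    assume "y \<notin> S"
    have "y \<in> \<Union>E" using xy(1) by (rule nbs_vertex)
    then have hv: "k + 3 \<le> card (nbs2 E y)" using heavy[of y] \<open>y \<notin> S\<close> by linarith
    have "card (nbs2 E y) \<le> (\<Sum>w \<in> nbs E y. deg E w - card (nbs E w \<inter> nbs E y))"
      by (rule card_nbs2_le)
    also have "\<dots> \<le> (\<Sum>w \<in> nbs E y. deg E w)" by (rule sum_mono) simp
    also have "\<dots> = deg E x + (\<Sum>w \<in> nbs E y - {x}. deg E w)"
      using xy(1) finite_nbs by (rule sum.remove[rotated])
    also have "(\<Sum>w \<in> nbs E y - {x}. deg E w) \<le> card (nbs E y - {x}) * k"
      using sum_bounded_above[of "nbs E y - {x}" "deg E" k] deg_le by simp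
    also have "card (nbs E y - {x}) = 1"
      using xy finite_nbs by (simp add: deg_def)
    finally show False using hv xy by simp
  qed
  have "u \<in> nbs E w" using assms(1) nbs_sym[of u w] by blast
  then have "u \<in> S" "w \<in> S" using *[of w u] *[of u w] assms w2 by blast+
  then show False using indep[of u w] assms(1) by blast
qed

lemma link_two:
  assumes "deg E u = 2" "triangles_at u = {}"
  obtains a b where "link u = {a, b}" "a \<noteq> b" "3 \<le> deg E a" "3 \<le> deg E b"
proof -
  have "card (link u) = 2" using card_link[of u] assms by simp
  then obtain a b where ab: "link u = {a, b}" "a \<noteq> b" by (auto simp: card_2_iff)
  have "3 \<le> deg E w" if "w \<in> link u" for w
    using link_deg[OF that] no_two_two[OF link_nbs[OF that] assms(1)] by linarith
  then show thesis using that ab by blast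
qed

text \<open>At most \<open>3 + k\<close> vertices are near \<open>u\<close>, so \<open>heavy\<close>
  leaves no room for one from \<open>S\<close>.\<close>

lemma no_S_near_two_three:
  assumes u: "u \<notin> S" "deg E u = 2" "a \<in> nbs E u" "deg E a = 3"
  shows "S \<inter> nbs2 E u = {}"
proof -
  obtain b where b: "nbs E u = {a, b}" "a \<noteq> b"
  proof -
    have "card (nbs E u) = 2" using u(2) by (simp add: deg_def)
    then have "card (nbs E u - {a}) = 1" using u(3) finite_nbs by simp
    then obtain b where "nbs E u - {a} = {b}" by (rule card_1_singletonE)
    then show thesis using that[of b] u(3) by blast
  qed
  have "u \<in> \<Union>E" using u(3) by (rule nbs_vertex)
  then have "k + 3 + card (S \<inter> nbs2 E u) \<le> card (nbs2 E u)" using heavy[of u] u(1) by blast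
  also have "\<dots> \<le> (\<Sum>w \<in> nbs E u. deg E w - card (nbs E w \<inter> nbs E u))" by (rule card_nbs2_le)
  also have "\<dots> \<le> (\<Sum>w \<in> nbs E u. deg E w)" by (rule sum_mono) simp
  also have "\<dots> \<le> 3 + k" using b u(4) deg_le[of b] by simp
  finally have "card (S \<inter> nbs2 E u) = 0" by simp
  then show ?thesis using finite_nbs2 by simp
qed

text \<open>The initial charge is -2. In \<open>S\<close>, \<open>u\<close> gets 1 from each side;
  outside \<open>S\<close> the degrees of its neighbours add up to at least \<open>k + 3\<close>, so
  if one of them is small, the other gives almost 2.\<close>

lemma rest_2:
  assumes u: "deg E u = 2" "triangles_at u = {}"
  shows "0 \<le> rest u"
proof -
  obtain a b where ab: "link u = {a, b}" "a \<noteq> b" "3 \<le> deg E a" "3 \<le> deg E b"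
    using link_two[OF u] by blast
  have rest: "rest u = give a u + give b u - 2"
    using ab u unfolding rest_def net_def give_def[of u] by simp
  show ?thesis
  proof (cases "u \<in> S")
    case True
    have "1 \<le> give w u" if "3 \<le> deg E w" for w
      using True that u frac_le[of 6 "deg E w" 6] unfolding give_def by auto
    from this[OF ab(3)] this[OF ab(4)] show ?thesis using rest by linarith
  next
    case False
    have *: "0 \<le> rest u" if "link u = {a, b}" "a \<noteq> b" "3 \<le> deg E a" "3 \<le> deg E b" "deg E a \<le> deg E b" for a b
    proof -
      have sum: "k + 3 \<le> deg E a + deg E b"
        using two_vertex_not_S[OF False u(1) that(1,2) u(2), of "{}"] by simp
      have rest: "rest u = give a u + give b u - 2"
        using that u unfolding rest_def net_def give_def[of u] by simp
      have b6: "6 \<le> deg E b" using sum that k by linarith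
      show ?thesis
      proof (cases "deg E a = 3")
        case True
        \<comment> \<open>The amount \<open>6 / k\<close> in \<open>give\<close> is chosen for this
          case: with the \<open>2 - 6 / k\<close> from \<open>b\<close> the income is exactly
          2.\<close>
        then have "deg E b = k" using sum deg_le[of b] by linarith
        then show ?thesis using rest b6 True u False unfolding give_def by simp
      next
        case a4: False
        have "give a u = 2 - 6 / deg E a" "give b u = 2 - 6 / deg E b"
          using a4 b6 that u False unfolding give_def by simp_all
        moreover have "6 / real (deg E a) + 6 / real (deg E b) \<le> 2"
        proof (cases "6 \<le> deg E a")
          case True
          then have "6 / real (deg E a) \<le> 6 / real 6" "6 / real (deg E b) \<le> 6 / real 6"
            using b6 by (intro frac_le; simp)+
          then show ?thesis by linarith
        next
          case False
          then have "30 \<le> deg E b" using sum k by linarith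
          then have "6 / real (deg E a) \<le> 6 / real 4" "6 / real (deg E b) \<le> 6 / real 30"
            using that a4 by (intro frac_le; simp)+
          then show ?thesis by simp
        qed
        ultimately show ?thesis using rest by simp
      qed
    qed
    show ?thesis
      using *[of a b] *[of b a] ab by (metis insert_commute nat_le_linear)
  qed
qed

text \<open>A neighbour of degree 2 would be outside \<open>S\<close> and have \<open>v\<close> from
  \<open>S\<close> nearby, against \<open>no_S_near_two_three\<close>. So \<open>v\<close> gives
  nothing away.\<close>

lemma net3_S: "deg E v = 3 \<Longrightarrow> v \<in> S \<Longrightarrow> w \<in> link v \<Longrightarrow> 0 \<le> net v w"
proof -
  assume v: "deg E v = 3" "v \<in> S" and w: "w \<in> link v"
  have "w \<notin> S" using indep[OF v(2), of w] link_nbs[OF w] by blast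
  have "deg E w \<noteq> 2"
  proof
    assume "deg E w = 2"
    have "v \<in> nbs E w" using link_nbs[OF w] nbs_sym[of w v] by blast
    then have "v \<in> S \<inter> nbs2 E w" by (rule S_nbs2[OF v(2)])
    then show False using no_S_near_two_three[OF \<open>w \<notin> S\<close> \<open>deg E w = 2\<close> \<open>v \<in> nbs E w\<close> v(1)] by blast
  qed
  then have "3 \<le> deg E w" using link_deg[OF w] by linarith
  then show ?thesis using net_nonneg[OF w] v(1) by simp
qed

text \<open>Outside \<open>S\<close> the neighbour \<open>z\<close> of largest degree has degree at
  least 12, as \<open>3 * 11 < 35\<close>, and gives at least 3/2. The other two can take more than
  that only if they have degree 2 and meet \<open>S\<close>, and then \<open>heavy\<close> forces
  \<open>z\<close> to have degree \<open>k\<close>, or even more if both are in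
  \<open>S\<close>.\<close>

lemma rest_3:
  assumes v: "deg E v = 3" "triangles_at v = {}"
  shows "0 \<le> rest v"
proof -
  have rest: "rest v = (\<Sum>w \<in> link v. net v w)" using v by (simp add: rest_def)
  show ?thesis
  proof (cases "v \<in> S")
    case True
    then show ?thesis unfolding rest using net3_S v by (intro sum_nonneg) blast
  next
    case False
    have card: "card (link v) = 3" using card_link[of v] v by simp
    have *: "0 \<le> rest v" if "link v = {x, y, z}" "x \<noteq> y" "y \<noteq> z" "x \<noteq> z"
      "deg E x \<le> deg E z" "deg E y \<le> deg E z" for x y z
    proof -
      have mem: "x \<in> link v" "y \<in> link v" "z \<in> link v" using that by auto
      have V: "v \<in> \<Union>E" using mem(1) by (rule link_vertex)
      have sum: "real k + 3 + card X \<le> real (deg E x) + real (deg E y) + real (deg E z)"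
        if "X \<subseteq> S \<inter> {x, y}" for X
      proof -
        have "X \<subseteq> S \<inter> nbs2 E v"
          using that S_nbs2[OF _ link_nbs[OF mem(1)]] S_nbs2[OF _ link_nbs[OF mem(2)]] by blast
        then show ?thesis using heavy_sum[OF V False, of X] v \<open>link v = {x, y, z}\<close> \<open>x \<noteq> y\<close> \<open>y \<noteq> z\<close> \<open>x \<noteq> z\<close> by simp
      qed
      note s0 = sum[of "{}", simplified]
      have s1: "x \<in> S \<Longrightarrow> real k + 4 \<le> real (deg E x) + real (deg E y) + real (deg E z)"
        "y \<in> S \<Longrightarrow> real k + 4 \<le> real (deg E x) + real (deg E y) + real (deg E z)"
        using sum[of "{x}"] sum[of "{y}"] by auto
      have s2: "x \<in> S \<Longrightarrow> y \<in> S \<Longrightarrow> real k + 5 \<le> real (deg E x) + real (deg E y) + real (deg E z)"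
        using sum[of "{x, y}"] \<open>x \<noteq> y\<close> by simp
      have z12: "12 \<le> deg E z" using s0 that k by linarith
      have nz: "net v z = 2 - 6 / deg E z" using net_big[OF mem(3)] v z12 by simp
      have n12: "3/2 \<le> net v z" using nz frac_le[of 12 "deg E z" 6] z12 by simp
      have nk: "net v z = 2 - 6 / k" if "k \<le> deg E z" using nz that deg_le[of z] by simp
      have r: "rest v = net v x + net v y + net v z" using rest that by simp
      have zk: "deg E z \<le> k" by (rule deg_le)
      note nx = net_cases[OF mem(1), unfolded v(1), simplified]
      note ny = net_cases[OF mem(2), unfolded v(1), simplified]
      \<comment> \<open>A neighbour takes 1 only if it has degree 2 and is in \<open>S\<close>; any
        other one takes at most \<open>6 / k\<close>.\<close>
      consider (both) "x \<in> S" "y \<in> S" "deg E x = 2" "deg E y = 2"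
        | (mixed) "x \<in> S \<or> y \<in> S" "deg E x = 2" "deg E y = 2" "net v x + net v y \<ge> -1 - 6 / k"
        | (one) "net v x + net v y \<ge> -1" | (none) "net v x + net v y \<ge> - (6 / k) - 6 / k"
      proof -
        have "net v x \<ge> - (6 / k) \<or> deg E x = 2 \<and> x \<in> S \<and> net v x = -1"
          "net v y \<ge> - (6 / k) \<or> deg E y = 2 \<and> y \<in> S \<and> net v y = -1"
          "net v x \<ge> 0 \<or> deg E x = 2 \<and> net v x \<ge> -1"
          "net v y \<ge> 0 \<or> deg E y = 2 \<and> net v y \<ge> -1"
          using nx ny six_div_k by linarith+
        then show thesis using that by argo
      qed
      then show ?thesis
      proof cases
        case both
        then show ?thesis using s2 zk by simp
      next
        case mixed
        then have "k \<le> deg E z" using s1 by auto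
        then show ?thesis using nk mixed r six_div_k by simp
      next
        case one
        then show ?thesis using r n12 by simp
      next
        case none
        then show ?thesis using r n12 six_div_k by simp
      qed
    qed
    obtain x y z where xyz: "link v = {x, y, z}" "x \<noteq> y" "y \<noteq> z" "x \<noteq> z"
      using card by (auto simp: card_3_iff)
    consider "deg E x \<le> deg E z \<and> deg E y \<le> deg E z" | "deg E x \<le> deg E y \<and> deg E z \<le> deg E y"
      | "deg E y \<le> deg E x \<and> deg E z \<le> deg E x" by linarith
    then show ?thesis
      using *[of x y z] *[of x z y] *[of y z x] xyz by cases (auto simp: insert_commute)
  qed
qed

lemma sum_net_lower:
  fixes c :: real
  assumes "\<And>w. w \<in> link v \<Longrightarrow> c \<le> net v w"
  shows "card (link v) * c \<le> (\<Sum>w \<in> link v. net v w)"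
  using sum_bounded_below[of "link v" c "net v"] assms by simp

text \<open>For \<open>v\<close> in \<open>S\<close>, all neighbours are outside \<open>S\<close>
  and take at most an even share. Otherwise each takes at most 1, but by \<open>heavy\<close> one
  has degree at least 6 and instead gives at least 1, so at least
  \<open>2 * d - 6 - (d - 1) + 1 = d - 4\<close> remains at degree \<open>d\<close>.\<close>

lemma rest_45:
  assumes v: "deg E v = 4 \<or> deg E v = 5" "triangles_at v = {}"
  shows "0 \<le> rest v"
proof -
  have card: "card (link v) = deg E v" using card_link[of v] v by simp
  have lower: "-1 \<le> net v w" if "w \<in> link v" for w
    using net_lower[OF that] v by auto
  show ?thesis
  proof (cases "v \<in> S")
    case True
    have lw: "- (2 - 6 / real (deg E v)) \<le> net v w" if "w \<in> link v" for w
    proof -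
      have "w \<notin> S" using indep[OF True, of w] link_nbs[OF that] by blast
      then show ?thesis using net_lower_not_S[OF that] v by auto
    qed
    have "card (link v) * (- (2 - 6 / real (deg E v))) \<le> (\<Sum>w \<in> link v. net v w)"
      by (rule sum_net_lower) (rule lw)
    then show ?thesis unfolding rest_def card using v by auto
  next
    case False
    have ne: "link v \<noteq> {}" using card v by auto
    then have V: "v \<in> \<Union>E" using link_vertex by (metis ex_in_conv)
    have "\<exists>w \<in> link v. 6 \<le> deg E w"
    proof (rule ccontr)
      assume "\<not> ?thesis"
      then have "(\<Sum>w \<in> link v. real (deg E w)) \<le> of_nat (card (link v)) * 5"
        by (intro sum_bounded_above) fastforce
      then show False using heavy_sum[OF V False, of "{}"] v k card by auto
    qed
    then obtain z where z: "z \<in> link v" "6 \<le> deg E z" by blast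
    have big: "\<exists>w \<in> link v. 4/3 \<le> net v w" if v4: "deg E v = 4"
    proof (rule ccontr)
      assume neg: "\<not> ?thesis"
      have "deg E w \<le> 8" if w: "w \<in> link v" for w
      proof (rule ccontr)
        assume "\<not> deg E w \<le> 8"
        then have "9 \<le> deg E w" by simp
        then have "4/3 \<le> net v w" using net_big[OF w] v frac_le[of 9 "deg E w" 6] by auto
        then show False using neg w by blast
      qed
      then have "(\<Sum>w \<in> link v. real (deg E w)) \<le> of_nat (card (link v)) * 8"
        by (intro sum_bounded_above) fastforce
      then show False using heavy_sum[OF V False, of "{}"] v4 v k card by auto
    qed
    have split: "real (card (link v) - 1) * (-1) + net v w \<le> (\<Sum>w \<in> link v. net v w)" if "w \<in> link v" for w
    proof -
      have "(\<Sum>w \<in> link v. net v w) = net v w + (\<Sum>x \<in> link v - {w}. net v x)"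
        by (rule sum.remove[OF finite_link that])
      moreover have "of_nat (card (link v - {w})) * (-1) \<le> (\<Sum>x \<in> link v - {w}. net v x)"
        by (rule sum_bounded_below) (use lower in blast)
      moreover have "card (link v - {w}) = card (link v) - 1" using that finite_link by simp
      ultimately show ?thesis by simp
    qed
    have "1 \<le> net v z" using net_big[OF z(1)] z(2) v by auto
    then show ?thesis
      using split[OF z(1)] big split v card unfolding rest_def by fastforce
  qed
qed

lemma rest_nonneg:
  assumes "v \<in> \<Union>E" "triangles_at v = {}"
  shows "0 \<le> rest v"
proof -
  have "2 \<le> deg E v" using assms(1) by (rule deg_ge)
  then consider "deg E v = 2" | "deg E v = 3" | "deg E v = 4 \<or> deg E v = 5" | "6 \<le> deg E v" by linarith
  then show ?thesis
    using rest_2 rest_3 rest_45 rest_big[of v] assms(2) by cases auto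
qed

end

section \<open>The share of a vertex in one of its triangles, by degree\<close>

context discharging
begin

text \<open>An ordered form of a triangle, headed by the vertex whose share is considered.\<close>

definition is_triangle :: "'a \<Rightarrow> 'a \<Rightarrow> 'a \<Rightarrow> bool" where
  "is_triangle v p q \<longleftrightarrow> {v, p, q} \<in> triangles E \<and> v \<noteq> p \<and> v \<noteq> q \<and> p \<noteq> q"

lemma is_triangle_rotate: "is_triangle v p q \<Longrightarrow> is_triangle p q v"
  unfolding is_triangle_def by (auto simp: insert_commute)

lemma is_triangle_swap: "is_triangle v p q \<Longrightarrow> is_triangle v q p"
  unfolding is_triangle_def by (auto simp: insert_commute)

lemma is_triangleD:
  assumes "is_triangle v p q"
  shows "{v, p, q} \<in> triangles_at v" "{v, p, q} - {v} = {p, q}" "p \<in> nbs E v" "q \<in> nbs E v"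
    "v \<in> \<Union>E" "1 \<le> card (triangles_at v)"
proof -
  show T: "{v, p, q} \<in> triangles_at v" using assms by (simp add: is_triangle_def triangles_at_def)
  show "{v, p, q} - {v} = {p, q}" using assms by (auto simp: is_triangle_def)
  show p: "p \<in> nbs E v" using assms triangle_nbs[of "{v, p, q}" v p] by (simp add: is_triangle_def)
  show "q \<in> nbs E v" using assms triangle_nbs[of "{v, p, q}" v q] by (simp add: is_triangle_def)
  show "v \<in> \<Union>E" using p by (rule nbs_vertex)
  have "0 < card (triangles_at v)" using T finite_triangles_at by (auto simp: card_gt_0_iff)
  then show "1 \<le> card (triangles_at v)" by simp
qed

lemma one_triangle:
  assumes "is_triangle v p q" "card (triangles_at v) = 1"
  shows "triangles_at v = {{v, p, q}}"
proof -
  obtain T where "triangles_at v = {T}" using assms(2) by (rule card_1_singletonE)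
  then show ?thesis using is_triangleD(1)[OF assms(1)] by simp
qed

lemma share_one:
  assumes "is_triangle v p q" "card (triangles_at v) = 1"
  shows "share v {v, p, q} = rest v"
  unfolding share_def using one_triangle[OF assms] by simp

text \<open>A neighbour on a triangle brings only its degree minus 1, which turns
  \<open>k + 3\<close> into \<open>k + 5\<close>, and into \<open>k + 7\<close> when there are two
  triangles.\<close>

lemma heavy_one:
  assumes t: "is_triangle v p q" "card (triangles_at v) = 1" and v: "v \<notin> S" "X \<subseteq> S \<inter> nbs2 E v"
  shows "k + 5 + card X \<le> (\<Sum>w \<in> link v. deg E w) + deg E p + deg E q"
proof -
  have "real k + 3 + card X \<le> (\<Sum>w \<in> link v. real (deg E w)) + (real (deg E p) - 1 + (real (deg E q) - 1))"
    using heavy_sum[OF is_triangleD(5)[OF t(1)] v] t(1)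
    unfolding one_triangle[OF t] by (simp add: is_triangleD(2) is_triangle_def)
  then have "real (k + 5 + card X) \<le> real ((\<Sum>w \<in> link v. deg E w) + deg E p + deg E q)" by simp
  then show ?thesis by (simp only: of_nat_le_iff)
qed

lemma two_triangles:
  assumes "is_triangle v p q" "card (triangles_at v) = 2"
  obtains T' where "triangles_at v = {{v, p, q}, T'}" "{v, p, q} \<noteq> T'"
proof -
  have "card (triangles_at v - {{v, p, q}}) = 1"
    using assms(2) is_triangleD(1)[OF assms(1)] finite_triangles_at by simp
  then obtain T' where T': "triangles_at v - {{v, p, q}} = {T'}" by (rule card_1_singletonE)
  show thesis
  proof (rule that)
    show "triangles_at v = {{v, p, q}, T'}"
      using T' is_triangleD(1)[OF assms(1)] by (metis insert_Diff)
    show "{v, p, q} \<noteq> T'" using T' by (metis DiffE insertI1)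
  qed
qed

lemma heavy_two:
  assumes t: "is_triangle v p q" "triangles_at v = {{v, p, q}, T'}" "{v, p, q} \<noteq> T'" and v: "v \<notin> S"
    and l: "link v = {}"
  shows "k + 7 \<le> deg E p + deg E q + (\<Sum>w \<in> T' - {v}. deg E w)"
proof -
  have "T' \<in> triangles E" "v \<in> T'" using t(2) unfolding triangles_at_def by blast+
  then have c: "card (T' - {v}) = 2" using card_triangle finite_triangle by simp
  have "(\<Sum>T \<in> {{v, p, q}, T'}. \<Sum>w \<in> T - {v}. real (deg E w) - 1) =
      (\<Sum>w \<in> {v, p, q} - {v}. real (deg E w) - 1) + (\<Sum>w \<in> T' - {v}. real (deg E w) - 1)"
    using t(3) by simp
  moreover have "(\<Sum>w \<in> T' - {v}. real (deg E w) - 1) = real (\<Sum>w \<in> T' - {v}. deg E w) - 2"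
    using c by (simp add: sum_subtractf)
  moreover have "(\<Sum>w \<in> {v, p, q} - {v}. real (deg E w) - 1) = real (deg E p) + real (deg E q) - 2"
    unfolding is_triangleD(2)[OF t(1)] using t(1) by (simp add: is_triangle_def)
  ultimately have "real k + 3 \<le> real (deg E p) + real (deg E q) - 2 + (real (\<Sum>w \<in> T' - {v}. deg E w) - 2)"
    using heavy_sum[OF is_triangleD(5)[OF t(1)] v, of "{}"] l t(2) by simp
  then have "real (k + 7) \<le> real (deg E p + deg E q + (\<Sum>w \<in> T' - {v}. deg E w))" by simp
  then show ?thesis by (simp only: of_nat_le_iff)
qed

text \<open>An ear passes its whole deficit to its triangle. By \<open>no_ear\<close> it is outside
  \<open>S\<close>, so \<open>heavy\<close> makes the other two vertices of the triangle
  large.\<close>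

lemma share_2:
  assumes t: "is_triangle v p q" and v: "deg E v = 2"
  shows "share v {v, p, q} = -2" "v \<notin> S" "X \<subseteq> S \<inter> nbs2 E v \<Longrightarrow> k + 5 + card X \<le> deg E p + deg E q"
proof -
  have c: "card (triangles_at v) = 1" "card (link v) = 0"
    using card_link[of v] is_triangleD(6)[OF t] v by linarith+
  then have l: "link v = {}" using finite_link by simp
  show "share v {v, p, q} = -2" using share_one[OF t c(1)] v l by (simp add: rest_def)
  show vS: "v \<notin> S" using no_ear[of v] v is_triangleD(1)[OF t] by blast
  show "X \<subseteq> S \<inter> nbs2 E v \<Longrightarrow> k + 5 + card X \<le> deg E p + deg E q"
    using heavy_one[OF t c(1) vS, of X] l by simp
qed

text \<open>The initial charge is 0 and one edge lies outside the triangle, so the share is the net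
  income along that edge.\<close>

lemma share_3:
  assumes t: "is_triangle v p q" and v: "deg E v = 3"
  obtains x where "link v = {x}" "share v {v, p, q} = net v x"
    "\<And>X. v \<notin> S \<Longrightarrow> X \<subseteq> S \<inter> nbs2 E v \<Longrightarrow> k + 5 + card X \<le> deg E x + deg E p + deg E q"
proof -
  have c: "card (triangles_at v) = 1" "card (link v) = 1"
    using card_link[of v] is_triangleD(6)[OF t] v by presburger+
  obtain x where l: "link v = {x}" using c(2) by (rule card_1_singletonE)
  show thesis
  proof (rule that[of x])
    show "share v {v, p, q} = net v x" using share_one[OF t c(1)] v l by (simp add: rest_def)
    show "k + 5 + card X \<le> deg E x + deg E p + deg E q" if "v \<notin> S" "X \<subseteq> S \<inter> nbs2 E v" for X
      using heavy_one[OF t c(1) that] l by simp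
  qed (rule l)
qed

lemma share_3_S: "is_triangle v p q \<Longrightarrow> deg E v = 3 \<Longrightarrow> v \<in> S \<Longrightarrow> 0 \<le> share v {v, p, q}"
  by (erule (1) share_3) (simp add: net3_S)

text \<open>If the triangle neighbours have small degrees, \<open>heavy\<close> leaves at least
  \<open>n\<close> for the third neighbour. One of them being in \<open>S\<close> counts for one
  more.\<close>

lemma share_3_high:
  assumes t: "is_triangle v p q" and v: "deg E v = 3" "v \<notin> S" and n: "6 \<le> n"
    "deg E p + deg E q + n \<le> k + 5 + (if p \<in> S \<or> q \<in> S then 1 else 0)"
  shows "2 - 6 / real n \<le> share v {v, p, q}"
proof -
  obtain x where x: "link v = {x}" "share v {v, p, q} = net v x"
    "\<And>X. v \<notin> S \<Longrightarrow> X \<subseteq> S \<inter> nbs2 E v \<Longrightarrow> k + 5 + card X \<le> deg E x + deg E p + deg E q"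
    using share_3[OF t v(1)] by blast
  have "k + 5 + (if p \<in> S \<or> q \<in> S then 1 else 0) \<le> deg E x + deg E p + deg E q"
    using x(3)[OF v(2), of "{}"] x(3)[OF v(2), of "{p}"] x(3)[OF v(2), of "{q}"]
      S_nbs2[of p v] S_nbs2[of q v] is_triangleD(3,4)[OF t] by auto
  then have "n \<le> deg E x" using n by linarith
  moreover have "x \<in> link v" using x by simp
  then have "net v x = 2 - 6 / deg E x" using net_big(1) v \<open>n \<le> deg E x\<close> n by simp
  moreover have "6 / real (deg E x) \<le> 6 / real n" by (rule frac_le) (use n \<open>n \<le> deg E x\<close> in simp_all)
  ultimately show ?thesis using x by linarith
qed

text \<open>A negative share means a third neighbour of degree 2, and then \<open>heavy\<close>
  makes \<open>deg E p + deg E q\<close> large. The last alternative keeps this neighbour as a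
  vertex of \<open>S\<close>, for use with \<open>share_4_far\<close>.\<close>

lemma share_3_cases:
  assumes t: "is_triangle v p q" and v: "deg E v = 3"
  shows "0 \<le> share v {v, p, q} \<or>
    k + 3 \<le> deg E p + deg E q \<and> - (6 / k) \<le> share v {v, p, q} \<or>
    k + 4 \<le> deg E p + deg E q \<and> -1 \<le> share v {v, p, q} \<and>
      (\<exists>u \<in> S. u \<in> nbs E v \<and> u \<noteq> p \<and> u \<noteq> q)"
proof (cases "v \<in> S")
  case True
  then show ?thesis using share_3_S[OF t v] by blast
next
  case False
  obtain x where x: "link v = {x}" "share v {v, p, q} = net v x"
    "\<And>X. v \<notin> S \<Longrightarrow> X \<subseteq> S \<inter> nbs2 E v \<Longrightarrow> k + 5 + card X \<le> deg E x + deg E p + deg E q"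
    using share_3[OF t v(1)] by blast
  have xl: "x \<in> link v" using x by simp
  note xn = link_nbs[OF xl]
  have "\<not> in_triangle v x" using xl by (simp add: link_def)
  moreover have "in_triangle v p" "in_triangle v q"
    using t unfolding in_triangle_def is_triangle_def by auto
  ultimately have xpq: "x \<noteq> p" "x \<noteq> q" by blast+
  consider "deg E x = 2" "x \<in> S" "net v x = -1" | "deg E x = 2" "net v x = - (6 / k)" | "0 \<le> net v x"
    using net_cases[OF xl] v by fastforce
  then show ?thesis
  proof cases
    case 1
    then have "k + 4 \<le> deg E p + deg E q" using x(3)[OF False, of "{x}"] S_nbs2[OF _ xn] by simp
    then show ?thesis using 1 x(2) xn xpq by auto
  next
    case 2
    then have "k + 3 \<le> deg E p + deg E q" using x(3)[OF False, of "{}"] by simp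
    then show ?thesis using 2 x(2) by simp
  next
    case 3
    then show ?thesis using x(2) by simp
  qed
qed

lemma share_4:
  assumes t: "is_triangle v p q" and v: "deg E v = 4"
  obtains (one) x y where "link v = {x, y}" "x \<noteq> y" "card (triangles_at v) = 1"
      "share v {v, p, q} = 2 + net v x + net v y"
    | (two) T' where "triangles_at v = {{v, p, q}, T'}" "{v, p, q} \<noteq> T'" "link v = {}"
      "share v {v, p, q} = 1 + (rich v T' - rich v {v, p, q}) / 2"
proof -
  have "card (triangles_at v) = 1 \<and> card (link v) = 2 \<or> card (triangles_at v) = 2 \<and> card (link v) = 0"
    using card_link[of v] is_triangleD(6)[OF t] v by presburger
  then consider "card (triangles_at v) = 1" "card (link v) = 2" | "card (triangles_at v) = 2" "card (link v) = 0"
    by metis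
  then show thesis
  proof cases
    case 1
    then obtain x y where xy: "link v = {x, y}" "x \<noteq> y" by (auto simp: card_2_iff)
    then show thesis using one[OF xy 1(1)] share_one[OF t 1(1)] v by (simp add: rest_def)
  next
    case 2
    then have l: "link v = {}" using finite_link by simp
    obtain T' where T': "triangles_at v = {{v, p, q}, T'}" "{v, p, q} \<noteq> T'"
      using two_triangles[OF t 2(1)] by blast
    have "share v {v, p, q} = 2 / 2 + (rich v {v, p, q} + rich v T' - 2 * rich v {v, p, q}) / 2"
      unfolding share_def using v l 2 T' by (simp add: rest_def)
    then show thesis using two[OF T' l] by (simp add: field_simps)
  qed
qed

lemma rich_eq: "is_triangle v p q \<Longrightarrow> rich v {v, p, q} = of_bool (k \<le> 2 + deg E p + deg E q)"
  unfolding rich_def by (simp add: is_triangleD(2)) (simp add: is_triangle_def add.assoc)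

lemma rich_range: "0 \<le> rich v T" "rich v T \<le> 1"
  by (simp_all add: rich_def)

lemma share_4_nonneg:
  assumes t: "is_triangle v p q" and v: "deg E v = 4"
  shows "0 \<le> share v {v, p, q}"
  using t v
proof (cases rule: share_4)
  case (one x y)
  then show ?thesis using net_lower[of x v] net_lower[of y v] v by simp
next
  case (two T')
  show ?thesis using rich_range[of v T'] rich_range[of v "{v, p, q}"] unfolding two(4)
    by (simp add: field_simps)
qed

lemma link_S_not_S: "x \<in> link v \<Longrightarrow> x \<in> S \<Longrightarrow> v \<notin> S"
  using indep[of v x] link_nbs[of x v] by blast

lemma net4_ge:
  assumes "x \<in> link v" "deg E v = 4" "x \<notin> S \<or> deg E x \<noteq> 2"
  shows "- 1 / 2 \<le> net v x"
proof (cases "deg E x = 2")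
  case True
  then show ?thesis using net_lower_not_S[OF assms(1)] assms(2,3) by simp
next
  case False
  then have "0 \<le> net v x" using net_nonneg[OF assms(1)] link_deg[OF assms(1)] assms(2) by simp
  then show ?thesis by simp
qed

text \<open>With one triangle, a share below 1 needs two further neighbours of degree 2, one of them
  in \<open>S\<close>, and \<open>heavy\<close> applies. With two triangles, it needs this one to be
  rich.\<close>

lemma share_4_cases:
  assumes t: "is_triangle v p q" and v: "deg E v = 4"
  shows "1 \<le> share v {v, p, q} \<or> k \<le> 2 + deg E p + deg E q"
  using t v
proof (cases rule: share_4)
  case (one x y)
  have xl: "x \<in> link v" "y \<in> link v" using one by auto
  have nx: "-1 \<le> net v x" "-1 \<le> net v y" using net_lower xl v by simp_all
  have hv: "k + 6 \<le> 4 + deg E p + deg E q" if "deg E x = 2" "deg E y = 2" "w \<in> S" "w \<in> link v" for w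
  proof -
    have "v \<notin> S" using link_S_not_S that by blast
    then show ?thesis
      using heavy_one[OF t one(3), of "{w}"] S_nbs2[OF that(3) link_nbs[OF that(4)]] that(1,2) one(1,2) by simp
  qed
  show ?thesis
  proof (cases "deg E x = 2 \<and> deg E y = 2")
    case True
    show ?thesis
    proof (cases "x \<in> S \<or> y \<in> S")
      case True
      then show ?thesis using hv[of x] hv[of y] xl \<open>deg E x = 2 \<and> deg E y = 2\<close> by auto
    next
      case False
      then show ?thesis using net4_ge[OF xl(1) v] net4_ge[OF xl(2) v] one(4) by simp
    qed
  next
    case False
    then have "3 \<le> deg E x \<or> 3 \<le> deg E y" using link_deg[OF xl(1)] link_deg[OF xl(2)] by linarith
    then have "0 \<le> net v x \<or> 0 \<le> net v y" using net_nonneg[OF xl(1)] net_nonneg[OF xl(2)] v by auto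
    then show ?thesis using nx one(4) by auto
  qed
next
  case (two T')
  then show ?thesis using rich_eq[OF t] rich_range[of v T'] by (auto simp: add.assoc)
qed

text \<open>The degrees missing in the triangle must be found elsewhere: either at a neighbour of
  degree at least 12, which gives 3/2, or in a second triangle, which is then rich and cedes
  1/2.\<close>

lemma share_4_poor:
  assumes t: "is_triangle v p q" and v: "deg E v = 4" "v \<notin> S" and pq: "deg E p + deg E q \<le> 9"
  shows "3 / 2 \<le> share v {v, p, q}"
  using t v(1)
proof (cases rule: share_4)
  case (one x y)
  have xl: "x \<in> link v" "y \<in> link v" using one by auto
  have "k + 5 \<le> deg E x + deg E y + deg E p + deg E q"
    using heavy_one[OF t one(3) v(2), of "{}"] one(1,2) by simp
  then have "12 \<le> deg E x \<or> 12 \<le> deg E y" using pq k by linarith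
  moreover have "3 / 2 \<le> net v z" if "z \<in> link v" "12 \<le> deg E z" for z
    using net_big[OF that(1)] v that(2) by simp
  ultimately have "3 / 2 \<le> net v x \<or> 3 / 2 \<le> net v y" using xl by blast
  then show ?thesis using net_lower[OF xl(1)] net_lower[OF xl(2)] v one(4) by auto
next
  case (two T')
  have "k + 7 \<le> deg E p + deg E q + (\<Sum>w \<in> T' - {v}. deg E w)"
    by (rule heavy_two[OF t two(1,2) v(2) two(3)])
  then have "rich v T' = 1" unfolding rich_def using pq by simp
  moreover have "rich v {v, p, q} = 0" using rich_eq[OF t] pq k by simp
  ultimately show ?thesis using two(4) by simp
qed

text \<open>A share below 1/2 would need two neighbours of degree 2 in \<open>S\<close> outside the
  triangle. With \<open>u\<close> these are three vertices of \<open>S\<close> near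
  \<open>v\<close>, and \<open>heavy\<close> would force \<open>deg E p + deg E q\<close> above
  \<open>k + 3\<close>.\<close>

lemma share_4_far:
  assumes t: "is_triangle v p q" and v: "deg E v = 4" and pq: "deg E p + deg E q \<le> k + 3"
    and u: "u \<in> S" "u \<in> nbs2 E v" "u \<notin> nbs E v"
  shows "1 / 2 \<le> share v {v, p, q}"
  using t v
proof (cases rule: share_4)
  case (one x y)
  have xl: "x \<in> link v" "y \<in> link v" using one by auto
  have nx: "-1 \<le> net v x" "-1 \<le> net v y" using net_lower xl v by simp_all
  have "\<not> (deg E x = 2 \<and> x \<in> S \<and> deg E y = 2 \<and> y \<in> S)"
  proof
    assume xy: "deg E x = 2 \<and> x \<in> S \<and> deg E y = 2 \<and> y \<in> S"
    then have "v \<notin> S" using link_S_not_S xl by blast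
    have "x \<noteq> u" "y \<noteq> u" using u(3) link_nbs[OF xl(1)] link_nbs[OF xl(2)] by blast+
    then have "card {x, y, u} = 3" using one(2) by simp
    moreover have "{x, y, u} \<subseteq> S \<inter> nbs2 E v"
      using u S_nbs2[OF _ link_nbs[OF xl(1)]] S_nbs2[OF _ link_nbs[OF xl(2)]] xy by blast
    ultimately show False
      using heavy_one[OF t one(3) \<open>v \<notin> S\<close>, of "{x, y, u}"] one(1,2) xy pq by simp
  qed
  then have "- 1 / 2 \<le> net v x \<or> - 1 / 2 \<le> net v y"
    using net4_ge[OF xl(1) v] net4_ge[OF xl(2) v] by blast
  then show ?thesis using nx one(4) by auto
next
  case (two T')
  show ?thesis using rich_range[of v T'] rich_range[of v "{v, p, q}"] unfolding two(4)
    by (simp add: field_simps)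
qed

text \<open>The initial charge is 4 and a neighbour outside triangles takes at most 1. With two
  triangles there is one such neighbour, which leaves at least \<open>(4 - 1) / 2\<close> for each
  triangle.\<close>

lemma share_5:
  assumes t: "is_triangle v p q" and v: "deg E v = 5"
  obtains (one) x y z where "link v = {x, y, z}" "x \<noteq> y" "x \<noteq> z" "y \<noteq> z" "card (triangles_at v) = 1"
      "share v {v, p, q} = 4 + net v x + net v y + net v z"
    | (two) "3 / 2 \<le> share v {v, p, q}"
proof -
  have "card (triangles_at v) = 1 \<and> card (link v) = 3 \<or> card (triangles_at v) = 2 \<and> card (link v) = 1"
    using card_link[of v] is_triangleD(6)[OF t] v by presburger
  then consider "card (triangles_at v) = 1" "card (link v) = 3" | "card (triangles_at v) = 2" "card (link v) = 1"
    by metis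
  then show thesis
  proof cases
    case 1
    then obtain x y z where xy: "link v = {x, y, z}" "x \<noteq> y" "x \<noteq> z" "y \<noteq> z" by (auto simp: card_3_iff)
    then show thesis using one[OF xy 1(1)] share_one[OF t 1(1)] v by (simp add: rest_def)
  next
    case 2
    obtain x where l: "link v = {x}" using 2(2) by (rule card_1_singletonE)
    have "share v {v, p, q} = (4 + net v x) / 2"
      unfolding share_def using v l 2 by (simp add: rest_def)
    moreover have "-1 \<le> net v x" using net_lower[of x v] l v by simp
    ultimately show thesis using two by simp
  qed
qed

lemma net5_ge:
  assumes "x \<in> link v" "deg E v = 5" "x \<notin> S \<or> deg E x \<noteq> 2"
  shows "- 4 / 5 \<le> net v x"
proof (cases "deg E x = 2")
  case True
  then show ?thesis using net_lower_not_S[OF assms(1)] assms(2,3) by simp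
next
  case False
  then have "0 \<le> net v x" using net_nonneg[OF assms(1)] link_deg[OF assms(1)] assms(2) by simp
  then show ?thesis by simp
qed

lemma share_5_ge_1:
  assumes t: "is_triangle v p q" and v: "deg E v = 5"
  shows "1 \<le> share v {v, p, q}"
  using t v
proof (cases rule: share_5)
  case (one x y z)
  then show ?thesis using net_lower[of x v] net_lower[of y v] net_lower[of z v] v by simp
qed simp

text \<open>Neighbours outside \<open>S\<close> take at most 4/5 each, and
  \<open>4 - 3 * 4 / 5 = 8 / 5\<close>.\<close>

lemma share_5_far:
  assumes t: "is_triangle v p q" and v: "deg E v = 5" and far: "S \<inter> nbs E v = {}"
  shows "3 / 2 \<le> share v {v, p, q}"
  using t v
proof (cases rule: share_5)
  case (one x y z)
  have l: "x \<in> link v" "y \<in> link v" "z \<in> link v" using one by auto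
  then have "x \<notin> S" "y \<notin> S" "z \<notin> S" using far link_nbs by blast+
  then show ?thesis using net5_ge[OF l(1) v] net5_ge[OF l(2) v] net5_ge[OF l(3) v] one(6) by simp
qed simp

text \<open>With one triangle, less than 3/2 is left only if all three further neighbours have
  degree 2 and one is in \<open>S\<close>; \<open>heavy\<close> then gives the second
  alternative.\<close>

lemma share_5_cases:
  assumes t: "is_triangle v p q" and v: "deg E v = 5"
  shows "3 / 2 \<le> share v {v, p, q} \<or> k \<le> deg E p + deg E q"
  using t v
proof (cases rule: share_5)
  case (one x y z)
  have l: "x \<in> link v" "y \<in> link v" "z \<in> link v" using one by auto
  have lower: "-1 \<le> net v x" "-1 \<le> net v y" "-1 \<le> net v z" using net_lower l v by simp_all
  show ?thesis
  proof (cases "deg E x = 2 \<and> deg E y = 2 \<and> deg E z = 2")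
    case True
    show ?thesis
    proof (cases "x \<in> S \<or> y \<in> S \<or> z \<in> S")
      case s: True
      then obtain w where w: "w \<in> link v" "w \<in> S" using l by blast
      then have "v \<notin> S" using link_S_not_S by blast
      then have "k + 6 \<le> 6 + deg E p + deg E q"
        using heavy_one[OF t one(5), of "{w}"] S_nbs2[OF w(2) link_nbs[OF w(1)]] True one(1-4) by simp
      then show ?thesis by simp
    next
      case False
      then show ?thesis using net5_ge[OF l(1) v] net5_ge[OF l(2) v] net5_ge[OF l(3) v] one(6) by simp
    qed
  next
    case False
    then have "3 \<le> deg E x \<or> 3 \<le> deg E y \<or> 3 \<le> deg E z"
      using link_deg[OF l(1)] link_deg[OF l(2)] link_deg[OF l(3)] by linarith
    then have "0 \<le> net v x \<or> 0 \<le> net v y \<or> 0 \<le> net v z"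
      using net_nonneg[OF l(1)] net_nonneg[OF l(2)] net_nonneg[OF l(3)] v by auto
    then show ?thesis using lower one(6) by auto
  qed
qed simp

lemma share_big:
  assumes t: "is_triangle v p q" and v: "6 \<le> deg E v"
  shows "4 - 12 / deg E v \<le> share v {v, p, q}"
proof -
  have "share v {v, p, q} = rest v / card (triangles_at v)" using v by (simp add: share_def)
  moreover have "0 < real (card (triangles_at v))" using is_triangleD(6)[OF t] by simp
  ultimately show ?thesis using rest_big[OF v] by (simp add: pos_le_divide_eq mult.commute)
qed

end

section \<open>Every triangle receives at least 3\<close>

context discharging
begin

lemma share_big_ge:
  assumes "is_triangle v p q" "6 \<le> n" "n \<le> deg E v"
  shows "4 - 12 / real n \<le> share v {v, p, q}"
proof -
  have "12 / real (deg E v) \<le> 12 / real n" by (rule frac_le) (use assms in simp_all)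
  moreover have "4 - 12 / deg E v \<le> share v {v, p, q}"
    by (rule share_big[OF assms(1)]) (use assms in simp)
  ultimately show ?thesis by linarith
qed

lemma share_ge_1: "is_triangle v p q \<Longrightarrow> 5 \<le> deg E v \<Longrightarrow> 1 \<le> share v {v, p, q}"
  using share_5_ge_1[of v p q] share_big_ge[of v p q 6] by (cases "deg E v = 5") simp_all

lemma share_3_ge: "is_triangle v p q \<Longrightarrow> deg E v = 3 \<Longrightarrow> -1 \<le> share v {v, p, q}"
  using share_3_cases[of v p q] six_div_k by fastforce

text \<open>The ear takes 2, so \<open>b\<close> and \<open>c\<close> have to supply 5; their
  degrees add up to at least \<open>k + 5\<close>.\<close>

lemma share_sum_2:
  assumes ta: "is_triangle a b c" and tb: "is_triangle b c a" and tc: "is_triangle c a b"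
    and a: "deg E a = 2" and bc: "deg E b \<le> deg E c"
  shows "3 \<le> share a {a, b, c} + share b {b, c, a} + share c {c, a, b}"
proof -
  note A = share_2[OF ta a]
  have sum: "k + 5 \<le> deg E b + deg E c" using A(3)[of "{}"] by simp
  have ck: "deg E c \<le> k" by (rule deg_le)
  show ?thesis
  proof (cases "deg E b = 5")
    case True
    \<comment> \<open>A vertex of \<open>S\<close> next to \<open>b\<close> would be near the ear as
      well and require \<open>k + 6 \<le> 5 + deg E c\<close>.\<close>
    have "S \<inter> nbs E b = {}"
    proof (rule ccontr)
      assume "S \<inter> nbs E b \<noteq> {}"
      then obtain w where w: "w \<in> S" "w \<in> nbs E b" by blast
      then have "w \<noteq> a" using A(2) by blast
      then have "{w} \<subseteq> S \<inter> nbs2 E a" using w nbs2_step[OF is_triangleD(3)[OF ta], of w] by blast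
      from A(3)[OF this] show False using True ck by simp
    qed
    then have "3 / 2 \<le> share b {b, c, a}" by (rule share_5_far[OF tb True])
    moreover have "32 \<le> deg E c" using sum True k by linarith
    then have "4 - 12 / real 32 \<le> share c {c, a, b}" by (intro share_big_ge[OF tc]) simp_all
    ultimately show ?thesis using A(1) by simp
  next
    case False
    then have b6: "6 \<le> deg E b" using sum ck by linarith
    \<comment> \<open>Two vertices of degree at least 8 keep \<open>4 - 12 / 8 = 5 / 2\<close> each;
      otherwise \<open>deg E c\<close> is at least \<open>k - 2\<close>.\<close>
    show ?thesis
    proof (cases "8 \<le> deg E b")
      case True
      have "4 - 12 / real 8 \<le> share b {b, c, a}" "4 - 12 / real 8 \<le> share c {c, a, b}"
        using True bc by (intro share_big_ge[OF tb] share_big_ge[OF tc]; simp)+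
      then show ?thesis using A(1) by simp
    next
      case False
      then have "30 \<le> deg E c" using sum k by linarith
      then have "4 - 12 / real 30 \<le> share c {c, a, b}" "4 - 12 / real 6 \<le> share b {b, c, a}"
        using b6 by (intro share_big_ge[OF tb] share_big_ge[OF tc]; simp)+
      then show ?thesis using A(1) by simp
    qed
  qed
qed

lemma triangle_not_both_S: "is_triangle a b c \<Longrightarrow> \<not> (a \<in> S \<and> b \<in> S)"
  using indep[of a b] is_triangleD(3)[of a b c] by blast

text \<open>At most one vertex of the triangle is in \<open>S\<close>. While \<open>c\<close> has
  degree at most 11, \<open>heavy\<close> forces a large third neighbour upon each vertex of degree
  3 outside \<open>S\<close>, whose share is then near 2; numerals such as 31 and 23 bound the
  degree of that neighbour from below, using \<open>k \<ge> 32\<close>. From degree 12 on,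
  \<open>c\<close> alone keeps 3.\<close>

lemma share_sum_33:
  assumes ta: "is_triangle a b c" and tb: "is_triangle b c a" and tc: "is_triangle c a b"
    and a: "deg E a = 3" and b: "deg E b = 3" and c: "3 \<le> deg E c"
  shows "3 \<le> share a {a, b, c} + share b {b, c, a} + share c {c, a, b}"
proof -
  note nS = triangle_not_both_S[OF ta] triangle_not_both_S[OF tb] triangle_not_both_S[OF tc]
  have ha: "2 - 6 / real n \<le> share a {a, b, c}"
    if "a \<notin> S" "6 \<le> n" "3 + deg E c + n \<le> k + 5 + (if b \<in> S \<or> c \<in> S then 1 else 0)" for n
    by (rule share_3_high[OF ta a that(1,2)]) (use that(3) b in simp)
  have hb: "2 - 6 / real n \<le> share b {b, c, a}"
    if "b \<notin> S" "6 \<le> n" "3 + deg E c + n \<le> k + 5 + (if a \<in> S \<or> c \<in> S then 1 else 0)" for n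
    by (rule share_3_high[OF tb b that(1,2)]) (use that(3) a in \<open>simp add: disj_commute add.commute\<close>)
  have Sa: "a \<in> S \<Longrightarrow> 0 \<le> share a {a, b, c}" by (rule share_3_S[OF ta a])
  have Sb: "b \<in> S \<Longrightarrow> 0 \<le> share b {b, c, a}" by (rule share_3_S[OF tb b])
  have ck: "deg E c \<le> k" by (rule deg_le)
  consider "deg E c = 3" | "deg E c = 4" | "deg E c = 5" | "6 \<le> deg E c" "deg E c \<le> 11" | "12 \<le> deg E c"
    using c by linarith
  then show ?thesis
  proof cases
    case 1
    have hc: "2 - 6 / real n \<le> share c {c, a, b}"
      if "c \<notin> S" "6 \<le> n" "6 + n \<le> k + 5 + (if a \<in> S \<or> b \<in> S then 1 else 0)" for n
      by (rule share_3_high[OF tc 1 that(1,2)]) (use that(3) a b in simp)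
    have Sc: "c \<in> S \<Longrightarrow> 0 \<le> share c {c, a, b}" by (rule share_3_S[OF tc 1])
    consider "a \<notin> S" "b \<notin> S" "c \<notin> S" | "a \<in> S" "b \<notin> S" "c \<notin> S" | "a \<notin> S" "b \<in> S" "c \<notin> S"
      | "a \<notin> S" "b \<notin> S" "c \<in> S" using nS by blast
    then show ?thesis
    proof cases
      case 1
      then show ?thesis using ha[of 31] hb[of 31] hc[of 31] k \<open>deg E c = 3\<close> by simp
    next
      case 2
      then show ?thesis using Sa hb[of 32] hc[of 32] k \<open>deg E c = 3\<close> by simp
    next
      case 3
      then show ?thesis using Sb ha[of 32] hc[of 32] k \<open>deg E c = 3\<close> by simp
    next
      case 4
      then show ?thesis using Sc ha[of 32] hb[of 32] k \<open>deg E c = 3\<close> by simp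
    qed
  next
    case 2
    have C0: "0 \<le> share c {c, a, b}" by (rule share_4_nonneg[OF tc 2])
    have C1: "c \<notin> S \<Longrightarrow> 3 / 2 \<le> share c {c, a, b}"
      by (rule share_4_poor[OF tc 2]) (use a b in simp_all)
    consider "a \<notin> S" "b \<notin> S" | "a \<in> S" "b \<notin> S" "c \<notin> S" | "a \<notin> S" "b \<in> S" "c \<notin> S" using nS by blast
    then show ?thesis
    proof cases
      case 1
      then show ?thesis using C0 ha[of 30] hb[of 30] k 2 by simp
    next
      case 2
      then show ?thesis using C1 Sa hb[of 31] k \<open>deg E c = 4\<close> by simp
    next
      case 3
      then show ?thesis using C1 Sb ha[of 31] k \<open>deg E c = 4\<close> by simp
    qed
  next
    case 3
    have C: "3 / 2 \<le> share c {c, a, b}" using share_5_cases[OF tc 3] a b k by simp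
    consider "a \<notin> S" "b \<notin> S" | "a \<in> S" "b \<notin> S" "c \<notin> S" | "a \<notin> S" "b \<in> S" "c \<notin> S" using nS by blast
    then show ?thesis
    proof cases
      case 1
      then show ?thesis using C ha[of 29] hb[of 29] k 3 by simp
    next
      case 2
      then show ?thesis using C Sa hb[of 30] k \<open>deg E c = 5\<close> by simp
    next
      case 3
      then show ?thesis using C Sb ha[of 30] k \<open>deg E c = 5\<close> by simp
    qed
  next
    case 4
    have C: "4 - 12 / real 6 \<le> share c {c, a, b}" by (rule share_big_ge[OF tc]) (use 4 in simp_all)
    have "a \<notin> S \<Longrightarrow> 2 - 6 / real 23 \<le> share a {a, b, c}" using 4 k by (intro ha) auto
    moreover have "b \<notin> S \<Longrightarrow> 2 - 6 / real 23 \<le> share b {b, c, a}" using 4 k by (intro hb) auto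
    ultimately show ?thesis using C Sa Sb nS(1) by (cases "a \<in> S"; cases "b \<in> S") auto
  next
    case 5
    have C: "4 - 12 / real 12 \<le> share c {c, a, b}" by (rule share_big_ge[OF tc]) (use 5 in simp_all)
    \<comment> \<open>The remaining alternative of \<open>share_3_cases\<close> would need
      \<open>deg E c > k\<close>.\<close>
    have A: "0 \<le> share a {a, b, c} \<or> k \<le> deg E c \<and> - (6 / k) \<le> share a {a, b, c}"
      using share_3_cases[OF ta a] b ck by auto
    have B: "0 \<le> share b {b, c, a} \<or> k \<le> deg E c \<and> - (6 / k) \<le> share b {b, c, a}"
      using share_3_cases[OF tb b] a ck by auto
    show ?thesis
    proof (cases "k \<le> deg E c")
      case True
      then have "4 - 12 / real 32 \<le> share c {c, a, b}" using k by (intro share_big_ge[OF tc]) simp_all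
      moreover have "- (6 / k) \<le> share a {a, b, c}" "- (6 / k) \<le> share b {b, c, a}"
        using A B six_div_k(1) by argo+
      ultimately show ?thesis using six_div_k(2) by linarith
    next
      case False
      then show ?thesis using A B C by simp
    qed
  qed
qed

text \<open>The delicate case is a share of -1 at \<open>a\<close>, caused by a neighbour
  \<open>u\<close> in \<open>S\<close>. Then \<open>c\<close> has degree \<open>k\<close> and keeps
  almost 4, and \<open>b\<close>, at distance two from \<open>u\<close>, still contributes
  1/2.\<close>

lemma share_sum_34:
  assumes ta: "is_triangle a b c" and tb: "is_triangle b c a" and tc: "is_triangle c a b"
    and a: "deg E a = 3" and b: "deg E b = 4" and c: "4 \<le> deg E c"
  shows "3 \<le> share a {a, b, c} + share b {b, c, a} + share c {c, a, b}"
proof -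
  note nS = triangle_not_both_S[OF ta] triangle_not_both_S[OF tb] triangle_not_both_S[OF tc]
  have ha: "2 - 6 / real n \<le> share a {a, b, c}"
    if "a \<notin> S" "6 \<le> n" "4 + deg E c + n \<le> k + 5" for n
    by (rule share_3_high[OF ta a that(1,2)]) (use that(3) b in simp)
  have Sa: "a \<in> S \<Longrightarrow> 0 \<le> share a {a, b, c}" by (rule share_3_S[OF ta a])
  have ck: "deg E c \<le> k" by (rule deg_le)
  have B0: "0 \<le> share b {b, c, a}" by (rule share_4_nonneg[OF tb b])
  note B1 = share_4_cases[OF tb b, unfolded a]
  have B2: "b \<notin> S \<Longrightarrow> deg E c \<le> 6 \<Longrightarrow> 3 / 2 \<le> share b {b, c, a}"
    by (rule share_4_poor[OF tb b]) (use a in simp_all)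
  consider "deg E c = 4" | "deg E c = 5" | "6 \<le> deg E c" using c by linarith
  then show ?thesis
  proof cases
    case 1
    have C1: "1 \<le> share c {c, a, b}" using share_4_cases[OF tc 1] a b k by simp
    have C2: "c \<notin> S \<Longrightarrow> 3 / 2 \<le> share c {c, a, b}"
      by (rule share_4_poor[OF tc 1]) (use a b in simp_all)
    have B: "1 \<le> share b {b, c, a}" using B1 1 k by simp
    show ?thesis
    proof (cases "a \<in> S")
      case True
      then show ?thesis using nS Sa B2 C2 1 by simp
    next
      case False
      then show ?thesis using ha[of 29] B C1 k 1 by simp
    qed
  next
    case 2
    have B: "1 \<le> share b {b, c, a}" using B1 2 k by simp
    have C: "3 / 2 \<le> share c {c, a, b}" using share_5_cases[OF tc 2] a b k by simp
    show ?thesis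
    proof (cases "a \<in> S")
      case True
      then show ?thesis using nS Sa B2 C 2 by simp
    next
      case False
      then show ?thesis using ha[of 28] B C k 2 by simp
    qed
  next
    case 3
    have C: "4 - 12 / real n \<le> share c {c, a, b}" if "6 \<le> n" "n \<le> deg E c" for n
      using that by (rule share_big_ge[OF tc])
    note C6 = C[OF order_refl 3]
    from share_3_cases[OF ta a] consider "0 \<le> share a {a, b, c}"
      | "k + 3 \<le> 4 + deg E c" "- (6 / k) \<le> share a {a, b, c}"
      | u where "k + 4 \<le> 4 + deg E c" "-1 \<le> share a {a, b, c}" "u \<in> S" "u \<in> nbs E a" "u \<noteq> b" "u \<noteq> c"
      unfolding b by blast
    then show ?thesis
    proof cases
      case 1
      show ?thesis
      proof (cases "1 \<le> share b {b, c, a}")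
        case True
        then show ?thesis using 1 C6 by simp
      next
        case False
        then have "27 \<le> deg E c" using B1 k by linarith
        then show ?thesis using 1 C[of 27] B0 by simp
      qed
    next
      case 2
      then have "31 \<le> deg E c" using k by linarith
      then have "4 - 12 / real 31 \<le> share c {c, a, b}" by (intro C) simp_all
      then show ?thesis using 2(2) B0 six_div_k(2) by linarith
    next
      case (3 u)
      \<comment> \<open>Otherwise \<open>{a, b, u}\<close> would be a second triangle on the edge
        between \<open>a\<close> and \<open>b\<close>.\<close>
      have "u \<notin> nbs E b"
      proof
        assume "u \<in> nbs E b"
        have "b \<in> nbs E a" "a \<noteq> b" by (rule is_triangleD(3)[OF ta]) (use ta in \<open>simp add: is_triangle_def\<close>)
        moreover have "u \<noteq> a" using 3(4) by (rule nbs_ne)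
        ultimately have "{a, b, u} \<in> triangles E"
          using 3 \<open>u \<in> nbs E b\<close> by (intro trianglesI) (auto simp: nbs_def)
        then have "{a, b, u} = {a, b, c}"
          using triangles_share_edge[OF no4, of "{a, b, u}" "{a, b, c}" a b] ta \<open>a \<noteq> b\<close>
          by (simp add: is_triangle_def)
        then show False using 3 \<open>u \<noteq> a\<close> by auto
      qed
      moreover have "u \<in> nbs2 E b" by (rule nbs2_step[OF is_triangleD(4)[OF tb] 3(4,5)])
      ultimately have "1 / 2 \<le> share b {b, c, a}"
        using a ck 3(3) by (intro share_4_far[OF tb b, of u]) simp_all
      moreover have "32 \<le> deg E c" using 3(1) k by linarith
      ultimately show ?thesis using 3(2) C[of 32] by simp
    qed
  qed
qed

text \<open>Beyond degree 4 of \<open>b\<close>, even -1 at \<open>a\<close> is covered: two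
  vertices of degree at least 6 keep 2 each, and next to a \<open>b\<close> of degree 5 a negative
  share of \<open>a\<close> forces \<open>deg E c\<close> to at least \<open>k - 2\<close>.\<close>

lemma share_sum_3:
  assumes ta: "is_triangle a b c" and tb: "is_triangle b c a" and tc: "is_triangle c a b"
    and a: "deg E a = 3" and b: "3 \<le> deg E b" and c: "deg E b \<le> deg E c"
  shows "3 \<le> share a {a, b, c} + share b {b, c, a} + share c {c, a, b}"
proof -
  have A: "-1 \<le> share a {a, b, c}" by (rule share_3_ge[OF ta a])
  consider "deg E b = 3" | "deg E b = 4" | "deg E b = 5" "deg E c = 5" | "deg E b = 5" "6 \<le> deg E c"
    | "6 \<le> deg E b" using b c by linarith
  then show ?thesis
  proof cases
    case 1
    then show ?thesis using share_sum_33[OF ta tb tc a] b c by simp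
  next
    case 2
    then show ?thesis using share_sum_34[OF ta tb tc a] c by simp
  next
    case 3
    have "0 \<le> share a {a, b, c}" using share_3_cases[OF ta a] 3 k by simp
    moreover have "3 / 2 \<le> share b {b, c, a}" using share_5_cases[OF tb 3(1)] 3 a k by simp
    moreover have "3 / 2 \<le> share c {c, a, b}" using share_5_cases[OF tc 3(2)] 3 a k by simp
    ultimately show ?thesis by simp
  next
    case 4
    have B: "1 \<le> share b {b, c, a}" by (rule share_ge_1[OF tb]) (use 4 in simp)
    show ?thesis
    proof (cases "0 \<le> share a {a, b, c}")
      case True
      then show ?thesis using B share_big_ge[OF tc, of 6] 4 by simp
    next
      case False
      then have "30 \<le> deg E c" using share_3_cases[OF ta a] 4 k by auto
      then show ?thesis using A B share_big_ge[OF tc, of 30] by simp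
    qed
  next
    case 5
    then show ?thesis using A share_big_ge[OF tb, of 6] share_big_ge[OF tc, of 6] c by simp
  qed
qed

lemma share_sum_4:
  assumes ta: "is_triangle a b c" and tb: "is_triangle b c a" and tc: "is_triangle c a b"
    and a: "deg E a = 4" and b: "4 \<le> deg E b" and c: "deg E b \<le> deg E c"
  shows "3 \<le> share a {a, b, c} + share b {b, c, a} + share c {c, a, b}"
proof -
  have A0: "0 \<le> share a {a, b, c}" by (rule share_4_nonneg[OF ta a])
  note A1 = share_4_cases[OF ta a]
  consider "deg E b = 4" "deg E c = 4" | "deg E b = 4" "deg E c = 5" | "deg E b = 4" "6 \<le> deg E c"
    | "deg E b = 5" "deg E c = 5" | "deg E b = 5" "6 \<le> deg E c" | "6 \<le> deg E b" "6 \<le> deg E c"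
    using b c by linarith
  then show ?thesis
  proof cases
    case 1
    then show ?thesis using A1 share_4_cases[OF tb 1(1)] share_4_cases[OF tc 1(2)] a k by simp
  next
    case 2
    then show ?thesis using A1 share_4_cases[OF tb 2(1)] share_ge_1[OF tc] a k by simp
  next
    case 3
    have B0: "0 \<le> share b {b, c, a}" by (rule share_4_nonneg[OF tb 3(1)])
    \<comment> \<open>A share below 1 at \<open>a\<close> or \<open>b\<close> requires
      \<open>k \<le> 2 + 4 + deg E c\<close>, which is why the line is drawn at
      \<open>32 - 6\<close>.\<close>
    show ?thesis
    proof (cases "26 \<le> deg E c")
      case True
      then show ?thesis using A0 B0 share_big_ge[OF tc, of 26] by simp
    next
      case False
      then show ?thesis using A1 share_4_cases[OF tb 3(1)] share_big_ge[OF tc, of 6] 3 a k by simp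
    qed
  next
    case 4
    then show ?thesis using A1 share_ge_1[OF tb] share_ge_1[OF tc] k by simp
  next
    case 5
    then show ?thesis using A0 share_ge_1[OF tb] share_big_ge[OF tc, of 6] by simp
  next
    case 6
    then show ?thesis using A0 share_big_ge[OF tb, of 6] share_big_ge[OF tc, of 6] by simp
  qed
qed

lemma share_sum:
  assumes t: "is_triangle a b c"
  shows "3 \<le> share a {a, b, c} + share b {b, c, a} + share c {c, a, b}"
proof -
  have main: "3 \<le> share a {a, b, c} + share b {b, c, a} + share c {c, a, b}"
    if ta: "is_triangle a b c" and o: "deg E a \<le> deg E b" "deg E b \<le> deg E c" for a b c
  proof -
    note tb = is_triangle_rotate[OF ta]
    note tc = is_triangle_rotate[OF tb]
    have "2 \<le> deg E a" using deg_ge is_triangleD(5)[OF ta] by blast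
    then consider "deg E a = 2" | "deg E a = 3" | "deg E a = 4" | "5 \<le> deg E a" by linarith
    then show ?thesis
    proof cases
      case 4
      then show ?thesis using share_ge_1[OF ta] share_ge_1[OF tb] share_ge_1[OF tc] o by simp
    qed (use share_sum_2 share_sum_3 share_sum_4 ta tb tc o in simp_all)
  qed
  have p: "{b, a, c} = {a, b, c}" "{a, c, b} = {a, b, c}" "{c, b, a} = {a, b, c}" "{b, c, a} = {a, b, c}"
    "{c, a, b} = {a, b, c}" by auto
  note t' = is_triangle_rotate[OF t] is_triangle_rotate[OF is_triangle_rotate[OF t]]
  consider "deg E a \<le> deg E b" "deg E b \<le> deg E c" | "deg E a \<le> deg E c" "deg E c \<le> deg E b"
    | "deg E b \<le> deg E a" "deg E a \<le> deg E c" | "deg E b \<le> deg E c" "deg E c \<le> deg E a"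
    | "deg E c \<le> deg E a" "deg E a \<le> deg E b" | "deg E c \<le> deg E b" "deg E b \<le> deg E a"
    by linarith
  then show ?thesis
    using main[of a b c] main[of a c b] main[of b a c] main[of b c a] main[of c a b] main[of c b a]
      t t' is_triangle_swap[OF t] is_triangle_swap[OF t'(1)] is_triangle_swap[OF t'(2)]
    unfolding p by cases simp_all
qed

text \<open>What one end of an edge gains, the other loses, and \<open>link\<close> is
  symmetric.\<close>

lemma sum_net: "(\<Sum>v \<in> \<Union>E. \<Sum>w \<in> link v. net v w) = 0"
proof -
  have sub: "link v \<subseteq> \<Union>E" for v using nbs_subset[of v] by (auto simp: link_def)
  have *: "(\<Sum>v \<in> \<Union>E. \<Sum>w \<in> link v. f v w) = (\<Sum>v \<in> \<Union>E. \<Sum>w \<in> \<Union>E. if w \<in> link v then f v w else 0)"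
    for f :: "'a \<Rightarrow> 'a \<Rightarrow> real"
  proof (rule sum.cong[OF refl])
    fix v
    have "\<Union>E \<inter> {w. w \<in> link v} = link v" using sub by blast
    then show "(\<Sum>w \<in> link v. f v w) = (\<Sum>w \<in> \<Union>E. if w \<in> link v then f v w else 0)"
      using finite_vertices by (simp add: sum.If_cases)
  qed
  have "(\<Sum>v \<in> \<Union>E. \<Sum>w \<in> link v. give w v) = (\<Sum>v \<in> \<Union>E. \<Sum>w \<in> link v. give v w)"
    unfolding * by (subst sum.swap) (simp add: link_sym[of _ _])
  then show ?thesis by (simp add: net_def sum_subtractf)
qed

theorem discharge: "6 * card (\<Union>E) + 3 * card (triangles E) \<le> 4 * card E"
proof -
  let ?V = "\<Union>E"
  have fin: "finite ?V" "finite (triangles E)"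
    using finite_vertices finite_triangles[OF finite_edges card_edge] by auto
  have "(\<Sum>v \<in> ?V. rest v) = (\<Sum>v \<in> ?V. 2 * real (deg E v) - 6) + (\<Sum>v \<in> ?V. \<Sum>w \<in> link v. net v w)"
    unfolding rest_def by (rule sum.distrib)
  also have "\<dots> = 2 * real (\<Sum>v \<in> ?V. deg E v) - 6 * card ?V"
    unfolding sum_net by (simp add: sum_subtractf flip: sum_distrib_left)
  finally have total: "(\<Sum>v \<in> ?V. rest v) = 4 * real (card E) - 6 * card ?V"
    unfolding handshake by simp
  have "3 * real (card (triangles E)) = (\<Sum>T \<in> triangles E. 3)" by simp
  also have "\<dots> \<le> (\<Sum>T \<in> triangles E. \<Sum>v \<in> T. share v T)"
  proof (rule sum_mono)
    fix T assume T: "T \<in> triangles E"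
    then obtain a b c where abc: "T = {a, b, c}" "a \<noteq> b" "b \<noteq> c" "a \<noteq> c" by (rule trianglesE)
    then have "is_triangle a b c" using T by (simp add: is_triangle_def)
    moreover have "{b, c, a} = {a, b, c}" "{c, a, b} = {a, b, c}" by auto
    ultimately show "3 \<le> (\<Sum>v \<in> T. share v T)" using share_sum[of a b c] abc by simp
  qed
  also have "\<dots> = (\<Sum>T \<in> triangles E. \<Sum>v \<in> {v \<in> ?V. v \<in> T}. share v T)"
  proof (intro sum.cong refl)
    fix T assume "T \<in> triangles E"
    then show "T = {v \<in> ?V. v \<in> T}" using triangles_subset[of T E] by blast
  qed
  also have "\<dots> = (\<Sum>v \<in> ?V. \<Sum>T \<in> triangles_at v. share v T)"
    unfolding triangles_at_def by (rule sum.swap_restrict[OF fin(2,1)])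
  also have "\<dots> \<le> (\<Sum>v \<in> ?V. rest v)"
  proof (rule sum_mono)
    fix v assume v: "v \<in> ?V"
    show "(\<Sum>T \<in> triangles_at v. share v T) \<le> rest v"
      using rest_nonneg[OF v] sum_share[of v] by (cases "triangles_at v = {}") simp_all
  qed
  finally have "3 * real (card (triangles E)) + 6 * real (card ?V) \<le> 4 * real (card E)" using total by simp
  then have "real (6 * card ?V + 3 * card (triangles E)) \<le> real (4 * card E)" by simp
  then show ?thesis by (simp only: of_nat_le_iff)
qed

end

section \<open>Degeneracy of the square\<close>

text \<open>The vertex that enters a peeled set last is the one coloured first.\<close>

inductive peel :: "'a set set \<Rightarrow> nat \<Rightarrow> 'a set \<Rightarrow> bool" for E m where
  peel_empty: "peel E m {}"
| peel_insert: "peel E m A \<Longrightarrow> v \<notin> A \<Longrightarrow> card (nbs2 E v - A) \<le> m \<Longrightarrow> peel E m (insert v A)"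

lemma finite_peel: "peel E m A \<Longrightarrow> finite A"
  by (induction rule: peel.induct) auto

context simple_edges
begin

text \<open>First \<open>S\<close> is peeled, then the rest of \<open>A\<close> in its order for
  \<open>E'\<close>. By then a vertex outside \<open>S\<close> has no more unpeeled neighbours in
  the square of \<open>E\<close> than it had for \<open>E'\<close>.\<close>

lemma peel_transfer:
  assumes "peel E' m A" "peel E m S" "simple_edges E'" "\<And>v. v \<notin> S \<Longrightarrow> nbs2 E v - S \<subseteq> nbs2 E' v"
  shows "peel E m (S \<union> A)"
  using assms(1)
proof (induction rule: peel.induct)
  case peel_empty
  then show ?case using assms(2) by simp
next
  case (peel_insert A v)
  show ?case
  proof (cases "v \<in> S")
    case True
    then show ?thesis using peel_insert.IH by (simp add: insert_absorb)
  next
    case False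
    have "nbs2 E v - (S \<union> A) \<subseteq> nbs2 E' v - A" using assms(4)[OF False] by blast
    then have "card (nbs2 E v - (S \<union> A)) \<le> m"
      using peel_insert.hyps(3) card_mono[of "nbs2 E' v - A"] simple_edges.finite_nbs2[OF assms(3)]
      by (meson finite_Diff order_trans)
    then have "peel E m (insert v (S \<union> A))"
      using peel_insert.IH peel_insert.hyps(2) False by (intro peel.peel_insert) auto
    then show ?thesis by simp
  qed
qed

text \<open>\<open>f\<close> is an arbitrary colouring outside \<open>A\<close> that has to be
  respected. The vertex peeled last is coloured first, by updating \<open>f\<close>, before the
  induction hypothesis extends it to the vertices peeled earlier.\<close>

lemma peel_coloring:
  assumes "peel E m A" "\<And>v. v \<in> A \<Longrightarrow> finite (L v) \<and> m < card (L v)"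
  shows "\<exists>g. (\<forall>v. v \<notin> A \<longrightarrow> g v = f v) \<and> (\<forall>v \<in> A. g v \<in> L v \<and> (\<forall>w \<in> nbs2 E v. g w \<noteq> g v))"
  using assms
proof (induction arbitrary: f rule: peel.induct)
  case (peel_insert A v)
  have "card (f ` (nbs2 E v - A)) \<le> m"
    using card_image_le[of "nbs2 E v - A" f] finite_nbs2 peel_insert.hyps(3) by (meson finite_Diff order_trans)
  then have "card (f ` (nbs2 E v - A)) < card (L v)" using peel_insert.prems[of v] by simp
  then have "\<not> L v \<subseteq> f ` (nbs2 E v - A)"
    using card_mono[of "f ` (nbs2 E v - A)" "L v"] finite_nbs2 by (meson finite_Diff finite_imageI not_le)
  then obtain c where c: "c \<in> L v" "c \<notin> f ` (nbs2 E v - A)" by blast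
  obtain g where g: "\<And>x. x \<notin> A \<Longrightarrow> g x = (f(v := c)) x"
    "\<And>x. x \<in> A \<Longrightarrow> g x \<in> L x" "\<And>x w. x \<in> A \<Longrightarrow> w \<in> nbs2 E x \<Longrightarrow> g w \<noteq> g x"
    using peel_insert.IH[of "f(v := c)"] peel_insert.prems by blast
  have gv: "g v = c" using g(1)[OF peel_insert.hyps(2)] by simp
  have "g w \<noteq> g v" if w: "w \<in> nbs2 E v" for w
  proof (cases "w \<in> A")
    case True
    have "v \<in> nbs2 E w" using w nbs2_sym[of w v] by blast
    then show ?thesis using g(3)[OF True] by metis
  next
    case False
    have "w \<noteq> v" using w by (simp add: nbs2_def)
    then have "g w = f w" using g(1)[OF False] by simp
    moreover have "f w \<in> f ` (nbs2 E v - A)" using w False by blast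
    ultimately show ?thesis using c(2) gv by metis
  qed
  then show ?case using g gv c(1) by (intro exI[of _ g]) auto
qed auto

text \<open>The rank increases with the time of peeling. Neighbours outside \<open>A\<close>, which
  are never peeled, count as later.\<close>

lemma peel_rank:
  assumes "peel E m A"
  shows "\<exists>\<rho> :: 'a \<Rightarrow> nat. inj_on \<rho> A \<and> (\<forall>v \<in> A. card {w \<in> nbs2 E v. w \<in> A \<longrightarrow> \<rho> v < \<rho> w} \<le> m)"
  using assms
proof (induction rule: peel.induct)
  case (peel_insert A v)
  then obtain \<rho> :: "'a \<Rightarrow> nat" where r: "inj_on \<rho> A"
    "\<forall>v \<in> A. card {w \<in> nbs2 E v. w \<in> A \<longrightarrow> \<rho> v < \<rho> w} \<le> m" by blast
  have finA: "finite A" using peel_insert.hyps(1) by (rule finite_peel)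
  define n where "n = Suc (sum \<rho> A)"
  have n: "\<rho> w < n" if "w \<in> A" for w
    unfolding n_def using member_le_sum[of w A \<rho>] that finA by simp
  define \<rho>' where "\<rho>' = \<rho>(v := n)"
  have "inj_on \<rho>' (insert v A)"
    unfolding \<rho>'_def using r(1) n peel_insert.hyps(2) by (auto simp: inj_on_def)
  moreover have "card {w \<in> nbs2 E u. w \<in> insert v A \<longrightarrow> \<rho>' u < \<rho>' w} \<le> m" if u: "u \<in> insert v A" for u
  proof (cases "u = v")
    case True
    have "w \<notin> A" if "w \<in> insert v A \<longrightarrow> \<rho>' v < \<rho>' w" "w \<noteq> v" for w
      using that n[of w] unfolding \<rho>'_def by auto
    then have "{w \<in> nbs2 E v. w \<in> insert v A \<longrightarrow> \<rho>' v < \<rho>' w} \<subseteq> nbs2 E v - A"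
      by (auto simp: nbs2_def)
    then show ?thesis using True peel_insert.hyps(3) card_mono[of "nbs2 E v - A"] finite_nbs2
      by (meson finite_Diff order_trans)
  next
    case False
    then have uA: "u \<in> A" using u by blast
    have "{w \<in> nbs2 E u. w \<in> insert v A \<longrightarrow> \<rho>' u < \<rho>' w} \<subseteq> {w \<in> nbs2 E u. w \<in> A \<longrightarrow> \<rho> u < \<rho> w}"
      using False peel_insert.hyps(2) by (auto simp: \<rho>'_def)
    moreover have "finite {w \<in> nbs2 E u. w \<in> A \<longrightarrow> \<rho> u < \<rho> w}" using finite_nbs2 by simp
    ultimately show ?thesis using r(2) uA by (meson card_mono order_trans)
  qed
  ultimately show ?case by blast
qed auto

text \<open>\<open>I\<close> is a kernel of the square on \<open>M\<close> with edges directed to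
  the higher rank. It is built from the top: the vertex of lowest rank is decided last and rejected
  only if it has a neighbour in \<open>I\<close>.\<close>

lemma greedy_independent:
  fixes \<rho> :: "'a \<Rightarrow> nat"
  assumes "finite M" "inj_on \<rho> M"
  shows "\<exists>I \<subseteq> M. (\<forall>x \<in> I. \<forall>y \<in> I. y \<notin> nbs2 E x) \<and>
    (\<forall>v \<in> M - I. \<exists>w \<in> I. w \<in> nbs2 E v \<and> \<rho> v < \<rho> w)"
  using assms
proof (induction "card M" arbitrary: M)
  case (Suc n)
  then have "M \<noteq> {}" by auto
  then obtain v where v: "v \<in> M" "\<And>w. w \<in> M \<Longrightarrow> \<rho> v \<le> \<rho> w"
    using ex_is_arg_min_if_finite[of M \<rho>] Suc.prems(1) by (auto simp: is_arg_min_linorder)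
  have "n = card (M - {v})" using Suc.hyps(2) v(1) by simp
  moreover have "inj_on \<rho> (M - {v})" using Suc.prems(2) by (rule inj_on_subset) blast
  ultimately obtain I where I: "I \<subseteq> M - {v}" "\<And>x y. x \<in> I \<Longrightarrow> y \<in> I \<Longrightarrow> y \<notin> nbs2 E x"
    "\<And>u. u \<in> M - {v} - I \<Longrightarrow> \<exists>w \<in> I. w \<in> nbs2 E u \<and> \<rho> u < \<rho> w"
    using Suc.hyps(1)[of "M - {v}"] Suc.prems(1) by (metis finite_Diff)
  show ?case
  proof (cases "I \<inter> nbs2 E v = {}")
    case True
    have "\<And>x. x \<in> I \<Longrightarrow> v \<notin> nbs2 E x" using True nbs2_sym by (metis disjoint_iff)
    moreover have "v \<notin> nbs2 E v" by (simp add: nbs2_def)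
    ultimately show ?thesis
      using I v(1) True by (intro exI[of _ "insert v I"]) auto
  next
    case False
    then obtain w where w: "w \<in> I" "w \<in> nbs2 E v" by blast
    have "\<rho> v \<noteq> \<rho> w" using inj_onD[OF Suc.prems(2), of v w] w I(1) v(1) by blast
    then have "\<rho> v < \<rho> w" using v(2)[of w] w I(1) by fastforce
    then have ex: "\<exists>w \<in> I. w \<in> nbs2 E u \<and> \<rho> u < \<rho> w" if "u \<in> M - I" for u
      using I(3)[of u] that w by (cases "u = v") auto
    show ?thesis
    proof (intro exI[of _ I] conjI ballI)
      show "I \<subseteq> M" using I(1) by blast
      show "y \<notin> nbs2 E x" if "x \<in> I" "y \<in> I" for x y using I(2) that .
      show "\<exists>w \<in> I. w \<in> nbs2 E u \<and> \<rho> u < \<rho> w" if "u \<in> M - I" for u using that by (rule ex)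
    qed
  qed
qed auto

end

text \<open>The edge bound for all sets of edges stands in for planarity and the absence of
  5-cycles. It passes to subsets, as the induction requires.\<close>

locale sparse_edges = simple_edges +
  fixes k :: nat
  assumes no4: "\<not> has_cycle E 4"
    and k: "32 \<le> k"
    and deg_le: "deg E v \<le> k"
    and sparse: "H \<subseteq> E \<Longrightarrow> H \<noteq> {} \<Longrightarrow> 4 * card H < 6 * card (\<Union>H) + 3 * card (triangles H)"

lemma (in simple_edges) deg_mono: "H \<subseteq> E \<Longrightarrow> deg H v \<le> deg E v"
  unfolding deg_def by (intro card_mono finite_nbs) (auto simp: nbs_def)

lemma (in sparse_edges) sparse_subset: "H \<subseteq> E \<Longrightarrow> sparse_edges H k"
proof
  assume H: "H \<subseteq> E"
  show "finite H" using H finite_edges by (rule finite_subset)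
  show "card e = 2" if "e \<in> H" for e using that H card_edge by blast
  show "\<not> has_cycle H 4" using no4 has_cycle_mono[OF _ H] by blast
  show "32 \<le> k" by (rule k)
  show "deg H v \<le> k" for v using deg_mono[OF H] deg_le by (rule order_trans)
  show "4 * card F < 6 * card (\<Union>F) + 3 * card (triangles F)" if "F \<subseteq> H" "F \<noteq> {}" for F
    using sparse[of F] that H by blast
qed

text \<open>On a path of length at most two between vertices outside \<open>S\<close>, each edge has
  an end outside \<open>S\<close>, so it is not \<open>{u, w}\<close>.\<close>

lemma (in simple_edges) nbs2_delete_edge:
  assumes "u \<in> S" "w \<in> S" "v \<notin> S"
  shows "nbs2 E v - S \<subseteq> nbs2 (E - {{u, w}}) v"
  using assms unfolding nbs2_def nbs_def by (auto simp: doubleton_eq_iff)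

text \<open>A path of length two through \<open>u\<close> joins two neighbours of \<open>u\<close>,
  and these are adjacent.\<close>

lemma (in simple_edges) nbs2_delete_vertex:
  assumes "u \<in> S" "v \<notin> S" and clique: "\<And>x y. x \<in> nbs E u \<Longrightarrow> y \<in> nbs E u \<Longrightarrow> x \<noteq> y \<Longrightarrow> {x, y} \<in> E"
  shows "nbs2 E v - S \<subseteq> nbs2 {e \<in> E. u \<notin> e} v"
proof
  fix x assume x: "x \<in> nbs2 E v - S"
  have ne: "x \<noteq> v" "x \<noteq> u" "v \<noteq> u" using x assms(1,2) by (auto simp: nbs2_def)
  have direct: "x \<in> nbs2 {e \<in> E. u \<notin> e} v" if "{v, x} \<in> E"
    using that ne by (auto simp: nbs2_def nbs_def)
  show "x \<in> nbs2 {e \<in> E. u \<notin> e} v"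
  proof (cases "{v, x} \<in> E")
    case False
    then obtain y where y: "{v, y} \<in> E" "{y, x} \<in> E" using x by (auto simp: nbs2_def nbs_def)
    show ?thesis
    proof (cases "y = u")
      case True
      then have "v \<in> nbs E u" "x \<in> nbs E u" using y by (auto simp: nbs_def insert_commute)
      then show ?thesis using clique[of v x] ne direct by blast
    next
      case False
      then show ?thesis using y ne by (auto simp: nbs2_def nbs_def)
    qed
  qed (rule direct)
qed

text \<open>\<open>V\<close> stays the same when edges are deleted, so vertices that become isolated
  are still peeled.\<close>

theorem peel_sparse:
  assumes "sparse_edges E k" "finite V" "\<Union>E \<subseteq> V"
  shows "peel E (k + 2) V"
  using assms
proof (induction "card E" arbitrary: E rule: less_induct)
  case less
  interpret sparse_edges E k by (rule less.prems(1))
  let ?C = "{S. S \<subseteq> V \<and> peel E (k + 2) S}"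
  have "{} \<in> ?C" by (simp add: peel_empty)
  then have ne: "?C \<noteq> {}" by (rule ex_in_conv[THEN iffD1, OF exI])
  have "finite ?C" using assms(2) by simp
  then have "\<exists>S \<in> ?C. \<forall>S' \<in> ?C. S \<subseteq> S' \<longrightarrow> S = S'" using ne by (rule finite_has_maximal)
  then obtain S where mem: "S \<in> ?C" and max: "\<forall>S' \<in> ?C. S \<subseteq> S' \<longrightarrow> S = S'" by (rule bexE)
  have S: "S \<subseteq> V" "peel E (k + 2) S" using mem by simp_all
  have S_max: "S = S'" if "S' \<subseteq> V" "peel E (k + 2) S'" "S \<subseteq> S'" for S'
    using max that by simp
  have heavy: "k + 3 + card (S \<inter> nbs2 E v) \<le> card (nbs2 E v)" if v: "v \<in> V" "v \<notin> S" for v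
  proof (rule ccontr)
    assume "\<not> ?thesis"
    then have "card (nbs2 E v - S) \<le> k + 2"
      using card_Diff_subset_Int[of "nbs2 E v" S] finite_nbs2[of v] by (simp add: Int_commute)
    then have "peel E (k + 2) (insert v S)" using S(2) v(2) by (intro peel_insert)
    then show False using S_max[of "insert v S"] S(1) v by blast
  qed
  have reduce: ?case if H: "H \<subseteq> E" "H \<noteq> E" "\<And>v. v \<notin> S \<Longrightarrow> nbs2 E v - S \<subseteq> nbs2 H v" for H
  proof -
    interpret H: sparse_edges H k using H(1) by (rule sparse_subset)
    have "card H < card E" using H finite_edges by (intro psubset_card_mono) auto
    moreover have "\<Union>H \<subseteq> V" using H(1) less.prems(3) by blast
    ultimately have "peel H (k + 2) V" by (rule less.hyps[OF _ H.sparse_edges_axioms assms(2)])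
    then have "peel E (k + 2) (S \<union> V)"
      using S(2) H.simple_edges_axioms H(3) by (rule peel_transfer)
    then show ?thesis using S(1) by (simp add: Un_absorb1)
  qed
  show ?case
  proof (cases "S = V")
    case False
    then obtain v0 where "v0 \<in> V" "v0 \<notin> S" using S(1) by blast
    then have "nbs2 E v0 \<noteq> {}" using heavy[of v0] by auto
    then have E_ne: "E \<noteq> {}" by (auto simp: nbs2_def nbs_def)
    \<comment> \<open>\<open>clique\<close> covers leaves and ears in \<open>S\<close> alike. A leaf
      outside \<open>S\<close> contradicts \<open>heavy\<close>, as it has at most \<open>k\<close>
      neighbours in the square.\<close>
    consider (edge) u w where "{u, w} \<in> E" "u \<in> S" "w \<in> S"
      | (clique) u where "u \<in> S" "u \<in> \<Union>E" "\<And>x y. x \<in> nbs E u \<Longrightarrow> y \<in> nbs E u \<Longrightarrow> x \<noteq> y \<Longrightarrow> {x, y} \<in> E"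
      | (leaf) u where "u \<notin> S" "u \<in> \<Union>E" "deg E u = 1"
      | (none) "\<And>u w. u \<in> S \<Longrightarrow> w \<in> S \<Longrightarrow> {u, w} \<notin> E"
        "\<And>u. u \<in> S \<Longrightarrow> u \<in> \<Union>E \<Longrightarrow> \<exists>x \<in> nbs E u. \<exists>y \<in> nbs E u. x \<noteq> y \<and> {x, y} \<notin> E"
        "\<And>u. u \<notin> S \<Longrightarrow> u \<in> \<Union>E \<Longrightarrow> deg E u \<noteq> 1"
      by metis
    then show ?thesis
    proof cases
      case edge
      show ?thesis
      proof (rule reduce)
        show "E - {{u, w}} \<subseteq> E" "E - {{u, w}} \<noteq> E" using edge(1) by blast+
        show "nbs2 E v - S \<subseteq> nbs2 (E - {{u, w}}) v" if "v \<notin> S" for v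
          by (rule nbs2_delete_edge[OF edge(2,3) that])
      qed
    next
      case clique
      show ?thesis
      proof (rule reduce)
        show "{e \<in> E. u \<notin> e} \<subseteq> E" "{e \<in> E. u \<notin> e} \<noteq> E" using clique(2) by blast+
        show "nbs2 E v - S \<subseteq> nbs2 {e \<in> E. u \<notin> e} v" if "v \<notin> S" for v
          by (rule nbs2_delete_vertex[OF clique(1) that clique(3)])
      qed
    next
      case leaf
      have "k + 3 \<le> card (nbs2 E u)" using heavy[of u] leaf less.prems(3) by fastforce
      also have "\<dots> \<le> (\<Sum>w \<in> nbs E u. deg E w - card (nbs E w \<inter> nbs E u))" by (rule card_nbs2_le)
      also have "\<dots> \<le> (\<Sum>w \<in> nbs E u. k)" using deg_le by (intro sum_mono) (meson diff_le_self order_trans)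
      also have "\<dots> = k" using leaf(3) by (simp add: deg_def)
      finally show ?thesis by simp
    next
      case none
      have "discharging E k S"
      proof
        show "2 \<le> deg E v" if v: "v \<in> \<Union>E" for v
        proof (cases "v \<in> S")
          case True
          obtain x y where xy: "x \<in> nbs E v" "y \<in> nbs E v" "x \<noteq> y" using none(2)[OF True v] by blast
          then have "card {x, y} \<le> deg E v" unfolding deg_def by (intro card_mono finite_nbs) auto
          then show ?thesis using xy(3) by simp
        next
          case False
          then show ?thesis using none(3)[OF False v] deg_pos[OF v] by linarith
        qed
        show "w \<notin> nbs E u" if "u \<in> S" "w \<in> S" for u w
          using none(1)[OF that] by (simp add: nbs_def)
        show "k + 3 + card (S \<inter> nbs2 E v) \<le> card (nbs2 E v)" if "v \<in> \<Union>E" "v \<notin> S" for v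
          using heavy that less.prems(3) by blast
        show "triangles_at u = {}" if u: "u \<in> S" "deg E u = 2" for u
        proof (rule ccontr)
          assume "triangles_at u \<noteq> {}"
          then obtain T where T: "T \<in> triangles E" "u \<in> T" by (auto simp: triangles_at_def)
          have "T - {u} \<subseteq> nbs E u" using triangle_nbs[OF T] by blast
          moreover have "card (T - {u}) = 2" using T card_triangle finite_triangle by simp
          ultimately have nb: "T - {u} = nbs E u"
            using u(2) finite_nbs unfolding deg_def by (intro card_subset_eq) auto
          have "u \<in> \<Union>E" using T triangles_subset by blast
          then obtain x y where "x \<in> nbs E u" "y \<in> nbs E u" "x \<noteq> y" "{x, y} \<notin> E" using none(2)[OF u(1)] by blast
          then show False using T(1) unfolding nb[symmetric] triangles_def by blast
        qed
      qed (use k no4 deg_le in auto)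
      then have "6 * card (\<Union>E) + 3 * card (triangles E) \<le> 4 * card E" by (rule discharging.discharge)
      then show ?thesis using sparse[OF order_refl E_ne] by simp
    qed
  qed (use S(2) in simp)
qed

section \<open>Colouring and painting the square\<close>

definition edge_set :: "'a pair_pre_digraph \<Rightarrow> 'a set set" where
  "edge_set G = (\<lambda>(u, v). {u, v}) ` parcs G"

lemma (in pair_graph) edge_set_iff: "{u, v} \<in> edge_set G \<longleftrightarrow> (u, v) \<in> parcs G"
proof
  assume "{u, v} \<in> edge_set G"
  then obtain x y where "(x, y) \<in> parcs G" "{u, v} = {x, y}" by (auto simp: edge_set_def)
  then show "(u, v) \<in> parcs G" using arcs_symmetric[of x y] by (auto simp: doubleton_eq_iff)
qed (force simp: edge_set_def)

lemma (in pair_graph) simple_edges_edge_set: "simple_edges (edge_set G)"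
proof
  show "finite (edge_set G)" using pair_finite_arcs by (simp add: edge_set_def)
  show "card e = 2" if "e \<in> edge_set G" for e
    using that pair_no_loops by (force simp: edge_set_def card_2_iff)
qed

lemma (in pair_graph) Union_edge_set: "\<Union>(edge_set G) \<subseteq> pverts G"
  using in_arcsD1 in_arcsD2 by (auto simp: edge_set_def)

lemma (in pair_graph) nbs_edge_set: "nbs (edge_set G) v = {w. (v, w) \<in> parcs G}"
  by (simp add: nbs_def edge_set_iff)

lemma (in pair_graph) deg_edge_set_le: "deg (edge_set G) v \<le> max_degree G"
proof (cases "v \<in> pverts G")
  case True
  have "out_arcs (with_proj G) v = Pair v ` nbs (edge_set G) v"
    by (auto simp: out_arcs_def nbs_edge_set)
  then have "out_degree (with_proj G) v = deg (edge_set G) v"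
    by (simp add: out_degree_def deg_def card_image inj_on_def)
  then show ?thesis unfolding max_degree_def using True pair_finite_verts
    by (metis Max_ge finite_imageI finite_insert image_eqI insert_iff)
next
  case False
  then have "nbs (edge_set G) v = {}" using in_arcsD1 by (auto simp: nbs_edge_set)
  then show ?thesis by (simp add: deg_def)
qed

lemma (in pair_graph) contains_cycleI:
  assumes "has_cycle (edge_set G) n" "n = 4 \<or> n = 5"
  shows "contains_cycle G n"
proof -
  obtain vs where vs: "distinct vs" "length vs = n" "path_edges vs \<subseteq> edge_set G"
    "{last vs, hd vs} \<in> edge_set G" using assms(1) by (auto simp: has_cycle_def)
  show ?thesis
  proof (cases "n = 4")
    case True
    then obtain a b c d where v: "vs = [a, b, c, d]"
      using vs(2) by (auto simp: length_Suc_conv numeral_eq_Suc)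
    then have "(a, b) \<in> parcs G" "(b, c) \<in> parcs G" "(c, d) \<in> parcs G" "(d, a) \<in> parcs G"
      using vs by (auto simp: edge_set_iff)
    then have "cycle [(a, b), (b, c), (c, d), (d, a)]"
      using vs(1) v in_arcsD1[of a b] unfolding cycle_def awalk_def by (intro exI[of _ a]) auto
    then show ?thesis unfolding contains_cycle_def using True by (intro exI[of _ "[(a, b), (b, c), (c, d), (d, a)]"]) simp
  next
    case False
    then have n: "n = 5" using assms(2) by blast
    then obtain a b c d e where v: "vs = [a, b, c, d, e]"
      using vs(2) by (auto simp: length_Suc_conv numeral_eq_Suc)
    then have "(a, b) \<in> parcs G" "(b, c) \<in> parcs G" "(c, d) \<in> parcs G" "(d, e) \<in> parcs G" "(e, a) \<in> parcs G"
      using vs by (auto simp: edge_set_iff)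
    then have "cycle [(a, b), (b, c), (c, d), (d, e), (e, a)]"
      using vs(1) v in_arcsD1[of a b] unfolding cycle_def awalk_def by (intro exI[of _ a]) auto
    then show ?thesis unfolding contains_cycle_def using n
      by (intro exI[of _ "[(a, b), (b, c), (c, d), (d, e), (e, a)]"]) simp
  qed
qed

text \<open>The distance is an infimum of extended reals, so a walk of length 2 has to be extracted:
  some walk costs less than 3, and none less than 2.\<close>

lemma (in pair_graph) mu_2:
  assumes "wf_digraph.\<mu> (with_proj G) (\<lambda>_. 1) u v = 2"
  shows "\<exists>x. (u, x) \<in> parcs G \<and> (x, v) \<in> parcs G"
proof -
  have wf: "wf_digraph (with_proj G)" by unfold_locales
  have cost: "awalk_cost (\<lambda>_. 1) p = real (length p)" for p :: "('a \<times> 'a) list"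
    by (induction p) simp_all
  have "(INF p \<in> {p. awalk u p v}. ereal (length p)) < 3"
    using assms unfolding wf_digraph.\<mu>_def[OF wf] cost by simp
  then obtain p where p: "awalk u p v" "ereal (length p) < 3" by (auto simp: INF_less_iff)
  have "2 \<le> ereal (length p)"
    using wf_digraph.min_cost_le_walk_cost[OF wf p(1), of "\<lambda>_. 1"] assms unfolding cost by simp
  then have "length p = 2" using p(2) by simp
  then obtain e1 e2 where "p = [e1, e2]" by (auto simp: length_Suc_conv numeral_eq_Suc)
  then show ?thesis using p(1) by (cases e1; cases e2) (auto simp: awalk_def)
qed

lemma (in pair_graph) square_arcs: "(u, v) \<in> parcs (square G) \<Longrightarrow> v \<in> nbs2 (edge_set G) u"
proof -
  assume "(u, v) \<in> parcs (square G)"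
  then consider "(u, v) \<in> parcs G" | "wf_digraph.\<mu> (with_proj G) (\<lambda>_. 1) u v = 2" "u \<in> pverts G"
    by (auto simp: square_def)
  then show ?thesis
  proof cases
    case 1
    then show ?thesis using pair_no_loops[of "(u, v)"] by (auto simp: nbs2_def nbs_edge_set)
  next
    case 2
    \<comment> \<open>The empty walk has cost 0.\<close>
    have "u \<noteq> v"
    proof
      assume "u = v"
      have "awalk u [] u" using 2(2) by (simp add: awalk_def)
      moreover have "wf_digraph (with_proj G)" by unfold_locales
      ultimately have "wf_digraph.\<mu> (with_proj G) (\<lambda>_. 1) u u \<le> 0"
        using wf_digraph.min_cost_le_walk_cost[of "with_proj G" u "[]" u "\<lambda>_. 1"]
        by (simp add: zero_ereal_def)
      then show False using 2(1) \<open>u = v\<close> by simp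
    qed
    then show ?thesis using mu_2[OF 2(1)] by (auto simp: nbs2_def nbs_edge_set)
  qed
qed

lemma planar_plane_graph:
  assumes "pair_graph G" "planar G"
  obtains \<phi> \<gamma> where "plane_graph (edge_set G) \<phi> \<gamma>"
proof -
  interpret pair_graph G by fact
  interpret simple_edges "edge_set G" by (rule simple_edges_edge_set)
  obtain \<phi> :: "'a \<Rightarrow> complex" and \<gamma> :: "'a set \<Rightarrow> real \<Rightarrow> complex" where
    inj: "inj_on \<phi> (pverts G)" and
    arcs: "\<And>u v. (u, v) \<in> parcs G \<Longrightarrow> Path_Connected.arc (\<gamma> {u, v}) \<and>
        {pathstart (\<gamma> {u, v}), pathfinish (\<gamma> {u, v})} = {\<phi> u, \<phi> v}" and
    meet: "\<And>u v x y. (u, v) \<in> parcs G \<Longrightarrow> (x, y) \<in> parcs G \<Longrightarrow> {u, v} \<noteq> {x, y} \<Longrightarrow>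
        path_image (\<gamma> {u, v}) \<inter> path_image (\<gamma> {x, y}) = \<phi> ` ({u, v} \<inter> {x, y})"
    using assms(2) unfolding planar_def by fast
  have "plane_graph (edge_set G) \<phi> \<gamma>"
  proof
    show "inj_on \<phi> (\<Union>(edge_set G))" using inj Union_edge_set by (rule inj_on_subset)
    show "Path_Connected.arc (\<gamma> e)" if "e \<in> edge_set G" for e
      using that arcs by (auto simp: edge_set_def)
    show "{pathstart (\<gamma> e), pathfinish (\<gamma> e)} = \<phi> ` e" if e: "e \<in> edge_set G" for e
    proof -
      obtain u v where uv: "(u, v) \<in> parcs G" "e = {u, v}" using e by (auto simp: edge_set_def)
      show ?thesis using arcs[OF uv(1)] unfolding uv(2) by simp
    qed
    show "path_image (\<gamma> e) \<inter> path_image (\<gamma> e') = \<phi> ` (e \<inter> e')"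
      if e: "e \<in> edge_set G" "e' \<in> edge_set G" "e \<noteq> e'" for e e'
    proof -
      obtain u v where uv: "(u, v) \<in> parcs G" "e = {u, v}" using e(1) by (auto simp: edge_set_def)
      obtain x y where xy: "(x, y) \<in> parcs G" "e' = {x, y}" using e(2) by (auto simp: edge_set_def)
      show ?thesis using meet[OF uv(1) xy(1)] e(3) unfolding uv(2) xy(2) by blast
    qed
  qed (use finite_edges card_edge in auto)
  then show thesis by (rule that)
qed

lemma peel_edge_set:
  assumes "pair_graph G" "planar G" "32 \<le> max_degree G"
    and "\<not> contains_cycle G 4" "\<not> contains_cycle G 5"
  shows "peel (edge_set G) (max_degree G + 2) (pverts G)"
proof -
  interpret pair_graph G by fact
  interpret simple_edges "edge_set G" by (rule simple_edges_edge_set)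
  obtain \<phi> \<gamma> where plane: "plane_graph (edge_set G) \<phi> \<gamma>" using planar_plane_graph assms(1,2) by blast
  have cyc: "\<not> has_cycle (edge_set G) 4" "\<not> has_cycle (edge_set G) 5"
    using contains_cycleI assms(4,5) by blast+
  have "sparse_edges (edge_set G) (max_degree G)"
  proof
    show "4 * card H < 6 * card (\<Union>H) + 3 * card (triangles H)"
      if H: "H \<subseteq> edge_set G" "H \<noteq> {}" for H
    proof -
      have "\<not> has_cycle H 4" "\<not> has_cycle H 5" using cyc has_cycle_mono[OF _ H(1)] by blast+
      then show ?thesis
        using plane_graph.edge_bound[OF plane_graph.plane_subgraph[OF plane H(1)] H(2)] by blast
    qed
  qed (use assms(3) cyc deg_edge_set_le in auto)
  then show ?thesis using pair_finite_verts Union_edge_set by (rule peel_sparse)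
qed

lemma (in pair_graph) choosable_square:
  assumes "peel (edge_set G) m (pverts G)"
  shows "choosable (square G) (m + 1)"
  unfolding choosable_def
proof (intro allI impI)
  interpret simple_edges "edge_set G" by (rule simple_edges_edge_set)
  fix L :: "'a \<Rightarrow> nat set"
  assume L: "\<forall>v \<in> pverts (square G). finite (L v) \<and> card (L v) = m + 1"
  have pv: "pverts (square G) = pverts G" by (simp add: square_def)
  have "finite (L v) \<and> m < card (L v)" if "v \<in> pverts G" for v using L that unfolding pv by simp
  from peel_coloring[of m "pverts G" L "\<lambda>_. 0 :: nat", OF assms this]
  obtain f where f: "\<And>v. v \<in> pverts G \<Longrightarrow> f v \<in> L v"
    "\<And>v w. v \<in> pverts G \<Longrightarrow> w \<in> nbs2 (edge_set G) v \<Longrightarrow> f w \<noteq> f v" by blast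
  have "f u \<noteq> f v" if "(u, v) \<in> parcs (square G)" for u v
  proof -
    have "u \<in> pverts G" using that in_arcsD1 by (auto simp: square_def)
    then show ?thesis using f(2) square_arcs[OF that] by metis
  qed
  then show "\<exists>f. list_coloring (square G) L f"
    unfolding list_coloring_def pv using f(1) by (intro exI[of _ f]) auto
qed

text \<open>Painter always paints a kernel of the presented set. Whenever \<open>v\<close> is passed
  over, a neighbour of higher rank is painted, a new one each time as painted vertices are not
  presented again. There are at most \<open>m\<close> of them.\<close>

lemma (in pair_graph) paintable_square:
  assumes "peel (edge_set G) m (pverts G)"
  shows "paintable (square G) (m + 1)"
proof -
  interpret simple_edges "edge_set G" by (rule simple_edges_edge_set)
  let ?N = "nbs2 (edge_set G)"
  have pv: "pverts (square G) = pverts G" by (simp add: square_def)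
  obtain \<rho> :: "'a \<Rightarrow> nat" where inj: "inj_on \<rho> (pverts G)" and
    rank: "\<And>v. v \<in> pverts G \<Longrightarrow> card {w \<in> ?N v. w \<in> pverts G \<longrightarrow> \<rho> v < \<rho> w} \<le> m"
    using peel_rank[OF assms] by blast
  define K where "K M = (SOME I. I \<subseteq> M \<and> (\<forall>x \<in> I. \<forall>y \<in> I. y \<notin> ?N x) \<and>
    (\<forall>v \<in> M - I. \<exists>w \<in> I. w \<in> ?N v \<and> \<rho> v < \<rho> w))" for M
  have K: "K M \<subseteq> M \<and> (\<forall>x \<in> K M. \<forall>y \<in> K M. y \<notin> ?N x) \<and>
    (\<forall>v \<in> M - K M. \<exists>w \<in> K M. w \<in> ?N v \<and> \<rho> v < \<rho> w)" if M: "M \<subseteq> pverts G" for M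
  proof -
    have "finite M" using M pair_finite_verts by (rule finite_subset)
    then have "\<exists>I. I \<subseteq> M \<and> (\<forall>x \<in> I. \<forall>y \<in> I. y \<notin> ?N x) \<and>
      (\<forall>v \<in> M - I. \<exists>w \<in> I. w \<in> ?N v \<and> \<rho> v < \<rho> w)"
      using greedy_independent[of M \<rho>] inj_on_subset[OF inj M] by blast
    then show ?thesis unfolding K_def by (rule someI_ex)
  qed
  define \<sigma> where "\<sigma> Ss = K (last Ss)" for Ss
  have \<sigma>_take: "\<sigma> (take (Suc i) Ss) = K (Ss ! i)" if "i < length Ss" for i Ss
    using that by (simp add: \<sigma>_def take_Suc_conv_app_nth)
  have "winning_painter_strategy (square G) (m + 1) \<sigma>"
    unfolding winning_painter_strategy_def
  proof (intro allI impI conjI)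
    fix Ss assume legal: "legal_history (square G) \<sigma> Ss"
    have sub: "Ss ! i \<subseteq> pverts G - painted \<sigma> (take i Ss)" if "i < length Ss" for i
      using legal that unfolding legal_history_def pv by blast
    {
      assume ne: "Ss \<noteq> []"
      have "last Ss \<subseteq> pverts G" using sub[of "length Ss - 1"] ne by (auto simp: last_conv_nth)
      note KS = K[OF this]
      show "\<sigma> Ss \<subseteq> last Ss" using KS by (simp add: \<sigma>_def)
      show "independent_set (square G) (\<sigma> Ss)"
        unfolding independent_set_def pv \<sigma>_def
        using KS \<open>last Ss \<subseteq> pverts G\<close> square_arcs by blast
    }
    show "\<not> lister_has_won (square G) (m + 1) \<sigma> Ss"
    proof
      assume "lister_has_won (square G) (m + 1) \<sigma> Ss"
      then obtain v where v: "v \<in> pverts G" "m + 1 \<le> times_listed v Ss" "v \<notin> painted \<sigma> Ss"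
        unfolding lister_has_won_def pv by blast
      let ?I = "{i. i < length Ss \<and> v \<in> Ss ! i}"
      have "\<exists>w \<in> K (Ss ! i). w \<in> ?N v \<and> \<rho> v < \<rho> w" if i: "i \<in> ?I" for i
      proof -
        have "v \<notin> K (Ss ! i)"
          using v(3) i \<sigma>_take[of i Ss] unfolding painted_def by blast
        moreover have "Ss ! i \<subseteq> pverts G" using sub[of i] i by blast
        ultimately show ?thesis using K[of "Ss ! i"] i by blast
      qed
      then obtain w where w: "\<And>i. i \<in> ?I \<Longrightarrow> w i \<in> K (Ss ! i) \<and> w i \<in> ?N v \<and> \<rho> v < \<rho> (w i)"
        by metis
      \<comment> \<open>\<open>w i\<close> is painted in round \<open>i\<close>, so Lister may not
        present it in round \<open>j\<close>.\<close>
      have later: "w i \<noteq> w j" if ij: "i \<in> ?I" "j \<in> ?I" "i < j" for i j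
      proof
        assume eq: "w i = w j"
        have "w j \<in> Ss ! j" using w[OF ij(2)] K[of "Ss ! j"] sub[of j] ij(2) by blast
        then have "w j \<notin> painted \<sigma> (take j Ss)" using sub[of j] ij(2) by blast
        moreover have "\<sigma> (take (Suc i) (take j Ss)) = K (Ss ! i)"
          using \<sigma>_take[of i Ss] ij by (simp add: min_def)
        then have "K (Ss ! i) \<subseteq> painted \<sigma> (take j Ss)"
          unfolding painted_def using ij by force
        ultimately show False using w[OF ij(1)] eq by auto
      qed
      have "inj_on w ?I"
      proof (rule inj_onI, rule ccontr)
        fix i j assume "i \<in> ?I" "j \<in> ?I" "w i = w j" "i \<noteq> j"
        then show False using later[of i j] later[of j i] by (cases "i < j") auto
      qed
      then have "times_listed v Ss = card (w ` ?I)" unfolding times_listed_def by (simp add: card_image)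
      also have "\<dots> \<le> card {w \<in> ?N v. w \<in> pverts G \<longrightarrow> \<rho> v < \<rho> w}"
        using w finite_nbs2 by (intro card_mono) auto
      also have "\<dots> \<le> m" using v(1) by (rule rank)
      finally show False using v(2) by simp
    qed
  qed
  then show ?thesis unfolding paintable_def by blast
qed

theorem corollary1:
  fixes G :: "'a pair_pre_digraph"
  assumes "pair_graph G"
    and "planar G"
    and "max_degree G \<ge> 32"
    and "\<not> contains_cycle G 4"
    and "\<not> contains_cycle G 5"
  shows "list_chromatic_number (square G) \<le> max_degree G + 3
    \<and> paint_number (square G) \<le> max_degree G + 3"
proof -
  interpret pair_graph G by fact
  have "peel (edge_set G) (max_degree G + 2) (pverts G)" using assms by (rule peel_edge_set)
  then have "choosable (square G) (max_degree G + 3)" "paintable (square G) (max_degree G + 3)"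
    using choosable_square[of "max_degree G + 2"] paintable_square[of "max_degree G + 2"]
    by (simp_all add: numeral_3_eq_3)
  then show ?thesis
    unfolding list_chromatic_number_def paint_number_def by (auto intro: Least_le)
qed

end
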